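(* For every weak composition $\mathbf b\in\mathbb N^n$, \[ \kappa_{\mathbf b}=\sum_{\mathbf a\in\mathbb N^n}\tilde K^{-1}_{\mathbf a\mathbf b}\,\mathfrak h_{\mathbf a}, \qquad \tilde K^{-1}_{\mathbf a\mathbf b}=\sum_U\operatorname{sgn}(U), \] where the sum is over special snake tabloids $U$ of weight $\mathbf a$ and shape $\mathbf b$.
   Context: Fix $n\ge1$, $[n]=\{1,\dots,n\}$, weak compositions in $\mathbb N^n$, $x^{\mathbf a}=\prod_ix_i^{\mathbf a_i}$. $h_k(x_1,\dots,x_i)=\sum_{1\le i_1\le\cdots\le i_k\le i}x_{i_1}\cdots x_{i_k}$, $\mathfrak h_{\mathbf a}=\prod_{i\ge1}h_{\mathbf a_i}(x_1,\dots,x_i)$. Cells $(c,r)$: column $c$, row $r$, row 1 at the bottom. Key diagram $\mathbb D(\mathbf a)=\{(c,r)\in\mathbb Z_{>0}\times[n]:c\le\mathbf a_r\}$. A filling $T:\mathbb D(\mathbf a)\to[n]$ has shape $\mathbf a$ and weight $\mathrm{wt}(T)_i=|T^{-1}(i)|$; $\hat T$ extends $T$ to $\mathbb D(\mathbf a)\sqcup\{(0,1),\dots,(0,n)\}$ by $\hat T(0,i)=i$. Two cells attack if in the same column, or in adjacent columns with the left one strictly higher. A semi-standard key tableau (SSKT) is a filling such that no two attacking cells of $\hat T$ have equal entries, entries of $\hat T$ weakly decrease left to right along each row, and there is no co-inversion triple: three cells with distinct entries either of the form $(c,r),(c+1,r),(c,s)$ with $r<s$, $\mathbf a_r>\mathbf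 a_s$, or $(c+1,r),(c,s),(c+1,s)$ with $r<s$, $\mathbf a_r\le\mathbf a_s$ ($c\ge0$), such that with $k,i$ the left and right entries of the two cells in the same row and $j$ the third entry, $i<j<k$ or $j<k<i$ or $k<i<j$. The key polynomial is $\kappa_{\mathbf a}=\sum x^{\mathrm{wt}(T)}$ over SSKT of shape $\mathbf a$. Key poset: $\mathbf a\preceq\mathbf b$ iff $\mathbf a_i\le\mathbf b_i$ for all $i$, and $\mathbf a_i>\mathbf a_j$ with $i<j$ implies $\mathbf b_i>\mathbf b_j$. Two cells are weakly connected if they share a column or lie in adjacent columns with the left cell weakly higher; a set of cells is weakly connected if it forms a single class under the transitive closure of this relation. A snake of $\mathbf b$ is $S\subseteq\mathbb D(\mathbf b)$ such that (1) $S$ is weakly connected, (2) $\mathbb D(\mathbf b)\setminus S=\mathbb D(\mathbf a)$ for some $\mathbf a\preceq\mathbf b$, (3) $S$ contains no three cells $(c,s),(c+1,s),(c+1,r)$ with $r<s$. A snake is special if it is empty or contains the lowest cell of column 1 of the key diagram. A special snake tabloid $U=(S_1,\dots,S_n)$ of shape $\mathbf b$ is a decomposition $\mathbb D(\mathbf b)=S_1\sqcup\cdots\sqcup S_n$ such that each $S_i$ is a special snake of the key diagram $\mathbb D(\mathbf b)\setminus(S_1\sqcup\cdots\sqcup S_{i-1})$, with $S_i=\emptyset$ if and only if row $i$ of that diagram is empty. Its weight is $(|S_1|,\dots,|S_n|)$. The height of a snake is the number of rows containing a cell of it (height of $\emptyset$ is 1), its sign is $(-1)^{\mathrm{height}-1}$,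 and $\operatorname{sgn}(U)$ is the product of the signs of its snakes. *)

theory Defs
  imports "HOL-Library.Poly_Mapping" "HOL-Library.FuncSet" "HOL-Library.Disjoint_Sets"
begin

section \<open>Polynomials and weak compositions\<close>

text \<open>A polynomial with integer coefficients is a finitely supported map from exponents to
  coefficients, with the convolution product of \<^theory>\<open>HOL-Library.Poly_Mapping\<close>.\<close>

type_synonym int_mpoly = "(nat \<Rightarrow>\<^sub>0 nat) \<Rightarrow>\<^sub>0 int"

definition X :: "nat \<Rightarrow> int_mpoly" where
  "X i = Poly_Mapping.single (Poly_Mapping.single i 1) 1"

text \<open>A weak composition in \<open>\<nat>\<^sup>n\<close> is a function on the positive integers; it is set to zero
  outside \<open>{1..n}\<close> so that each tuple has exactly one representative.\<close>

definition weak_comps :: "nat \<Rightarrow> (nat \<Rightarrow> nat) set" where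
  "weak_comps n = {a. \<forall>i. i \<notin> {1..n} \<longrightarrow> a i = 0}"

definition x_pow :: "nat \<Rightarrow> (nat \<Rightarrow> nat) \<Rightarrow> int_mpoly" where
  "x_pow n a = (\<Prod>i\<in>{1..n}. X i ^ a i)"

text \<open>The index sequences \<open>1 \<le> i\<^sub>1 \<le> \<dots> \<le> i\<^sub>k \<le> i\<close> are sorted lists.\<close>

definition complete_hom :: "nat \<Rightarrow> nat \<Rightarrow> int_mpoly" where
  "complete_hom k i =
     (\<Sum>js | length js = k \<and> sorted js \<and> set js \<subseteq> {1..i}. prod_list (map X js))"

definition flag_hom :: "nat \<Rightarrow> (nat \<Rightarrow> nat) \<Rightarrow> int_mpoly" where
  "flag_hom n a = (\<Prod>i\<in>{1..n}. complete_hom (a i) i)"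

section \<open>Key tableaux and key polynomials\<close>

text \<open>A cell is a pair (column, row); row 1 is at the bottom.\<close>

type_synonym cell = "nat \<times> nat"

definition key_diagram :: "nat \<Rightarrow> (nat \<Rightarrow> nat) \<Rightarrow> cell set" where
  "key_diagram n a = {(c, r). 1 \<le> c \<and> r \<in> {1..n} \<and> c \<le> a r}"

definition ext_diagram :: "nat \<Rightarrow> (nat \<Rightarrow> nat) \<Rightarrow> cell set" where
  "ext_diagram n a = key_diagram n a \<union> {0} \<times> {1..n}"

text \<open>Fillings are extensional functions on the diagram, so that they can be counted.\<close>

definition fillings :: "nat \<Rightarrow> (nat \<Rightarrow> nat) \<Rightarrow> (cell \<Rightarrow> nat) set" where
  "fillings n a = key_diagram n a \<rightarrow>\<^sub>E {1..n}"

definition filling_weight :: "nat \<Rightarrow> (nat \<Rightarrow> nat) \<Rightarrow> (cell \<Rightarrow> nat) \<Rightarrow> nat \<Rightarrow> nat" where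
  "filling_weight n a T i = card {x \<in> key_diagram n a. T x = i}"

definition ext_filling :: "(cell \<Rightarrow> nat) \<Rightarrow> cell \<Rightarrow> nat" where
  "ext_filling T = (\<lambda>(c, r). if c = 0 then r else T (c, r))"

definition attacks :: "cell \<Rightarrow> cell \<Rightarrow> bool" where
  "attacks = (\<lambda>(c, r) (c', r').
     (c = c' \<and> r \<noteq> r') \<or> (c' = c + 1 \<and> r > r') \<or> (c = c' + 1 \<and> r' > r))"

text \<open>The inequalities force the three entries to be distinct.\<close>

definition coinv_order :: "nat \<Rightarrow> nat \<Rightarrow> nat \<Rightarrow> bool" where
  "coinv_order i j k \<longleftrightarrow> (i < j \<and> j < k) \<or> (j < k \<and> k < i) \<or> (k < i \<and> i < j)"

definition has_coinversion_triple :: "nat \<Rightarrow> (nat \<Rightarrow> nat) \<Rightarrow> (cell \<Rightarrow> nat) \<Rightarrow> bool" where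
  "has_coinversion_triple n a T \<longleftrightarrow> (\<exists>c r s. r < s \<and>
     (a r > a s \<and> {(c, r), (c + 1, r), (c, s)} \<subseteq> ext_diagram n a \<and>
        coinv_order (ext_filling T (c + 1, r)) (ext_filling T (c, s)) (ext_filling T (c, r))
      \<or> a r \<le> a s \<and> {(c + 1, r), (c, s), (c + 1, s)} \<subseteq> ext_diagram n a \<and>
        coinv_order (ext_filling T (c + 1, s)) (ext_filling T (c + 1, r)) (ext_filling T (c, s))))"

definition SSKT :: "nat \<Rightarrow> (nat \<Rightarrow> nat) \<Rightarrow> (cell \<Rightarrow> nat) set" where
  "SSKT n a = {T \<in> fillings n a.
     (\<forall>x\<in>ext_diagram n a. \<forall>y\<in>ext_diagram n a.
        attacks x y \<longrightarrow> ext_filling T x \<noteq> ext_filling T y) \<and>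
     (\<forall>c d r. c \<le> d \<and> (c, r) \<in> ext_diagram n a \<and> (d, r) \<in> ext_diagram n a \<longrightarrow>
        ext_filling T (d, r) \<le> ext_filling T (c, r)) \<and>
     \<not> has_coinversion_triple n a T}"

definition key_polynomial :: "nat \<Rightarrow> (nat \<Rightarrow> nat) \<Rightarrow> int_mpoly" where
  "key_polynomial n a = (\<Sum>T\<in>SSKT n a. x_pow n (filling_weight n a T))"

section \<open>Snakes and special snake tabloids\<close>

definition key_le :: "nat \<Rightarrow> (nat \<Rightarrow> nat) \<Rightarrow> (nat \<Rightarrow> nat) \<Rightarrow> bool" where
  "key_le n a b \<longleftrightarrow> (\<forall>i\<in>{1..n}. a i \<le> b i) \<and>
     (\<forall>i\<in>{1..n}. \<forall>j\<in>{1..n}. i < j \<and> a i > a j \<longrightarrow> b i > b j)"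

definition cells_weakly_connected :: "cell \<Rightarrow> cell \<Rightarrow> bool" where
  "cells_weakly_connected = (\<lambda>(c, r) (c', r').
     c = c' \<or> (c' = c + 1 \<and> r \<ge> r') \<or> (c = c' + 1 \<and> r' \<ge> r))"

text \<open>The empty set counts as weakly connected: the empty snake is allowed.\<close>

definition weakly_connected :: "cell set \<Rightarrow> bool" where
  "weakly_connected S \<longleftrightarrow>
     (\<forall>x\<in>S. \<forall>y\<in>S. (x, y) \<in> {(u, v). u \<in> S \<and> v \<in> S \<and> cells_weakly_connected u v}\<^sup>+)"

definition snake :: "nat \<Rightarrow> (nat \<Rightarrow> nat) \<Rightarrow> cell set \<Rightarrow> bool" where
  "snake n b S \<longleftrightarrow> S \<subseteq> key_diagram n b \<and> weakly_connected S \<and>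
     (\<exists>a\<in>weak_comps n. key_le n a b \<and> key_diagram n b - S = key_diagram n a) \<and>
     \<not> (\<exists>c r s. r < s \<and> {(c, s), (c + 1, s), (c + 1, r)} \<subseteq> S)"

definition special_snake :: "nat \<Rightarrow> (nat \<Rightarrow> nat) \<Rightarrow> cell set \<Rightarrow> bool" where
  "special_snake n b S \<longleftrightarrow> snake n b S \<and>
     (S = {} \<or> (1, LEAST r. (1, r) \<in> key_diagram n b) \<in> S)"

text \<open>The composition \<open>d\<close> describes the key diagram that remains once the first \<open>i - 1\<close> snakes
  have been removed.\<close>

definition special_snake_tabloids :: "nat \<Rightarrow> (nat \<Rightarrow> nat) \<Rightarrow> (nat \<Rightarrow> cell set) set" where
  "special_snake_tabloids n b = {U \<in> {1..n} \<rightarrow>\<^sub>E Pow (key_diagram n b).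
     disjoint_family_on U {1..n} \<and> (\<Union>i\<in>{1..n}. U i) = key_diagram n b \<and>
     (\<forall>i\<in>{1..n}. \<exists>d\<in>weak_comps n.
        key_diagram n d = key_diagram n b - (\<Union>j\<in>{1..<i}. U j) \<and>
        special_snake n d (U i) \<and>
        (U i = {} \<longleftrightarrow> (\<forall>c. (c, i) \<notin> key_diagram n d)))}"

definition tabloid_weight :: "nat \<Rightarrow> (nat \<Rightarrow> cell set) \<Rightarrow> nat \<Rightarrow> nat" where
  "tabloid_weight n U i = (if i \<in> {1..n} then card (U i) else 0)"

definition snake_height :: "cell set \<Rightarrow> nat" where
  "snake_height S = (if S = {} then 1 else card (snd ` S))"

definition snake_sign :: "cell set \<Rightarrow> int" where
  "snake_sign S = (- 1) ^ (snake_height S - 1)"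

definition tabloid_sign :: "nat \<Rightarrow> (nat \<Rightarrow> cell set) \<Rightarrow> int" where
  "tabloid_sign n U = (\<Prod>i\<in>{1..n}. snake_sign (U i))"

definition inv_kostka :: "nat \<Rightarrow> (nat \<Rightarrow> nat) \<Rightarrow> (nat \<Rightarrow> nat) \<Rightarrow> int" where
  "inv_kostka n a b =
     (\<Sum>U | U \<in> special_snake_tabloids n b \<and> tabloid_weight n U = a. tabloid_sign n U)"

section \<open>Finiteness of the index sets\<close>

text \<open>A sum over an infinite set is zero by convention; the following facts show that all sums
  above, and the sum of \<open>inv_kostka n a b\<close> over its support in \<open>a\<close>, are genuine finite sums.\<close>

lemma finite_complete_hom_index:
  "finite {js. length js = k \<and> sorted js \<and> set js \<subseteq> {1..i::nat}}"
  by (rule finite_subset[OF _ finite_lists_length_eq[of "{1..i}" k]]) auto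

lemma finite_key_diagram: "finite (key_diagram n a)"
proof -
  have "key_diagram n a \<subseteq> (\<Union>r\<in>{1..n}. {1..a r} \<times> {r})"
    by (auto simp: key_diagram_def)
  then show ?thesis
    by (rule finite_subset) auto
qed

lemma finite_SSKT: "finite (SSKT n a)"
  by (rule finite_subset[of _ "key_diagram n a \<rightarrow>\<^sub>E {1..n}"])
    (auto simp: SSKT_def fillings_def intro!: finite_PiE finite_key_diagram)

lemma finite_special_snake_tabloids: "finite (special_snake_tabloids n b)"
  by (rule finite_subset[of _ "{1..n} \<rightarrow>\<^sub>E Pow (key_diagram n b)"])
    (auto simp: special_snake_tabloids_def intro!: finite_PiE finite_key_diagram)

lemma finite_inv_kostka_support: "finite {a. inv_kostka n a b \<noteq> 0}"
proof (rule finite_subset)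
  show "{a. inv_kostka n a b \<noteq> 0} \<subseteq> tabloid_weight n ` special_snake_tabloids n b"
  proof
    fix a assume "a \<in> {a. inv_kostka n a b \<noteq> 0}"
    then obtain U where "U \<in> special_snake_tabloids n b" "tabloid_weight n U = a"
      unfolding inv_kostka_def
      by (auto elim: sum.not_neutral_contains_not_neutral)
    then show "a \<in> tabloid_weight n ` special_snake_tabloids n b"
      by auto
  qed
qed (simp add: finite_special_snake_tabloids)

end

theory Submission
  imports Defs "HOL-Computational_Algebra.Polynomial"
begin

text \<open>
  Erasing the smallest letter of a key tableau deletes a strip: a row \<open>s\<close> may be shortened from
  \<open>b s\<close> to \<open>d s\<close> only if \<open>b r \<le> d s\<close> or \<open>b s < d r\<close> for all lower rows \<open>r\<close>.  So a key polynomial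
  is an iterate of operators \<open>H(x)\<close> that delete strips, with weight \<open>x\<close> per cell.  Let \<open>N(m)\<close> be
  the signed sum over the deletions of special snakes with \<open>m\<close> cells.  The heart of the proof is the
  commutation relation \<open>N(m) H(x) = H(x) N(m) - x H(x) N(m + 1)\<close>.  Mark \<open>m\<close> by a variable \<open>y\<close> and
  scan the columns from right to left: the partial sums of both sides, indexed by the rows cut in
  the current column, satisfy linear relations that propagate to the next column, because sums over
  initial segments of the rows ending there telescope.  Since
  \<open>h(m; k..i) - x\<^sub>k h(m - 1; k..i) = h(m; k + 1..i)\<close> for the complete homogeneous polynomials in
  \<open>x\<^sub>k, \<dots>, x\<^sub>i\<close>, the relation moves the sum of \<open>h(m; 1..i) N(m)\<close> over \<open>m\<close> through
  \<open>H(x\<^sub>1), \<dots>, H(x\<^sub>i)\<close>, where only \<open>N(0)\<close> is left, the condition that row \<open>i\<close> has become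
  empty.  This expands a key polynomial along its lowest nonempty row \<open>i\<close>; iterating the expansion
  produces the tabloids.
\<close>

section \<open>Alternating sums over initial segments\<close>

text \<open>A strip and a snake do not commute term by term: the operation that acts second meets
  rows that the other has already shortened. Both orders agree only after all choices within a
  column have been summed, and equality of the two complete sums is too weak to survive the step to
  another column. The invariant therefore also compares sums in which some rows were cut one column
  further right, by either operation; the five linear relations of \<open>exchanges\<close> form a
  family that reproduces itself.

  The factor \<open>y - x\<close> is a generating function: multiply the commutation relation by
  \<open>y ^ (m + 1)\<close> and sum over \<open>m\<close>. While row \<open>i\<close> is nonempty,
  \<open>N(0)\<close> vanishes, so a factor \<open>y\<close> on the side where the snake acts first
  is matched by \<open>y - x\<close> on the other side. \<open>end_weight\<close> installs this at
  the left end. The induction gives the equality only up to one more factor \<open>y - x\<close>,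
  which is cancelled at the end, where \<open>y\<close> is an indeterminate over an integral
  domain.\<close>

definition initial_segments :: "nat set \<Rightarrow> nat set set" where
  "initial_segments C = {L. L \<subseteq> C \<and> (\<forall>s\<in>L. \<forall>r\<in>C. r < s \<longrightarrow> r \<in> L)}"

text \<open>The weight is that of a snake which cuts exactly the rows of \<open>L\<close>, all for
  the first time: each cut cell contributes \<open>y\<close> and each new row contributes
  \<open>-1\<close>.\<close>

definition isum :: "'a::comm_ring_1 \<Rightarrow> nat set \<Rightarrow> (nat set \<Rightarrow> 'a) \<Rightarrow> 'a" where
  "isum y C g = (\<Sum>L\<in>initial_segments C. (- y) ^ card L * g L)"

lemma finite_initial_segments [simp]: "finite C \<Longrightarrow> finite (initial_segments C)"
  by (rule finite_subset[of _ "Pow C"]) (auto simp: initial_segments_def)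

lemma initial_segments_empty [simp]: "initial_segments {} = {{}}"
  by (auto simp: initial_segments_def)

lemma initial_segmentsD: "L \<in> initial_segments C \<Longrightarrow> L \<subseteq> C"
  by (simp add: initial_segments_def)

lemma isum_empty [simp]: "isum y {} g = g {}"
  by (simp add: isum_def)

lemma isum_cong:
  "(\<And>L. L \<in> initial_segments C \<Longrightarrow> g L = h L) \<Longrightarrow> isum y C g = isum y C h"
  by (auto simp: isum_def intro!: sum.cong)

lemma isum_add: "isum y C (\<lambda>L. g L + h L) = isum y C g + isum y C h"
  by (simp add: isum_def algebra_simps sum.distrib)

lemma isum_diff: "isum y C (\<lambda>L. g L - h L) = isum y C g - isum y C h"
  by (simp add: isum_def algebra_simps sum_subtractf)

lemma isum_mult: "isum y C (\<lambda>L. k * g L) = k * isum y C g"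
  by (simp add: isum_def sum_distrib_left mult_ac)

lemma isum_delta:
  assumes "finite C"
  shows "isum y C (\<lambda>L. if L = {} then k else 0) = k"
proof -
  have "{} \<in> initial_segments C"
    by (simp add: initial_segments_def)
  then show ?thesis
    using assms by (simp add: isum_def if_distrib sum.delta cong: if_cong)
qed

lemma initial_segments_split:
  assumes "\<And>b c. b \<in> B \<Longrightarrow> c \<in> C \<Longrightarrow> b < c"
  shows "initial_segments (B \<union> C) =
    initial_segments B \<union> (\<union>) B ` (initial_segments C - {{}})" (is "?l = ?r")
proof (intro equalityI subsetI)
  fix L assume L: "L \<in> ?l"
  show "L \<in> ?r"
  proof (cases "L \<inter> C = {}")
    case True
    with L have "L \<in> initial_segments B"
      unfolding initial_segments_def by blast
    then show ?thesis by blast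
  next
    case False
    then obtain c where "c \<in> L" "c \<in> C" by auto
    with L assms have "B \<subseteq> L" by (auto simp: initial_segments_def)
    then have "L = B \<union> (L \<inter> C)" using L by (auto simp: initial_segments_def)
    moreover have "L \<inter> C \<in> initial_segments C - {{}}"
      using L False by (auto simp: initial_segments_def)
    ultimately show ?thesis by blast
  qed
next
  fix L assume "L \<in> ?r"
  then show "L \<in> ?l"
  proof
    assume "L \<in> initial_segments B"
    then have "L \<subseteq> B" "\<And>s r. s \<in> L \<Longrightarrow> r \<in> B \<Longrightarrow> r < s \<Longrightarrow> r \<in> L"
      by (auto simp: initial_segments_def)
    moreover have "\<not> r < s" if "s \<in> L" "r \<in> C" for r s
      using that assms[of s r] \<open>L \<subseteq> B\<close> by auto
    ultimately show ?thesis unfolding initial_segments_def by blast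
  next
    assume "L \<in> (\<union>) B ` (initial_segments C - {{}})"
    then obtain M where M: "L = B \<union> M" "M \<subseteq> C" "\<And>s r. s \<in> M \<Longrightarrow> r \<in> C \<Longrightarrow> r < s \<Longrightarrow> r \<in> M"
      by (auto simp: initial_segments_def)
    moreover have "\<not> r < s" if "s \<in> B" "r \<in> C" for r s
      using that assms[of s r] by auto
    ultimately show ?thesis unfolding initial_segments_def by blast
  qed
qed

text \<open>An initial segment that reaches into the upper block \<open>C\<close> contains all of
  \<open>B\<close>. The value at \<open>L = {}\<close> is masked in the second sum because the
  segment \<open>B\<close> already occurs in the first.\<close>

lemma isum_split:
  assumes "finite B" "finite C" and lt: "\<And>b c. b \<in> B \<Longrightarrow> c \<in> C \<Longrightarrow> b < c"
  shows "isum y (B \<union> C) g =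
    isum y B g + (- y) ^ card B * isum y C (\<lambda>L. if L = {} then 0 else g (B \<union> L))"
proof -
  have disj: "B \<inter> C = {}" using lt by blast
  have d2: "initial_segments B \<inter> (\<union>) B ` (initial_segments C - {{}}) = {}"
  proof -
    have "L = {}" if "L \<subseteq> C" "B \<union> L \<subseteq> B" for L
      using that disj by blast
    then show ?thesis by (auto dest!: initial_segmentsD)
  qed
  have inj: "inj_on ((\<union>) B) (initial_segments C - {{}})"
  proof (rule inj_onI)
    fix L M assume "L \<in> initial_segments C - {{}}" "M \<in> initial_segments C - {{}}"
      and eq: "B \<union> L = B \<union> M"
    then have "L \<subseteq> C" "M \<subseteq> C" by (auto dest: initial_segmentsD)
    with eq disj show "L = M" by blast
  qed
  have "isum y (B \<union> C) g = isum y B g +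
      (\<Sum>L\<in>initial_segments C - {{}}. (- y) ^ card (B \<union> L) * g (B \<union> L))"
    unfolding isum_def initial_segments_split[of B C, OF lt, simplified]
    using assms(1,2) d2 by (subst sum.union_disjoint) (auto simp: sum.reindex[OF inj])
  also have "(\<Sum>L\<in>initial_segments C - {{}}. (- y) ^ card (B \<union> L) * g (B \<union> L)) =
     (\<Sum>L\<in>initial_segments C - {{}}. (- y) ^ card B * ((- y) ^ card L * g (B \<union> L)))"
  proof (rule sum.cong[OF refl])
    fix L assume "L \<in> initial_segments C - {{}}"
    then have "L \<subseteq> C" by (auto simp: initial_segments_def)
    then have "card (B \<union> L) = card B + card L"
      using assms(1,2) disj by (intro card_Un_disjoint) (auto intro: finite_subset)
    then show "(- y) ^ card (B \<union> L) * g (B \<union> L) = (- y) ^ card B * ((- y) ^ card L * g (B \<union> L))"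
      by (simp add: power_add mult_ac)
  qed
  also have "\<dots> = (- y) ^ card B * isum y C (\<lambda>L. if L = {} then 0 else g (B \<union> L))"
    unfolding isum_def sum_distrib_left using assms(2)
    by (intro sum.mono_neutral_cong_left) auto
  finally show ?thesis .
qed

lemma isum_insert_min:
  assumes "finite C" and lt: "\<And>c. c \<in> C \<Longrightarrow> m < c"
  shows "isum y (insert m C) g = g {} - y * isum y C (\<lambda>L. g (insert m L))"
proof -
  have seg: "initial_segments {m} = {{}, {m}}"
    by (auto simp: initial_segments_def)
  have "isum y (insert m C) g = isum y ({m} \<union> C) g" by simp
  also have "\<dots> = isum y {m} g + (- y) ^ card {m} *
      isum y C (\<lambda>L. if L = {} then 0 else g ({m} \<union> L))"
    using assms by (intro isum_split) auto
  also have "isum y {m} g = g {} - y * g {m}"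
    by (simp add: isum_def seg)
  also have "isum y C (\<lambda>L. if L = {} then 0 else g ({m} \<union> L)) =
     isum y C (\<lambda>L. g (insert m L) - (if L = {} then g {m} else 0))"
    by (rule isum_cong) auto
  also have "\<dots> = isum y C (\<lambda>L. g (insert m L)) - g {m}"
    by (simp add: isum_diff isum_delta[OF assms(1)])
  finally show ?thesis by (simp add: algebra_simps)
qed

lemma isum_split_insert:
  assumes "finite B" "finite C" "\<And>b. b \<in> B \<Longrightarrow> b < v" "\<And>c. c \<in> C \<Longrightarrow> v < c"
  shows "isum y (insert v (B \<union> C)) g =
    isum y B g - y * (- y) ^ card B * isum y C (\<lambda>L. g (insert v (B \<union> L)))"
proof -
  have "isum y (insert v (B \<union> C)) g = isum y (B \<union> insert v C) g" by simp
  also have "\<dots> = isum y B g +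
      (- y) ^ card B * isum y (insert v C) (\<lambda>L. if L = {} then 0 else g (B \<union> L))"
    using assms by (intro isum_split) (auto dest: less_trans)
  also have "isum y (insert v C) (\<lambda>L. if L = {} then 0 else g (B \<union> L)) =
      - y * isum y C (\<lambda>L. g (insert v (B \<union> L)))"
    using assms by (subst isum_insert_min) auto
  finally show ?thesis by (simp add: algebra_simps)
qed

text \<open>Every proper initial segment \<open>L\<close> has one successor, obtained by adding the
  least missing element. Under the weight \<open>(- y) ^ card L\<close> the first summand at
  \<open>L\<close> is the negative of the second summand at its successor, so neighbours cancel. The
  induction peels off the minimum \<open>m\<close> and applies the hypothesis to \<open>g\<close>
  precomposed with \<open>insert m\<close>.\<close>

lemma isum_telescope:
  assumes "finite C"
  shows "isum y C (\<lambda>L. (if C - L = {} then 0 else y * g (insert (Min (C - L)) L)) +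
    (if L = {} then 0 else g L)) = 0"
  using assms
proof (induction C arbitrary: g rule: finite_linorder_min_induct)
  case empty
  then show ?case by simp
next
  case (insert m C)
  have m: "m \<notin> C" using insert by blast
  have m1: "Min (insert m C) = m"
    using insert by (intro Min_eqI) (auto intro: less_imp_le)
  have "isum y (insert m C) (\<lambda>L. (if insert m C - L = {} then 0
        else y * g (insert (Min (insert m C - L)) L)) + (if L = {} then 0 else g L)) =
    y * g {m} - y * isum y C (\<lambda>L. (if insert m C - insert m L = {} then 0
        else y * g (insert (Min (insert m C - insert m L)) (insert m L))) + g (insert m L))"
    using insert m1 by (subst isum_insert_min) auto
  also have "isum y C (\<lambda>L. (if insert m C - insert m L = {} then 0
        else y * g (insert (Min (insert m C - insert m L)) (insert m L))) + g (insert m L)) =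
     isum y C (\<lambda>L. ((if C - L = {} then 0
        else y * g (insert m (insert (Min (C - L)) L))) +
          (if L = {} then 0 else g (insert m L))) + (if L = {} then g {m} else 0))"
  proof (rule isum_cong)
    fix L assume "L \<in> initial_segments C"
    then have e: "insert m C - insert m L = C - L" using m by auto
    show "(if insert m C - insert m L = {} then 0
        else y * g (insert (Min (insert m C - insert m L)) (insert m L))) + g (insert m L) =
     ((if C - L = {} then 0 else y * g (insert m (insert (Min (C - L)) L))) +
          (if L = {} then 0 else g (insert m L))) + (if L = {} then g {m} else 0)"
      unfolding e by (auto simp: insert_commute)
  qed
  also have "\<dots> = g {m}"
    unfolding isum_add[where h = "\<lambda>L. if L = {} then g {m} else 0"]
    unfolding insert.IH[where g = "\<lambda>L. g (insert m L)"]
    by (simp add: isum_delta insert)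
  finally show ?case by simp
qed

text \<open>The initial segments that do not contain all of \<open>B\<close> cancel in pairs.\<close>

lemma isum_telescope_barrier:
  assumes "finite B" "finite C" "\<And>b. b \<in> B \<Longrightarrow> b < w" "\<And>c. c \<in> C \<Longrightarrow> w < c"
    and W: "finite W" "w \<in> W" "\<And>v. v \<in> W \<Longrightarrow> w \<le> v" "W \<inter> B = {}" "W \<inter> C = {}"
  shows "isum y (B \<union> C) (\<lambda>L. y * g (insert (Min ((B \<union> C \<union> W) - L)) L) +
      (if L = {} then 0 else g L)) =
    (- y) ^ card B * isum y C (\<lambda>L. y * g (insert w (B \<union> L)) + (if L = {} then 0 else g (B \<union> L)))"
  using assms(1,3) W(4)
proof (induction B arbitrary: g rule: finite_linorder_min_induct)
  case empty
  have "isum y C (\<lambda>L. y * g (insert (Min ((C \<union> W) - L)) L) + (if L = {} then 0 else g L)) =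
    isum y C (\<lambda>L. y * g (insert w L) + (if L = {} then 0 else g L))"
  proof (rule isum_cong)
    fix L assume L: "L \<in> initial_segments C"
    have "Min ((C \<union> W) - L) = w"
      using assms(2,4) W initial_segmentsD[OF L] by (intro Min_eqI) (auto dest: less_imp_le)
    then show "y * g (insert (Min ((C \<union> W) - L)) L) + (if L = {} then 0 else g L) =
      y * g (insert w L) + (if L = {} then 0 else g L)" by simp
  qed
  then show ?case by (simp cong: if_cong)
next
  case (insert m B)
  have m: "m \<notin> B" "m \<notin> C" "m \<notin> W" "m < w"
    using insert assms(4)[of m] W by (auto dest: less_asym)
  have lt: "m < c" if "c \<in> B \<union> C" for c
    using that insert(2,4) assms(4) by (metis Un_iff insertI1 order.strict_trans m(4))
  have "m \<le> v" if "v \<in> W" for v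
    using m(4) W(3)[OF that] by simp
  then have m1: "Min (insert m (B \<union> C \<union> W)) = m"
    using insert(1) assms(2) W(1) lt by (intro Min_eqI) (auto intro: less_imp_le)
  let ?D = "B \<union> C"
  have "isum y (insert m B \<union> C) (\<lambda>L. y * g (insert (Min ((insert m B \<union> C \<union> W) - L)) L) +
      (if L = {} then 0 else g L)) =
    y * g {m} - y * isum y ?D (\<lambda>L. y * g (insert (Min (insert m (?D \<union> W) - insert m L)) (insert m L))
       + g (insert m L))"
  proof -
    have e: "insert m B \<union> C = insert m ?D" "insert m B \<union> C \<union> W = insert m (?D \<union> W)" by auto
    show ?thesis
      unfolding e using insert(1) assms(2) m1 lt by (subst isum_insert_min) auto
  qed
  also have "isum y ?D (\<lambda>L. y * g (insert (Min (insert m (?D \<union> W) - insert m L)) (insert m L))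
       + g (insert m L)) =
     isum y ?D (\<lambda>L. (y * g (insert m (insert (Min (?D \<union> W - L)) L)) +
          (if L = {} then 0 else g (insert m L))) + (if L = {} then g {m} else 0))"
  proof (rule isum_cong)
    fix L assume "L \<in> initial_segments ?D"
    then have e: "insert m (?D \<union> W) - insert m L = ?D \<union> W - L" using m by auto
    show "y * g (insert (Min (insert m (?D \<union> W) - insert m L)) (insert m L)) + g (insert m L) =
     (y * g (insert m (insert (Min (?D \<union> W - L)) L)) +
          (if L = {} then 0 else g (insert m L))) + (if L = {} then g {m} else 0)"
      unfolding e by (auto simp: insert_commute)
  qed
  also have "\<dots> = isum y ?D (\<lambda>L. y * g (insert m (insert (Min (?D \<union> W - L)) L)) +
          (if L = {} then 0 else g (insert m L))) + g {m}"
    unfolding isum_add[where h = "\<lambda>L. if L = {} then g {m} else 0"]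
    using insert(1) assms(2) by (simp add: isum_delta)
  also have "isum y ?D (\<lambda>L. y * g (insert m (insert (Min (?D \<union> W - L)) L)) +
          (if L = {} then 0 else g (insert m L))) =
     (- y) ^ card B * isum y C (\<lambda>L. y * g (insert m (insert w (B \<union> L))) +
        (if L = {} then 0 else g (insert m (B \<union> L))))"
    using insert by (intro insert.IH[where g = "\<lambda>L. g (insert m L)"]) auto
  finally show ?case
    using insert(1) m by (simp add: insert_commute algebra_simps cong: if_cong)
qed

text \<open>A snake that cuts the rows \<open>K\<close> in column \<open>c + 1\<close> may cut the rows \<open>K'\<close> in column \<open>c\<close>, where
  \<open>A\<close> is the set of rows of length \<open>c\<close>.  The conditions encode the key poset order, condition (3)
  of a snake and weak connectedness.\<close>

definition snake_steps :: "nat set \<Rightarrow> nat set \<Rightarrow> nat set set" where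
  "snake_steps A K = {K'. K' \<subseteq> A \<union> K \<and> (\<forall>s\<in>K'. \<forall>r\<in>A. r < s \<longrightarrow> r \<in> K') \<and>
     (\<forall>s\<in>K' \<inter> K. \<forall>r\<in>K. s \<le> r) \<and> (K \<noteq> {} \<longrightarrow> (\<exists>u\<in>K'. \<exists>v\<in>K. v \<le> u))}"

text \<open>A row costs a sign only in the column where it ends, that is, as a member of
  \<open>A\<close>; letting a row of \<open>K\<close> continue costs none. Over a scan that starts
  without cut rows, the sign becomes \<open>-1\<close> to the number of cut rows, and the exponent
  of \<open>y\<close> counts cells.\<close>

definition step_sum :: "'a::comm_ring_1 \<Rightarrow> nat set \<Rightarrow> nat set \<Rightarrow> (nat set \<Rightarrow> 'a) \<Rightarrow> 'a" where
  "step_sum y A K g = (\<Sum>K'\<in>snake_steps A K. (- 1) ^ card (K' \<inter> A) * y ^ card K' * g K')"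

lemma finite_snake_steps [simp]: "finite A \<Longrightarrow> finite K \<Longrightarrow> finite (snake_steps A K)"
  by (rule finite_subset[of _ "Pow (A \<union> K)"]) (auto simp: snake_steps_def)

lemma snake_stepsD: "K' \<in> snake_steps A K \<Longrightarrow> K' \<subseteq> A \<union> K"
  by (simp add: snake_steps_def)

lemma step_sum_cong:
  "(\<And>K'. K' \<in> snake_steps A K \<Longrightarrow> g K' = h K') \<Longrightarrow> step_sum y A K g = step_sum y A K h"
  by (auto simp: step_sum_def intro!: sum.cong)

lemma step_sum_add: "step_sum y A K (\<lambda>L. g L + h L) = step_sum y A K g + step_sum y A K h"
  by (simp add: step_sum_def algebra_simps sum.distrib)

lemma step_sum_mult: "step_sum y A K (\<lambda>L. k * g L) = k * step_sum y A K g"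
  by (simp add: step_sum_def sum_distrib_left mult_ac)

lemma step_sum_empty: "step_sum y A {} g = isum y A g"
proof -
  have "snake_steps A {} = initial_segments A"
    by (auto simp: snake_steps_def initial_segments_def)
  moreover have "(- 1) ^ card (L \<inter> A) * y ^ card L = (- y) ^ card L"
    if "L \<in> initial_segments A" for L
    using initial_segmentsD[OF that] by (simp add: Int_absorb2 power_mult_distrib[symmetric])
  ultimately show ?thesis by (simp add: step_sum_def isum_def)
qed

text \<open>Connectedness forces some row \<open>u\<close> with \<open>v \<le> u\<close> into the
  new cut, hence all of \<open>B\<close>; condition (3) of a snake allows no row of \<open>K\<close>
  but the lowest one, \<open>v\<close>, to continue. So the new cut is \<open>B \<union> L\<close>
  with or without \<open>v\<close>, and \<open>L\<close> may be empty only if \<open>v\<close>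
  continues. The cell in row \<open>v\<close> contributes \<open>y\<close> but no sign.\<close>

lemma step_sum_nonempty:
  assumes fin: "finite B" "finite C" "finite K"
    and K: "K \<noteq> {}" "Min K = v" "K \<inter> (B \<union> C) = {}"
    and B: "\<And>b. b \<in> B \<Longrightarrow> b < v" and C: "\<And>c. c \<in> C \<Longrightarrow> v < c"
  shows "step_sum y (B \<union> C) K g =
    (- y) ^ card B * isum y C (\<lambda>L. y * g (insert v (B \<union> L)) + (if L = {} then 0 else g (B \<union> L)))"
proof -
  have v: "v \<in> K" "\<And>k. k \<in> K \<Longrightarrow> v \<le> k"
    using K(2) Min_in[OF fin(3) K(1)] Min_le[OF fin(3)] by auto
  have vB: "v \<notin> B" "v \<notin> C" "B \<inter> C = {}"
    using v(1) K(3) B C by (auto dest: less_asym)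
  let ?I = "initial_segments C"
  have steps: "snake_steps (B \<union> C) K = (\<lambda>L. insert v (B \<union> L)) ` ?I \<union> (\<union>) B ` (?I - {{}})"
    (is "?l = ?r1 \<union> ?r2")
  proof (intro equalityI subsetI)
    fix K' assume K': "K' \<in> ?l"
    then obtain u w where u: "u \<in> K'" "w \<in> K" "w \<le> u" using K(1) by (auto simp: snake_steps_def)
    then have vu: "v \<le> u" using v(2) le_trans by blast
    have up: "\<And>s r. s \<in> K' \<Longrightarrow> r \<in> B \<union> C \<Longrightarrow> r < s \<Longrightarrow> r \<in> K'"
      using K' unfolding snake_steps_def by blast
    then have BK: "B \<subseteq> K'" using u(1) vu B by (meson UnI1 less_le_trans subsetI)
    have sub: "K' \<subseteq> insert v (B \<union> C)"
    proof
      fix s assume s: "s \<in> K'"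
      show "s \<in> insert v (B \<union> C)"
      proof (cases "s \<in> K")
        case True
        then have "s \<le> v" using K' s v(1) unfolding snake_steps_def by blast
        then show ?thesis using v(2)[OF True] by simp
      next
        case False
        then show ?thesis using K' s unfolding snake_steps_def by blast
      qed
    qed
    define L where "L = K' \<inter> C"
    have L: "L \<in> ?I" using up by (auto simp: L_def initial_segments_def)
    show "K' \<in> ?r1 \<union> ?r2"
    proof (cases "v \<in> K'")
      case True
      then have "K' = insert v (B \<union> L)" using sub BK by (auto simp: L_def)
      then show ?thesis using L by blast
    next
      case False
      then have e: "K' = B \<union> L" using sub BK by (auto simp: L_def)
      have "u \<notin> B" using vu B[of u] by auto
      then have "L \<noteq> {}" using u(1) e by blast
      then show ?thesis using e L by blast
    qed
  next
    fix K' assume "K' \<in> ?r1 \<union> ?r2"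
    then obtain L where L: "L \<in> ?I" and e: "K' = insert v (B \<union> L) \<or> K' = B \<union> L \<and> L \<noteq> {}"
      by blast
    have LC: "L \<subseteq> C" and Li: "\<And>s r. s \<in> L \<Longrightarrow> r \<in> C \<Longrightarrow> r < s \<Longrightarrow> r \<in> L"
      using L by (auto simp: initial_segments_def)
    have e1: "K' \<subseteq> insert v (B \<union> L)" "B \<union> L \<subseteq> K'" using e by auto
    have s1: "K' \<subseteq> (B \<union> C) \<union> K" using e1 LC v(1) by auto
    have s2: "r \<in> K'" if "s \<in> K'" "r \<in> B \<union> C" "r < s" for s r
    proof -
      have "s \<in> insert v (B \<union> L)" using that e1 by blast
      moreover have "\<not> r < s" if "r \<in> C" "s \<in> insert v B"
        using that B[of s] C[of r] by auto
      ultimately show ?thesis using that e1 Li by blast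
    qed
    have s3: "s \<le> r" if "s \<in> K' \<inter> K" "r \<in> K" for s r
    proof -
      have "s = v" using that e1 K(3) LC by blast
      then show ?thesis using v(2) that by blast
    qed
    have s4: "\<exists>u\<in>K'. \<exists>w\<in>K. w \<le> u"
    proof (cases "v \<in> K'")
      case True
      then show ?thesis using v by blast
    next
      case False
      then obtain c where "c \<in> L" using e by blast
      moreover then have "v \<le> c" using LC C less_imp_le by blast
      ultimately show ?thesis using v e1 by blast
    qed
    show "K' \<in> ?l"
      using s1 s2 s3 s4 unfolding snake_steps_def by blast
  qed
  have disj: "?r1 \<inter> ?r2 = {}"
  proof -
    have "v \<notin> B \<union> L" if "L \<in> ?I" for L using that vB initial_segmentsD by blast
    then show ?thesis by blast
  qed
  have inj1: "inj_on (\<lambda>L. insert v (B \<union> L)) ?I"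
  proof (rule inj_onI)
    fix L M assume "L \<in> ?I" "M \<in> ?I" and eq: "insert v (B \<union> L) = insert v (B \<union> M)"
    then have "L \<subseteq> C" "M \<subseteq> C" by (auto dest: initial_segmentsD)
    then have "L = insert v (B \<union> L) \<inter> C" "M = insert v (B \<union> M) \<inter> C" using vB by auto
    with eq show "L = M" by simp
  qed
  have inj2: "inj_on ((\<union>) B) (?I - {{}})"
  proof (rule inj_onI)
    fix L M assume "L \<in> ?I - {{}}" "M \<in> ?I - {{}}" and eq: "B \<union> L = B \<union> M"
    then have "L \<subseteq> C" "M \<subseteq> C" by (auto dest: initial_segmentsD)
    with eq vB show "L = M" by blast
  qed
  let ?w = "\<lambda>K'. (- 1) ^ card (K' \<inter> (B \<union> C)) * y ^ card K' * g K'"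
  have card: "card (B \<union> L) = card B + card L" "finite L" "v \<notin> B \<union> L"
     "insert v (B \<union> L) \<inter> (B \<union> C) = B \<union> L" "(B \<union> L) \<inter> (B \<union> C) = B \<union> L" if "L \<in> ?I" for L
  proof -
    have LC: "L \<subseteq> C" using initial_segmentsD[OF that] .
    then show "finite L" using fin finite_subset by blast
    then show "card (B \<union> L) = card B + card L"
      using fin LC vB by (intro card_Un_disjoint) auto
    show "v \<notin> B \<union> L" "insert v (B \<union> L) \<inter> (B \<union> C) = B \<union> L" "(B \<union> L) \<inter> (B \<union> C) = B \<union> L"
      using LC vB by auto
  qed
  have "step_sum y (B \<union> C) K g = sum ?w ?r1 + sum ?w ?r2"
    unfolding step_sum_def steps using fin disj by (intro sum.union_disjoint) auto
  also have "sum ?w ?r1 = (\<Sum>L\<in>?I. (- y) ^ card B * ((- y) ^ card L * (y * g (insert v (B \<union> L)))))"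
    unfolding sum.reindex[OF inj1] o_def
  proof (rule sum.cong[OF refl])
    fix L assume L: "L \<in> ?I"
    show "?w (insert v (B \<union> L)) = (- y) ^ card B * ((- y) ^ card L * (y * g (insert v (B \<union> L))))"
      using card[OF L] fin
      by (simp add: power_add power_minus[of y] mult_ac)
  qed
  also have "sum ?w ?r2 = (\<Sum>L\<in>?I - {{}}. (- y) ^ card B * ((- y) ^ card L * g (B \<union> L)))"
    unfolding sum.reindex[OF inj2] o_def
  proof (rule sum.cong[OF refl])
    fix L assume "L \<in> ?I - {{}}"
    then have L: "L \<in> ?I" by blast
    show "?w (B \<union> L) = (- y) ^ card B * ((- y) ^ card L * g (B \<union> L))"
      using card[OF L] fin
      by (simp add: power_add power_minus[of y] mult_ac)
  qed
  also have "\<dots> = (\<Sum>L\<in>?I. (- y) ^ card B * ((- y) ^ card L * (if L = {} then 0 else g (B \<union> L))))"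
    using fin by (intro sum.mono_neutral_cong_left) auto
  finally show ?thesis
    by (simp add: isum_add) (simp add: isum_def sum_distrib_left algebra_simps)
qed

text \<open>Rows of \<open>K\<close> above its minimum can neither continue nor help connectedness,
  so the snake remembers only its lowest row from one column to the next.\<close>

lemma step_sum_Min_only:
  assumes "finite A" "finite K" "K \<noteq> {}" "K \<inter> A = {}"
  shows "step_sum y A K g = step_sum y A {Min K} g"
proof -
  let ?v = "Min K"
  have v: "?v \<in> K" using assms by simp
  have A: "A = {a\<in>A. a < ?v} \<union> {a\<in>A. ?v < a}"
    using v assms(4) by (auto simp: not_less_iff_gr_or_eq dest: linorder_neqE_nat)
  have vA: "?v \<notin> A" using v assms(4) by blast
  let ?B = "{a\<in>A. a < ?v}" and ?C = "{a\<in>A. ?v < a}"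
  have 1: "step_sum y (?B \<union> ?C) K g = (- y) ^ card ?B *
     isum y ?C (\<lambda>L. y * g (insert ?v (?B \<union> L)) + (if L = {} then 0 else g (?B \<union> L)))"
    using assms by (intro step_sum_nonempty) auto
  have 2: "step_sum y (?B \<union> ?C) {?v} g = (- y) ^ card ?B *
     isum y ?C (\<lambda>L. y * g (insert ?v (?B \<union> L)) + (if L = {} then 0 else g (?B \<union> L)))"
    using assms vA by (intro step_sum_nonempty) auto
  show ?thesis using 1 2 A by simp
qed

text \<open>When \<open>v\<close> becomes a row ending here, the segments
  \<open>B \<union> L\<close> with nonempty \<open>L\<close> are lost and the sets
  \<open>insert v (B \<union> L)\<close> are gained. A snake arriving in row \<open>v\<close> runs
  through both kinds: it restores the former, and on the latter it has the same power of
  \<open>y\<close> with the opposite sign, since continuing \<open>v\<close> costs no sign.\<close>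

lemma step_sum_insert_identity:
  assumes "finite B" "finite C" "\<And>b. b \<in> B \<Longrightarrow> b < v" "\<And>c. c \<in> C \<Longrightarrow> v < c"
  shows "step_sum y (B \<union> C) {} g = step_sum y (insert v (B \<union> C)) {} g + step_sum y (B \<union> C) {v} g"
proof -
  have lt: "b < c" if "b \<in> B" "c \<in> C" for b c using that assms(3,4) less_trans by blast
  have 1: "isum y (B \<union> C) g = isum y B g +
     (- y) ^ card B * isum y C (\<lambda>L. if L = {} then 0 else g (B \<union> L))"
    using assms lt by (intro isum_split) auto
  have 2: "isum y (insert v (B \<union> C)) g =
    isum y B g - y * (- y) ^ card B * isum y C (\<lambda>L. g (insert v (B \<union> L)))"
    using assms by (intro isum_split_insert) auto
  have 3: "step_sum y (B \<union> C) {v} g = (- y) ^ card B *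
     isum y C (\<lambda>L. y * g (insert v (B \<union> L)) + (if L = {} then 0 else g (B \<union> L)))"
    using assms by (intro step_sum_nonempty) auto
  show ?thesis
    unfolding step_sum_empty 1 2 3 isum_add isum_mult by (simp add: algebra_simps)
qed

section \<open>Exchanging a strip and a snake at one column\<close>

text \<open>\<open>Q\<close> is the set of rows that end in the current column or are cut in the next one.  For a
  set \<open>J\<close> of rows cut in the current column, the values of \<open>p\<close> (snake deleted before the strip) and
  \<open>q\<close> (strip deleted before the snake) are the sums over all continuations to the left; the index
  0 means that all of \<open>J\<close> is cut by the snake, and the second argument of \<open>p1\<close>, \<open>q1\<close> is the row cut
  by the strip.\<close>

locale site_exchange =
  fixes x y :: "'a::comm_ring_1" and Q :: "nat set"
    and p0 q0 :: "nat set \<Rightarrow> 'a" and p1 q1 :: "nat set \<Rightarrow> nat \<Rightarrow> 'a"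
  assumes fin: "finite Q"
    and empty: "(y - x) * p0 {} = (y - x) * q0 {}"
    and none: "\<And>J m. J \<subseteq> Q \<Longrightarrow> m \<in> J \<Longrightarrow> (\<And>r. r \<in> J \<Longrightarrow> m \<le> r) \<Longrightarrow>
      (y - x) * p0 J = y * q0 J - (if J = {m} then 0 else x * q1 J m)"
    and single: "\<And>m. m \<in> Q \<Longrightarrow> (y - x) * p1 {m} m = y * q0 {m} + (y - x) * q1 {m} m"
    and least: "\<And>J m m'. J \<subseteq> Q \<Longrightarrow> m \<in> J \<Longrightarrow> m' \<in> J \<Longrightarrow> m < m' \<Longrightarrow>
      (\<And>r. r \<in> J \<Longrightarrow> r = m \<or> m' \<le> r) \<Longrightarrow>
      (y - x) * p1 J m = y * q0 J + (y - x) * q1 J m - y * q1 J m'"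
    and other: "\<And>J m w. J \<subseteq> Q \<Longrightarrow> m \<in> J \<Longrightarrow> w \<in> J \<Longrightarrow> m < w \<Longrightarrow> p1 J w = p0 J"
begin

text \<open>When the snake acts first, the strip may cut in this column the lowest row that the
  snake has left alone, including rows of the arriving snake that did not continue.\<close>

definition G :: "nat set \<Rightarrow> 'a" where
  "G J = p0 J + (if Q - J = {} then 0 else x * p1 (insert (Min (Q - J)) J) (Min (Q - J)))"

text \<open>\<open>K\<close> holds the rows cut by the snake and \<open>U\<close> those cut by the
  strip in the column to the right. Before the strip acts, the rows of \<open>U\<close> are longer
  than this column, so they are withheld from the snake; the strip may still continue in them, which
  is why \<open>G\<close> ranges over all of \<open>Q\<close>.\<close>

definition snake_first :: "nat set \<Rightarrow> nat set \<Rightarrow> 'a" where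
  "snake_first K U = step_sum y (Q - K - U) K G"

text \<open>In the exchange theorems \<open>A\<close> is \<open>Q - K\<close>: the strip acts before
  the snake and meets the rows of \<open>K\<close> uncut, hence too long for this column. A row cut
  here by the strip no longer reaches the column, so it leaves the candidates of the snake, but it
  joins the rows ending in the next column to the left.\<close>

definition strip_first :: "nat set \<Rightarrow> nat set \<Rightarrow> 'a" where
  "strip_first A K = step_sum y A K q0 + (if A = {} then 0 else
     x * step_sum y (A - {Min A}) K (\<lambda>J. q1 (insert (Min A) J) (Min A)))"

abbreviation z :: 'a where "z \<equiv> y - x"

lemma none':
  assumes "J \<subseteq> Q" "m \<in> J" "\<And>r. r \<in> J \<Longrightarrow> m \<le> r" "J \<noteq> {m}"
  shows "z * p0 J = y * q0 J - x * q1 J m"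
  using none[OF assms(1-3)] assms(4) by simp

lemma strip_first_Min:
  assumes "finite A" "finite K" "K \<noteq> {}" "K \<inter> A = {}"
  shows "strip_first A K = strip_first A {Min K}"
proof -
  have "K \<inter> (A - {Min A}) = {}" using assms by blast
  then show ?thesis
    using assms by (simp add: strip_first_def step_sum_Min_only[of _ K])
qed

text \<open>Row \<open>m\<close> lies below the arriving snake row \<open>v\<close>, so it must be
  cut here: by the snake for a further factor \<open>- y\<close>, or by the strip, as its lowest
  available row, for a factor \<open>x\<close>. Both possibilities combine to
  \<open>y * q0 - x * q1\<close>, which is \<open>z * p0\<close> by \<open>none'\<close>.\<close>

lemma strip_first_low:
  assumes sub: "insert v (insert m (B \<union> C)) \<subseteq> Q"
    and m: "m < v" "\<And>b. b \<in> B \<Longrightarrow> m < b"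
    and B: "\<And>b. b \<in> B \<Longrightarrow> b < v" and C: "\<And>c. c \<in> C \<Longrightarrow> v < c"
  shows "strip_first (insert m (B \<union> C)) {v} = - ((- y) ^ card B * isum y C
    (\<lambda>L. y * (z * p0 (insert v (insert m B \<union> L))) + (if L = {} then 0 else z * p0 (insert m B \<union> L))))"
proof -
  have fB: "finite B" "finite C" using sub fin by (auto dest: finite_subset)
  have mC: "m < c" if "c \<in> C" for c using m(1) C[OF that] by simp
  have mn: "m \<notin> B" "m \<notin> C" using m(2) mC by auto
  have Min: "Min (insert m (B \<union> C)) = m"
    using fB m(2) mC by (intro Min_eqI) (auto intro: less_imp_le)
  have del: "insert m (B \<union> C) - {m} = B \<union> C" using mn by auto
  have 1: "step_sum y (insert m B \<union> C) {v} q0 = (- y) ^ card (insert m B) * isum y C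
     (\<lambda>L. y * q0 (insert v (insert m B \<union> L)) + (if L = {} then 0 else q0 (insert m B \<union> L)))"
    using fB m B C by (intro step_sum_nonempty) (auto dest: less_asym)
  have 2: "step_sum y (B \<union> C) {v} (\<lambda>J. q1 (insert m J) m) = (- y) ^ card B * isum y C
     (\<lambda>L. y * q1 (insert m (insert v (B \<union> L))) m + (if L = {} then 0 else q1 (insert m (B \<union> L)) m))"
    using fB B C by (intro step_sum_nonempty) auto
  have "strip_first (insert m (B \<union> C)) {v} = (- y) ^ card B * isum y C
     (\<lambda>L. - y * (y * q0 (insert v (insert m B \<union> L)) + (if L = {} then 0 else q0 (insert m B \<union> L)))
        + x * (y * q1 (insert m (insert v (B \<union> L))) m + (if L = {} then 0 else q1 (insert m (B \<union> L)) m)))"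
    using 1 2 fB mn unfolding strip_first_def Min del isum_add[of y C "\<lambda>L. - y * _ L" "\<lambda>L. x * _ L"] isum_mult
    by (simp add: algebra_simps)
  also have "isum y C
     (\<lambda>L. - y * (y * q0 (insert v (insert m B \<union> L)) + (if L = {} then 0 else q0 (insert m B \<union> L)))
        + x * (y * q1 (insert m (insert v (B \<union> L))) m + (if L = {} then 0 else q1 (insert m (B \<union> L)) m)))
     = isum y C (\<lambda>L. - 1 * (y * (z * p0 (insert v (insert m B \<union> L))) +
        (if L = {} then 0 else z * p0 (insert m B \<union> L))))"
  proof (rule isum_cong)
    fix L assume "L \<in> initial_segments C"
    then have L: "L \<subseteq> C" by (rule initial_segmentsD)
    let ?J = "insert v (insert m (B \<union> L))" and ?J' = "insert m (B \<union> L)"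
    have 1: "z * p0 ?J = y * q0 ?J - x * q1 ?J m"
    proof -
      have "?J \<noteq> {m}" using m(1) by auto
      moreover have "m \<le> r" if "r \<in> ?J" for r using that m mC L by (auto intro: less_imp_le)
      ultimately show ?thesis using sub L by (intro none') auto
    qed
    have 2: "z * p0 ?J' = y * q0 ?J' - x * q1 ?J' m" if "L \<noteq> {}"
    proof -
      have "?J' \<noteq> {m}" using that L mn by auto
      moreover have "m \<le> r" if "r \<in> ?J'" for r using that m mC L by (auto intro: less_imp_le)
      ultimately show ?thesis using sub L by (intro none') auto
    qed
    show "- y * (y * q0 (insert v (insert m B \<union> L)) + (if L = {} then 0 else q0 (insert m B \<union> L)))
        + x * (y * q1 (insert m (insert v (B \<union> L))) m + (if L = {} then 0 else q1 (insert m (B \<union> L)) m))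
     = - 1 * (y * (z * p0 (insert v (insert m B \<union> L))) +
        (if L = {} then 0 else z * p0 (insert m B \<union> L)))"
      using 2 by (simp add: 1 insert_commute[of m v]) (simp add: algebra_simps)
  qed
  also have "\<dots> = - isum y C (\<lambda>L. y * (z * p0 (insert v (insert m B \<union> L))) +
        (if L = {} then 0 else z * p0 (insert m B \<union> L)))"
    by (subst isum_mult) simp
  finally show ?thesis by simp
qed

text \<open>The terms with \<open>x\<close> on the right are a correction for empty
  \<open>B\<close>. If \<open>B\<close> is nonempty, its least row lies below \<open>v\<close>, so
  \<open>other\<close> identifies \<open>p1\<close> with \<open>p0\<close>, the correction vanishes
  and \<open>strip_first_low\<close> applies. If \<open>B\<close> is empty, the lowest row open to
  the strip lies above \<open>v\<close>, and \<open>least\<close> produces the correction.\<close>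

lemma strip_first_eq:
  assumes sub: "insert v (B \<union> C) \<subseteq> Q"
    and B: "\<And>b. b \<in> B \<Longrightarrow> b < v" and C: "\<And>c. c \<in> C \<Longrightarrow> v < c"
  shows "y * strip_first (B \<union> C) {v} = (- y) ^ card B * isum y C
    (\<lambda>L. y * (z * p0 (insert v (B \<union> L))) + (if L = {} then 0 else z * p0 (B \<union> L) +
        x * (z * p1 (insert v (B \<union> L)) v) - x * (z * p0 (insert v (B \<union> L)))))"
proof (cases "B = {}")
  case False
  have fB: "finite B" "finite C" using sub fin by (auto dest: finite_subset)
  define m where "m = Min B"
  define B' where "B' = B - {m}"
  have mB: "m \<in> B" using False fB by (simp add: m_def)
  have Be: "B = insert m B'" "m \<notin> B'" using mB by (auto simp: B'_def)
  have lt: "m < b" if "b \<in> B'" for b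
    using that fB Min_le[of B b] by (auto simp: B'_def m_def order.strict_iff_order)
  have card: "card B = Suc (card B')" using Be fB by simp
  have eq: "p1 (insert v (B \<union> L)) v = p0 (insert v (B \<union> L))" if "L \<in> initial_segments C" for L
    using sub initial_segmentsD[OF that] mB B by (intro other[of _ m]) auto
  have "y * strip_first (insert m (B' \<union> C)) {v} = y * - ((- y) ^ card B' * isum y C
    (\<lambda>L. y * (z * p0 (insert v (insert m B' \<union> L))) + (if L = {} then 0 else z * p0 (insert m B' \<union> L))))"
    using sub lt B C by (subst strip_first_low) (auto simp: Be)
  also have "\<dots> = (- y) ^ card B * isum y C
    (\<lambda>L. y * (z * p0 (insert v (B \<union> L))) + (if L = {} then 0 else z * p0 (B \<union> L)))"
    by (simp add: card Be(1)[symmetric] cong: if_cong)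
  also have "isum y C
    (\<lambda>L. y * (z * p0 (insert v (B \<union> L))) + (if L = {} then 0 else z * p0 (B \<union> L))) =
    isum y C (\<lambda>L. y * (z * p0 (insert v (B \<union> L))) + (if L = {} then 0 else z * p0 (B \<union> L) +
        x * (z * p1 (insert v (B \<union> L)) v) - x * (z * p0 (insert v (B \<union> L)))))"
    using eq by (intro isum_cong) auto
  finally show ?thesis using Be(1) by simp
next
  case True
  have fC: "finite C" using sub fin by (auto dest: finite_subset)
  let ?F = "\<lambda>L. y * (z * p0 (insert v L)) + (if L = {} then 0 else z * p0 L +
        x * (z * p1 (insert v L) v) - x * (z * p0 (insert v L)))"
  have 1: "step_sum y C {v} g = isum y C (\<lambda>L. y * g (insert v L) + (if L = {} then 0 else g L))"
    if "\<And>c. c \<in> C \<Longrightarrow> v < c" "finite C" for C g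
    using step_sum_nonempty[of "{}" C "{v}" v y g] that by (auto cong: if_cong)
  have zv: "z * p0 {v} = y * q0 {v}" using none[of "{v}" v] sub by auto
  have "y * strip_first C {v} = isum y C ?F"
  proof (cases "C = {}")
    case True
    then show ?thesis using 1[of "{}"] by (simp add: strip_first_def zv)
  next
    case False
    define c where "c = Min C"
    define D where "D = C - {c}"
    have cC: "c \<in> C" using False fC by (simp add: c_def)
    have Ce: "C = insert c D" "c \<notin> D" using cC by (auto simp: D_def)
    have lt: "c < b" if "b \<in> D" for b
      using that fC Min_le[of C b] by (auto simp: D_def c_def order.strict_iff_order)
    have fD: "finite D" using fC by (simp add: D_def)
    have vc: "v < c" using C cC by blast
    have vD: "v < d" if "d \<in> D" for d using C that Ce by auto
    have "y * strip_first C {v} = y * isum y C (\<lambda>L. y * q0 (insert v L) + (if L = {} then 0 else q0 L)) +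
      y * (x * isum y D (\<lambda>L. y * q1 (insert c (insert v L)) c + (if L = {} then 0 else q1 (insert c L) c)))"
      using 1[OF vD fD, of "\<lambda>J. q1 (insert c J) c"] 1[OF C fC] False
      by (simp add: strip_first_def c_def[symmetric] D_def[symmetric] distrib_left)
    also have "isum y C (\<lambda>L. y * q0 (insert v L) + (if L = {} then 0 else q0 L)) =
      y * q0 {v} - y * isum y D (\<lambda>L. y * q0 (insert v (insert c L)) + q0 (insert c L))"
      unfolding Ce(1) by (subst isum_insert_min[OF fD lt]) auto
    also have "y * (y * q0 {v} - y * isum y D (\<lambda>L. y * q0 (insert v (insert c L)) + q0 (insert c L))) +
      y * (x * isum y D (\<lambda>L. y * q1 (insert c (insert v L)) c + (if L = {} then 0 else q1 (insert c L) c))) =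
      y * (y * q0 {v}) - y * isum y D (\<lambda>L. y * (y * q0 (insert v (insert c L)) + q0 (insert c L)) -
        x * (y * q1 (insert c (insert v L)) c + (if L = {} then 0 else q1 (insert c L) c)))"
      unfolding isum_diff isum_mult by (simp add: algebra_simps)
    also have "isum y D (\<lambda>L. y * (y * q0 (insert v (insert c L)) + q0 (insert c L)) -
        x * (y * q1 (insert c (insert v L)) c + (if L = {} then 0 else q1 (insert c L) c))) =
       isum y D (\<lambda>L. ?F (insert c L))"
    proof (rule isum_cong)
      fix L assume "L \<in> initial_segments D"
      then have L: "L \<subseteq> D" by (rule initial_segmentsD)
      \<comment> \<open>Nothing lies below \<open>c\<close> in these sets except \<open>v\<close>.
        Hence \<open>none\<close> applies to both of them, and \<open>least\<close> with the two
        lowest rows \<open>v\<close> and \<open>c\<close> expresses the value of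
        \<open>p1\<close>.\<close>
      let ?J = "insert c L" and ?J' = "insert v (insert c L)"
      have sub': "?J' \<subseteq> Q" using sub L by (auto simp: Ce)
      have lts: "c < r" "v < r" if "r \<in> L" for r using that lt vD L by auto
      have a1: "z * p0 ?J = y * q0 ?J - (if L = {} then 0 else x * q1 ?J c)"
      proof -
        have "?J = {c} \<longleftrightarrow> L = {}" using L Ce by auto
        moreover have "c \<le> r" if "r \<in> ?J" for r using that lts by (auto simp: less_imp_le)
        ultimately show ?thesis using none[of ?J c] sub' by simp
      qed
      have a2: "z * p0 ?J' = y * q0 ?J' - x * q1 ?J' v"
        using sub' lts vc by (intro none') (auto simp: less_imp_le)
      have a3: "z * p1 ?J' v = y * q0 ?J' + z * q1 ?J' v - y * q1 ?J' c"
        using sub' lts vc by (intro least) (auto simp: less_imp_le)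
      show "y * (y * q0 ?J' + q0 ?J) -
        x * (y * q1 (insert c (insert v L)) c + (if L = {} then 0 else q1 ?J c)) = ?F ?J"
        by (simp add: a1 a2 a3 insert_commute[of c v]) (simp add: algebra_simps)
    qed
    also have "y * (y * q0 {v}) - y * isum y D (\<lambda>L. ?F (insert c L)) = isum y C ?F"
      unfolding Ce(1) by (subst isum_insert_min[OF fD lt, where g = ?F]) (auto simp: zv)
    finally show ?thesis .
  qed
  then show ?thesis using True by (simp cong: if_cong)
qed

text \<open>With a row \<open>m\<close> below it that the snake has cut, it makes no difference to
  the continuation whether the strip or the snake cut the row \<open>Min (Q - J)\<close>; this is
  \<open>other\<close>.\<close>

lemma zG:
  assumes "J \<subseteq> Q" "m \<in> J" "\<And>r. r \<in> Q \<Longrightarrow> r \<notin> J \<Longrightarrow> m < r"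
  shows "z * G J = z * p0 J +
    (if Q - J = {} then 0 else x * (z * p0 (insert (Min (Q - J)) J)))"
proof (cases "Q - J = {}")
  case True
  then show ?thesis by (simp add: G_def)
next
  case False
  then have M: "Min (Q - J) \<in> Q - J" using fin by (intro Min_in) auto
  then have "m < Min (Q - J)" using assms(3)[of "Min (Q - J)"] by simp
  then have "p1 (insert (Min (Q - J)) J) (Min (Q - J)) = p0 (insert (Min (Q - J)) J)"
    using assms(1,2) M by (intro other[of _ m]) auto
  then show ?thesis using False by (simp add: G_def algebra_simps)
qed

lemma zG_Min:
  assumes "J \<subseteq> Q" "v \<in> Q" "v \<notin> J" "\<And>r. r \<in> Q \<Longrightarrow> r \<notin> J \<Longrightarrow> v \<le> r"
  shows "z * G J = z * p0 J + x * (z * p1 (insert v J) v)"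
proof -
  have "Min (Q - J) = v" using assms fin by (intro Min_eqI) auto
  then show ?thesis using assms(2,3) by (auto simp: G_def algebra_simps)
qed

text \<open>Both sides run over the same cuts \<open>B \<union> L\<close>, with or without
  \<open>v\<close>, and their termwise difference has the shape of a telescoping summand. It is left
  unevaluated because the rows of \<open>I\<close> above \<open>v\<close> decide how it
  collapses.\<close>

lemma snake_first_insert_eq_strip_first:
  assumes "I \<subseteq> Q" "v \<in> I" "\<And>r. r \<in> I \<Longrightarrow> v \<le> r"
    and A: "Q - I = B \<union> C" and B: "\<And>b. b \<in> B \<Longrightarrow> b < v" and C: "\<And>c. c \<in> C \<Longrightarrow> v < c"
  shows "z * snake_first I {} = y * strip_first (Q - I) I + x * (- y) ^ card B * isum y C
    (\<lambda>L. (if Q - insert v (B \<union> L) = {} then 0 else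
        y * (z * p0 (insert v (B \<union> insert (Min (Q - insert v (B \<union> L))) L)))) +
      (if L = {} then 0 else z * p0 (insert v (B \<union> L))))"
proof -
  have fI: "finite I" "I \<noteq> {}" and fB: "finite B" "finite C"
    using assms(1,2) A fin by (auto dest: finite_subset) (metis finite_Diff finite_Un)+
  have MinI: "Min I = v" using fI assms(2,3) by (intro Min_eqI) auto
  have disj: "I \<inter> (B \<union> C) = {}" using A by blast
  have sub: "insert v (B \<union> C) \<subseteq> Q" using A assms(1,2) by blast
  have 1: "snake_first I {} = (- y) ^ card B * isum y C
     (\<lambda>L. y * G (insert v (B \<union> L)) + (if L = {} then 0 else G (B \<union> L)))"
    using fI fB MinI disj B C by (simp add: snake_first_def A step_sum_nonempty)
  have "strip_first (Q - I) I = strip_first (B \<union> C) {v}"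
    using strip_first_Min[of "B \<union> C" I] fI fB disj MinI A by simp
  then have 2: "y * strip_first (Q - I) I = (- y) ^ card B * isum y C
    (\<lambda>L. y * (z * p0 (insert v (B \<union> L))) + (if L = {} then 0 else z * p0 (B \<union> L) +
        x * (z * p1 (insert v (B \<union> L)) v) - x * (z * p0 (insert v (B \<union> L)))))"
    using strip_first_eq[OF sub B C] by simp
  have rest: "r \<in> C - L \<or> r \<in> I - {v}" if "r \<in> Q" "r \<notin> insert v (B \<union> L)" for r L
    using that A by blast
  have "z * snake_first I {} = (- y) ^ card B * isum y C
     (\<lambda>L. z * (y * G (insert v (B \<union> L)) + (if L = {} then 0 else G (B \<union> L))))"
    unfolding 1 isum_mult by (simp add: mult_ac)
  also have "isum y C (\<lambda>L. z * (y * G (insert v (B \<union> L)) + (if L = {} then 0 else G (B \<union> L)))) =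
    isum y C (\<lambda>L. (y * (z * p0 (insert v (B \<union> L))) + (if L = {} then 0 else z * p0 (B \<union> L) +
        x * (z * p1 (insert v (B \<union> L)) v) - x * (z * p0 (insert v (B \<union> L))))) +
      x * ((if Q - insert v (B \<union> L) = {} then 0 else
        y * (z * p0 (insert v (B \<union> insert (Min (Q - insert v (B \<union> L))) L)))) +
      (if L = {} then 0 else z * p0 (insert v (B \<union> L)))))"
  proof (rule isum_cong)
    fix L assume "L \<in> initial_segments C"
    then have L: "L \<subseteq> C" by (rule initial_segmentsD)
    have vlt: "v < r" if "r \<in> Q" "r \<notin> insert v (B \<union> L)" for r
      using rest[OF that] C assms(3)[of r] by (auto simp: order.strict_iff_order)
    have a: "z * G (insert v (B \<union> L)) = z * p0 (insert v (B \<union> L)) +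
      (if Q - insert v (B \<union> L) = {} then 0 else
         x * (z * p0 (insert (Min (Q - insert v (B \<union> L))) (insert v (B \<union> L)))))"
      using sub L vlt by (intro zG[of _ v]) auto
    have b: "z * G (B \<union> L) = z * p0 (B \<union> L) + x * (z * p1 (insert v (B \<union> L)) v)"
    proof (rule zG_Min)
      show "v \<le> r" if "r \<in> Q" "r \<notin> B \<union> L" for r
        using that vlt[of r] by (cases "r = v") auto
      show "v \<notin> B \<union> L" using B[of v] C[of v] L by auto
    qed (use sub L in auto)
    have c: "insert v (B \<union> insert k L) = insert k (insert v (B \<union> L))" for k by auto
    have "z * (y * G (insert v (B \<union> L)) + (if L = {} then 0 else G (B \<union> L))) =
       y * (z * G (insert v (B \<union> L))) + (if L = {} then 0 else z * G (B \<union> L))"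
      by (simp add: algebra_simps)
    then show "z * (y * G (insert v (B \<union> L)) + (if L = {} then 0 else G (B \<union> L))) =
      (y * (z * p0 (insert v (B \<union> L))) + (if L = {} then 0 else z * p0 (B \<union> L) +
        x * (z * p1 (insert v (B \<union> L)) v) - x * (z * p0 (insert v (B \<union> L))))) +
      x * ((if Q - insert v (B \<union> L) = {} then 0 else
        y * (z * p0 (insert v (B \<union> insert (Min (Q - insert v (B \<union> L))) L)))) +
      (if L = {} then 0 else z * p0 (insert v (B \<union> L))))"
      unfolding a b c by (auto simp: algebra_simps)
  qed
  finally show ?thesis
    unfolding 2 isum_add[of y C "\<lambda>L. _ L + _ L" "\<lambda>L. x * _ L"] isum_mult
    by (simp add: algebra_simps)
qed

text \<open>For \<open>I = {v}\<close> the rows missing from \<open>insert v (B \<union> L)\<close>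
  are those of \<open>C - L\<close>, so the remainder telescopes to zero.\<close>

theorem exchange_single:
  assumes v: "v \<in> Q"
  shows "z * snake_first {v} {} = y * strip_first (Q - {v}) {v}"
proof -
  define B where "B = {a\<in>Q. a < v}"
  define C where "C = {a\<in>Q. v < a}"
  have A: "Q - {v} = B \<union> C" by (auto simp: B_def C_def)
  have e: "Q - insert v (B \<union> L) = C - L" for L using v by (auto simp: B_def C_def)
  have fC: "finite C" using fin by (simp add: C_def)
  have "z * snake_first {v} {} = y * strip_first (Q - {v}) {v} + x * (- y) ^ card B * isum y C
    (\<lambda>L. (if Q - insert v (B \<union> L) = {} then 0 else
        y * (z * p0 (insert v (B \<union> insert (Min (Q - insert v (B \<union> L))) L)))) +
      (if L = {} then 0 else z * p0 (insert v (B \<union> L))))"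
    using v A by (intro snake_first_insert_eq_strip_first) (auto simp: B_def C_def)
  then show ?thesis
    unfolding e isum_telescope[OF fC, of y "\<lambda>L. z * p0 (insert v (B \<union> L))"] by simp
qed

lemma strip_first_below:
  assumes "insert w (insert v (B \<union> C)) \<subseteq> Q" "v \<notin> B"
    and B: "\<And>b. b \<in> B \<Longrightarrow> b < w" "v < w" and C: "\<And>c. c \<in> C \<Longrightarrow> w < c"
  shows "strip_first (insert v (B \<union> C)) {w} = - ((- y) ^ card B * isum y C
    (\<lambda>L. y * (z * p0 (insert w (insert v (B \<union> L)))) + (if L = {} then 0 else z * p0 (insert v (B \<union> L)))))"
proof -
  have fB: "finite B" "finite C" using assms(1) fin by (auto dest: finite_subset)
  define m where "m = Min (insert v B)"
  define B' where "B' = insert v B - {m}"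
  have mB: "m \<in> insert v B" unfolding m_def by (rule Min_in) (use fB in auto)
  have Be: "insert v B = insert m B'" "m \<notin> B'" using mB by (auto simp: B'_def)
  have lt: "m < b" if "b \<in> B'" for b
    using that fB Min_le[of "insert v B" b] by (auto simp: B'_def m_def order.strict_iff_order)
  have "card (insert v B) = Suc (card B)" using assms(2) fB by simp
  moreover have "finite B'" using fB by (simp add: B'_def)
  ultimately have card: "card B' = card B" using Be by simp
  have e: "insert v (B \<union> L) = insert m (B' \<union> L)" for L using Be(1) by blast
  have e': "insert m B' \<union> L = insert m (B' \<union> L)" for L by simp
  have "insert w (insert m (B' \<union> C)) \<subseteq> Q" using assms(1) e by simp
  moreover have "b < w" if "b \<in> insert m B'" for b
  proof -
    have "b \<in> insert v B" using that Be(1) by simp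
    then show ?thesis using B by auto
  qed
  ultimately have "strip_first (insert m (B' \<union> C)) {w} = - ((- y) ^ card B' * isum y C
    (\<lambda>L. y * (z * p0 (insert w (insert m B' \<union> L))) + (if L = {} then 0 else z * p0 (insert m B' \<union> L))))"
    using lt C by (intro strip_first_low) auto
  then show ?thesis
    unfolding e e' card .
qed

text \<open>The rows of \<open>I - {v}\<close> never belong to \<open>L\<close> but may be cut by
  the strip, so the successor of a segment gets stuck at the lowest of them, \<open>w\<close>. What
  survives this barrier is, up to sign, the sum in which the snake arrives only in
  \<open>I - {v}\<close> and row \<open>v\<close> ends in this column.\<close>

theorem exchange_least:
  assumes I: "I \<subseteq> Q" "v \<in> I" "w \<in> I" "v < w" "\<And>r. r \<in> I \<Longrightarrow> r = v \<or> w \<le> r"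
  shows "z * snake_first I {} = y * strip_first (Q - I) I - x * strip_first (Q - (I - {v})) (I - {v})"
proof -
  define B where "B = {a\<in>Q - I. a < v}"
  define D where "D = {a\<in>Q - I. v < a \<and> a < w}"
  define C where "C = {a\<in>Q - I. w < a}"
  define W where "W = I - {v}"
  have A: "Q - I = B \<union> (D \<union> C)"
    using I by (auto simp: B_def C_def D_def intro: linorder_neqE_nat)
  have lt: "b < v" if "b \<in> B" for b using that by (simp add: B_def)
  have ltD: "v < d" "d < w" if "d \<in> D" for d using that by (auto simp: D_def)
  have ltC: "w < c" "v < c" if "c \<in> C" for c using that I(4) by (auto simp: C_def)
  have f: "finite B" "finite C" "finite D" "finite W" using fin I(1) by (auto simp: B_def C_def D_def W_def intro: finite_subset)
  have W: "w \<in> W" "\<And>r. r \<in> W \<Longrightarrow> w \<le> r" using I by (auto simp: W_def)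
  have W2: "W \<inter> D = {}" "W \<inter> C = {}" "W \<inter> B = {}" by (auto simp: W_def D_def C_def B_def)
  have MinW: "Min W = w" using W f by (intro Min_eqI) auto
  have e: "Q - insert v (B \<union> L) = D \<union> C \<union> W - L" for L
  proof -
    have "Q = insert v (W \<union> B \<union> D \<union> C)" using A I(1,2) by (auto simp: W_def)
    moreover have "v \<notin> W \<union> D \<union> C" "B \<inter> (D \<union> C \<union> W) = {}"
      using ltD(1) ltC(2) lt W2(3) by (auto simp: W_def dest: less_asym)
    ultimately show ?thesis by auto
  qed
  let ?g = "\<lambda>L. z * p0 (insert v (B \<union> L))"
  have "z * snake_first I {} = y * strip_first (Q - I) I + x * (- y) ^ card B * isum y (D \<union> C)
    (\<lambda>L. (if Q - insert v (B \<union> L) = {} then 0 else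
        y * ?g (insert (Min (Q - insert v (B \<union> L))) L)) + (if L = {} then 0 else ?g L))"
  proof (rule snake_first_insert_eq_strip_first)
    show "v \<le> r" if "r \<in> I" for r using I(4) I(5)[OF that] by auto
  qed (use I A lt ltD ltC in auto)
  also have "isum y (D \<union> C)
    (\<lambda>L. (if Q - insert v (B \<union> L) = {} then 0 else
        y * ?g (insert (Min (Q - insert v (B \<union> L))) L)) + (if L = {} then 0 else ?g L)) =
    isum y (D \<union> C) (\<lambda>L. y * ?g (insert (Min (D \<union> C \<union> W - L)) L) + (if L = {} then 0 else ?g L))"
  proof (rule isum_cong)
    fix L assume "L \<in> initial_segments (D \<union> C)"
    then have "w \<in> D \<union> C \<union> W - L" using W W2 initial_segmentsD by fastforce
    then have "D \<union> C \<union> W - L \<noteq> {}" by blast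
    then show "(if Q - insert v (B \<union> L) = {} then 0 else
        y * ?g (insert (Min (Q - insert v (B \<union> L))) L)) + (if L = {} then 0 else ?g L) =
      y * ?g (insert (Min (D \<union> C \<union> W - L)) L) + (if L = {} then 0 else ?g L)"
      unfolding e by (simp only: if_False)
  qed
  also have "\<dots> = (- y) ^ card D * isum y C (\<lambda>L. y * ?g (insert w (D \<union> L)) + (if L = {} then 0 else ?g (D \<union> L)))"
    using f W W2 ltD ltC by (intro isum_telescope_barrier) auto
  finally have 1: "z * snake_first I {} = y * strip_first (Q - I) I + x * (- y) ^ card B * ((- y) ^ card D *
     isum y C (\<lambda>L. y * ?g (insert w (D \<union> L)) + (if L = {} then 0 else ?g (D \<union> L))))" .
  have QW: "Q - W = insert v ((B \<union> D) \<union> C)" using A I W2 by (auto simp: W_def)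
  have "strip_first (Q - W) W = strip_first (insert v ((B \<union> D) \<union> C)) {w}"
    unfolding QW MinW[symmetric] using f W(1) W2 by (intro strip_first_Min) (auto simp: W_def)
  also have "\<dots> = - ((- y) ^ card (B \<union> D) * isum y C
    (\<lambda>L. y * (z * p0 (insert w (insert v (B \<union> D \<union> L)))) + (if L = {} then 0 else z * p0 (insert v (B \<union> D \<union> L)))))"
    using A I lt ltD ltC by (intro strip_first_below) (auto dest: lt ltD(1) less_trans)
  also have "card (B \<union> D) = card B + card D"
    using f lt ltD by (intro card_Un_disjoint) (auto dest: less_asym)
  finally show ?thesis
    unfolding 1 W_def[symmetric]
    by (simp add: power_add Un_assoc insert_commute[of w v] algebra_simps cong: if_cong)
qed

text \<open>The segments containing \<open>m = Min Q\<close> are treated separately because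
  \<open>m\<close> is the row that the strip would cut. Among them \<open>{m}\<close> is
  exceptional: \<open>none\<close> has no \<open>q1\<close> term there, and \<open>single\<close>
  has to supply it.\<close>

theorem exchange_empty: "z * snake_first {} {} = z * strip_first Q {}"
proof (cases "Q = {}")
  case True
  have "snake_first {} {} = p0 {}" "strip_first Q {} = q0 {}"
    unfolding snake_first_def strip_first_def G_def by (simp_all add: True step_sum_empty)
  then show ?thesis using empty by (simp only:)
next
  case False
  define m where "m = Min Q"
  define C where "C = Q - {m}"
  have mQ: "m \<in> Q" using False fin by (simp add: m_def)
  have Q: "Q = insert m C" "m \<notin> C" using mQ by (auto simp: C_def)
  have lt: "m < c" if "c \<in> C" for c
    using that fin Min_le[of Q c] by (auto simp: C_def m_def order.strict_iff_order)
  have fC: "finite C" using fin by (simp add: C_def)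
  have e: "Q - insert m L = C - L" for L using Q by auto
  let ?g = "\<lambda>L. z * p0 (insert m L)"
  have "z * snake_first {} {} = isum y Q (\<lambda>L. z * G L)"
    by (simp add: snake_first_def step_sum_empty isum_mult)
  also have "\<dots> = z * G {} - y * isum y C (\<lambda>L. z * G (insert m L))"
    unfolding Q(1) by (subst isum_insert_min[OF fC lt]) auto
  also have "z * G {} = z * p0 {} + x * (z * p1 {m} m)"
    using False by (simp add: G_def m_def[symmetric] algebra_simps)
  also have "isum y C (\<lambda>L. z * G (insert m L)) = isum y C (\<lambda>L. ?g L +
      (if C - L = {} then 0 else x * ?g (insert (Min (C - L)) L)))"
  proof (rule isum_cong)
    fix L assume "L \<in> initial_segments C"
    then have L: "L \<subseteq> C" by (rule initial_segmentsD)
    have "z * G (insert m L) = z * p0 (insert m L) +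
      (if Q - insert m L = {} then 0 else x * (z * p0 (insert (Min (Q - insert m L)) (insert m L))))"
      using L Q lt by (intro zG[of _ m]) auto
    then show "z * G (insert m L) = ?g L +
      (if C - L = {} then 0 else x * ?g (insert (Min (C - L)) L))"
      unfolding e by (simp add: insert_commute)
  qed
  finally have P: "z * snake_first {} {} = z * p0 {} + x * (z * p1 {m} m) - y * isum y C (\<lambda>L. ?g L +
      (if C - L = {} then 0 else x * ?g (insert (Min (C - L)) L)))" .
  have "z * strip_first Q {} = z * (q0 {} - y * isum y C (\<lambda>L. q0 (insert m L)) +
      x * isum y C (\<lambda>L. q1 (insert m L) m))"
    unfolding strip_first_def step_sum_empty m_def[symmetric] C_def[symmetric]
    using isum_insert_min[OF fC lt, of y q0] Q(1) by simp
  also have "\<dots> = z * q0 {} + isum y C (\<lambda>L. z * (- y * q0 (insert m L) + x * q1 (insert m L) m))"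
    unfolding isum_mult isum_add[of y C "\<lambda>L. - y * _ L" "\<lambda>L. x * _ L"] by (simp add: algebra_simps)
  also have "isum y C (\<lambda>L. z * (- y * q0 (insert m L) + x * q1 (insert m L) m)) =
    isum y C (\<lambda>L. (if L = {} then - y * (z * p0 {m}) + x * (z * p1 {m} m) + z * (z * p0 {m}) else 0) - z * ?g L)"
  proof (rule isum_cong)
    fix L assume "L \<in> initial_segments C"
    then have L: "L \<subseteq> C" by (rule initial_segmentsD)
    show "z * (- y * q0 (insert m L) + x * q1 (insert m L) m) =
      (if L = {} then - y * (z * p0 {m}) + x * (z * p1 {m} m) + z * (z * p0 {m}) else 0) - z * ?g L"
    proof (cases "L = {}")
      case True
      have n: "z * p0 {m} = y * q0 {m}" using none[of "{m}" m] mQ by simp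
      show ?thesis
        unfolding True if_P[OF refl] n single[OF mQ] by (simp add: algebra_simps)
    next
      case False
      then have "insert m L \<noteq> {m}" using L Q(2) by auto
      then have n: "z * p0 (insert m L) = y * q0 (insert m L) - x * q1 (insert m L) m"
        using L Q(1) lt by (intro none') (auto simp: less_imp_le)
      show ?thesis
        unfolding n using False by (simp add: algebra_simps)
    qed
  qed
  also have "\<dots> = - y * (z * p0 {m}) + x * (z * p1 {m} m) + z * (z * p0 {m}) - z * isum y C ?g"
    unfolding isum_diff isum_delta[OF fC] isum_mult ..
  finally have q: "z * strip_first Q {} = z * q0 {} + (- y * (z * p0 {m}) + x * (z * p1 {m} m) + z * (z * p0 {m}) - z * isum y C ?g)" .
  have "isum y C (\<lambda>L. (if C - L = {} then 0 else y * ?g (insert (Min (C - L)) L)) + ?g L)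
     = isum y C (\<lambda>L. ((if C - L = {} then 0 else y * ?g (insert (Min (C - L)) L)) +
         (if L = {} then 0 else ?g L)) + (if L = {} then ?g {} else 0))"
    by (intro isum_cong) auto
  also have "\<dots> = z * p0 {m}"
    using isum_add[of y C _ "\<lambda>L. if L = {} then ?g {} else 0"] isum_telescope[OF fC, of y ?g]
    by (simp add: isum_delta[OF fC])
  finally have t: "isum y C (\<lambda>L. if C - L = {} then 0 else y * ?g (insert (Min (C - L)) L)) + isum y C ?g
     = z * p0 {m}"
    by (simp add: isum_add)
  have t2: "y * isum y C (\<lambda>L. if C - L = {} then 0 else x * ?g (insert (Min (C - L)) L)) =
     x * isum y C (\<lambda>L. if C - L = {} then 0 else y * ?g (insert (Min (C - L)) L))"
    unfolding isum_mult[symmetric] by (intro isum_cong) (simp add: mult_ac)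
  have "y * isum y C (\<lambda>L. ?g L + (if C - L = {} then 0 else x * ?g (insert (Min (C - L)) L))) =
    y * isum y C ?g + x * (z * p0 {m} - isum y C ?g)"
    unfolding isum_add distrib_left t2 t[symmetric] by (simp add: algebra_simps)
  then show ?thesis
    unfolding P q using empty by (simp add: algebra_simps)
qed

text \<open>For the snake, a row already claimed by the strip is absent.
  \<open>step_sum_insert_identity\<close> puts it back at the price of a snake arriving in that row,
  which reduces the claim to \<open>exchange_empty\<close> and
  \<open>exchange_single\<close>.\<close>

theorem exchange_moved_single:
  assumes v: "v \<in> Q"
  shows "z * snake_first {} {v} = y * strip_first (Q - {v}) {v} + z * strip_first Q {}"
proof -
  define B where "B = {a\<in>Q. a < v}"
  define C where "C = {a\<in>Q. v < a}"
  have A: "Q - {v} = B \<union> C" "Q = insert v (B \<union> C)" using v by (auto simp: B_def C_def)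
  have "snake_first {} {v} = snake_first {} {} + snake_first {v} {}"
  proof -
    have "snake_first {} {v} = step_sum y (B \<union> C) {} G" "snake_first {v} {} = step_sum y (B \<union> C) {v} G"
      "snake_first {} {} = step_sum y (insert v (B \<union> C)) {} G"
      by (simp_all add: snake_first_def A(1) A(2)[symmetric])
    moreover have "finite B" "finite C" "\<And>b. b \<in> B \<Longrightarrow> b < v" "\<And>c. c \<in> C \<Longrightarrow> v < c"
      using fin by (auto simp: B_def C_def)
    ultimately show ?thesis by (simp only: step_sum_insert_identity)
  qed
  then show ?thesis
    using exchange_empty exchange_single[OF v] by (simp add: distrib_left)
qed

text \<open>The free rows split into blocks below \<open>v\<close>, between \<open>v\<close> and
  \<open>w\<close>, and above \<open>w\<close>. The sums over segments of the middle block occur in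
  two of the terms on the right and cancel; everything else runs over segments \<open>L\<close> of
  the top block and is compared termwise.\<close>

theorem exchange_moved_least:
  assumes I: "I \<subseteq> Q" "v \<in> I" "w \<in> I" "v < w" "\<And>r. r \<in> I \<Longrightarrow> r = v \<or> w \<le> r"
  shows "z * snake_first (I - {v}) {v} =
    y * strip_first (Q - I) I + z * strip_first (Q - (I - {v})) (I - {v}) - y * strip_first (Q - (I - {w})) (I - {w})"
proof -
  define B where "B = {a\<in>Q - I. a < v}"
  define D where "D = {a\<in>Q - I. v < a \<and> a < w}"
  define C where "C = {a\<in>Q - I. w < a}"
  have A: "Q - I = B \<union> (D \<union> C)"
    using I by (auto simp: B_def C_def D_def intro: linorder_neqE_nat)
  have lt: "b < v" "b < w" if "b \<in> B" for b using that I(4) by (auto simp: B_def)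
  have ltD: "v < d" "d < w" if "d \<in> D" for d using that by (auto simp: D_def)
  have ltC: "w < c" "v < c" if "c \<in> C" for c using that I(4) by (auto simp: C_def)
  have ltDC: "d < c" if "d \<in> D" "c \<in> C" for d c using that ltD ltC less_trans by blast
  have f: "finite B" "finite C" "finite D" "finite I" using fin I(1) by (auto simp: B_def C_def D_def intro: finite_subset)
  have disj: "I \<inter> (B \<union> (D \<union> C)) = {}" using A by blast
  have vw: "v \<in> Q" "w \<in> Q" "v \<notin> B \<union> (D \<union> C)" "w \<notin> B \<union> (D \<union> C)" using I disj by auto
  have sub: "B \<union> (D \<union> C) \<subseteq> Q" using A by blast
  have Min: "Min I = v" "Min (I - {v}) = w" "Min (I - {w}) = v"
  proof -
    have le: "v \<le> r" if "r \<in> I" for r using I(4) I(5)[OF that] by auto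
    have "w \<le> r" if "r \<in> I - {v}" for r using I(5)[of r] that by auto
    then show "Min I = v" "Min (I - {v}) = w" "Min (I - {w}) = v"
      using f I(2-4) le by (auto intro!: Min_eqI)
  qed
  have Qv: "Q - (I - {v}) = insert v ((B \<union> D) \<union> C)" using A I by blast
  have Qw: "Q - (I - {w}) = B \<union> insert w (D \<union> C)" using A I by blast
  have card: "card (B \<union> D) = card B + card D"
    using f lt ltD by (intro card_Un_disjoint) (auto dest: less_asym)
  let ?BD = "B \<union> D"
  let ?F = "\<lambda>L. y * (z * p0 (insert v (B \<union> L))) + (if L = {} then 0 else z * p0 (B \<union> L) +
        x * (z * p1 (insert v (B \<union> L)) v) - x * (z * p0 (insert v (B \<union> L))))"
  have qI: "strip_first (Q - I) I = strip_first (B \<union> (D \<union> C)) {v}"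
    unfolding A Min(1)[symmetric] using f I disj by (intro strip_first_Min) auto
  have q1: "y * strip_first (Q - I) I = (- y) ^ card B * isum y (D \<union> C) ?F"
    unfolding qI by (rule strip_first_eq) (use vw sub lt ltD ltC in auto)
  have qI: "strip_first (Q - (I - {w})) (I - {w}) = strip_first (B \<union> insert w (D \<union> C)) {v}"
    unfolding Qw Min(3)[symmetric] using f I disj by (intro strip_first_Min) auto
  have q2: "y * strip_first (Q - (I - {w})) (I - {w}) = (- y) ^ card B * isum y (insert w (D \<union> C)) ?F"
    unfolding qI by (rule strip_first_eq) (use vw sub lt ltD ltC I(4) in auto)
  have "strip_first (Q - (I - {v})) (I - {v}) = strip_first (insert v (?BD \<union> C)) {w}"
    unfolding Qv Min(2)[symmetric] using f I disj by (intro strip_first_Min) auto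
  also have "\<dots> = - ((- y) ^ card ?BD * isum y C
    (\<lambda>L. y * (z * p0 (insert w (insert v (?BD \<union> L)))) + (if L = {} then 0 else z * p0 (insert v (?BD \<union> L)))))"
    using vw sub lt ltD ltC I(4) by (intro strip_first_below) auto
  finally have q3: "z * strip_first (Q - (I - {v})) (I - {v}) = - ((- y) ^ card ?BD * isum y C
    (\<lambda>L. z * (y * (z * p0 (insert w (insert v (?BD \<union> L)))) + (if L = {} then 0 else z * p0 (insert v (?BD \<union> L))))))"
    unfolding isum_mult by simp
  have s1: "isum y (D \<union> C) ?F = isum y D ?F + (- y) ^ card D *
      isum y C (\<lambda>L. if L = {} then 0 else ?F (D \<union> L))"
    by (intro isum_split f ltDC)
  have s2: "isum y (insert w (D \<union> C)) ?F = isum y D ?F - y * (- y) ^ card D *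
      isum y C (\<lambda>L. ?F (insert w (D \<union> L)))"
    by (intro isum_split_insert f ltD ltC)
  have "snake_first (I - {v}) {v} = step_sum y (?BD \<union> C) (I - {v}) G"
  proof -
    have "Q - (I - {v}) - {v} = ?BD \<union> C" using A I by blast
    then show ?thesis by (simp add: snake_first_def)
  qed
  also have "\<dots> = (- y) ^ card ?BD * isum y C
     (\<lambda>L. y * G (insert w (?BD \<union> L)) + (if L = {} then 0 else G (?BD \<union> L)))"
    using f I disj Min lt ltD ltC by (intro step_sum_nonempty) auto
  finally have "z * snake_first (I - {v}) {v} = (- y) ^ card ?BD * isum y C
     (\<lambda>L. z * (y * G (insert w (?BD \<union> L)) + (if L = {} then 0 else G (?BD \<union> L))))"
    unfolding isum_mult by (simp add: mult_ac)
  also have "isum y C (\<lambda>L. z * (y * G (insert w (?BD \<union> L)) + (if L = {} then 0 else G (?BD \<union> L)))) =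
    isum y C (\<lambda>L. ((if L = {} then 0 else ?F (D \<union> L)) + y * ?F (insert w (D \<union> L))) -
      z * (y * (z * p0 (insert w (insert v (?BD \<union> L)))) + (if L = {} then 0 else z * p0 (insert v (?BD \<union> L)))))"
  proof (rule isum_cong)
    fix L assume "L \<in> initial_segments C"
    then have L: "L \<subseteq> C" by (rule initial_segmentsD)
    have low: "v \<le> r" if "r \<in> Q" "r \<notin> ?BD \<union> L" for r
    proof (cases "r \<in> I")
      case True
      then show ?thesis using I(4) I(5)[of r] by auto
    next
      case False
      then have "r \<in> C" using that A by blast
      then show ?thesis using ltC(2) less_imp_le by blast
    qed
    have v: "v \<notin> insert w (?BD \<union> L)" "v \<notin> ?BD \<union> L" using vw I(4) L by auto
    have a: "z * G (insert w (?BD \<union> L)) = z * p0 (insert w (?BD \<union> L)) +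
        x * (z * p1 (insert v (insert w (?BD \<union> L))) v)"
      using low v vw sub L by (intro zG_Min) auto
    have b: "z * G (?BD \<union> L) = z * p0 (?BD \<union> L) + x * (z * p1 (insert v (?BD \<union> L)) v)"
      using low v vw sub L by (intro zG_Min) auto
    have c: "z * (y * G (insert w (?BD \<union> L)) + (if L = {} then 0 else G (?BD \<union> L))) =
       y * (z * G (insert w (?BD \<union> L))) + (if L = {} then 0 else z * G (?BD \<union> L))"
      by (simp add: algebra_simps)
    have e: "B \<union> (D \<union> L) = ?BD \<union> L" "B \<union> insert w (D \<union> L) = insert w (?BD \<union> L)" by auto
    show "z * (y * G (insert w (?BD \<union> L)) + (if L = {} then 0 else G (?BD \<union> L))) =
      ((if L = {} then 0 else ?F (D \<union> L)) + y * ?F (insert w (D \<union> L))) -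
      z * (y * (z * p0 (insert w (insert v (?BD \<union> L)))) + (if L = {} then 0 else z * p0 (insert v (?BD \<union> L))))"
      unfolding c a b e by (cases "L = {}") (simp_all add: insert_commute[of w v] algebra_simps)
  qed
  finally show ?thesis
    unfolding q1 q2 q3 s1 s2 card isum_diff isum_add[of y C "\<lambda>L. if _ L then 0 else _ L" "\<lambda>L. y * _ L"] isum_mult
    by (simp add: power_add algebra_simps)
qed

text \<open>The candidates of the snake are \<open>Q - I\<close> on both sides, and \<open>w\<close>
  is not the lowest arriving row, so \<open>step_sum_Min_only\<close> cannot tell the two sides
  apart.\<close>

theorem exchange_other:
  assumes "I \<subseteq> Q" "v \<in> I" "w \<in> I" "v < w"
  shows "snake_first (I - {w}) {w} = snake_first I {}"
proof -
  have f: "finite I" using assms fin finite_subset by blast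
  have e: "Q - (I - {w}) - {w} = Q - I" "Q - I - {} = Q - I" using assms by auto
  have "Min (I - {w}) = Min I"
  proof (rule Min_eqI)
    show "Min I \<in> I - {w}"
      using Min_le[OF f assms(2)] Min_in[OF f] assms by auto
  qed (use f in auto)
  moreover have "I - {w} \<noteq> {}" "(I - {w}) \<inter> (Q - I) = {}" "I \<noteq> {}" using assms by auto
  ultimately show ?thesis
    using f fin unfolding snake_first_def e
    by (simp add: step_sum_Min_only[of _ I] step_sum_Min_only[of _ "I - {w}"])
qed

end

section \<open>Exchanging strips and snakes column by column\<close>

definition put :: "nat \<Rightarrow> nat set \<Rightarrow> (nat \<Rightarrow> nat) \<Rightarrow> nat \<Rightarrow> nat" where
  "put c J b = (\<lambda>r. if r \<in> J then c else b r)"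

definition site :: "nat set \<Rightarrow> nat \<Rightarrow> (nat \<Rightarrow> nat) \<Rightarrow> nat set" where
  "site R c b = {r \<in> R. b r = c}"

text \<open>Deleting a strip from right to left only ever shortens the lowest row of the current length:
  the strip operator is a product over the columns \<open>c\<close> of operators \<open>1 + x D(c)\<close>.\<close>

fun strip_scan :: "'a::comm_ring_1 \<Rightarrow> nat set \<Rightarrow> nat \<Rightarrow> ((nat \<Rightarrow> nat) \<Rightarrow> 'a) \<Rightarrow> (nat \<Rightarrow> nat) \<Rightarrow> 'a" where
  "strip_scan x R 0 g b = g b"
| "strip_scan x R (Suc c) g b = strip_scan x R c g b + (if site R (Suc c) b = {} then 0 else
     x * strip_scan x R c g (b(Min (site R (Suc c) b) := c)))"

text \<open>\<open>K\<close> holds the rows cut one column to the right, already shortened in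
  \<open>b\<close>. They only seem to end in the current column, so they are taken out of the site.
  The continuation \<open>g\<close> receives the last set of cut rows, which after a scan of at
  least one column is the set cut in column 1; this is how special snakes are recognised.\<close>

fun snake_scan :: "'a::comm_ring_1 \<Rightarrow> nat set \<Rightarrow> nat \<Rightarrow> nat set \<Rightarrow> (nat set \<Rightarrow> (nat \<Rightarrow> nat) \<Rightarrow> 'a) \<Rightarrow>
    (nat \<Rightarrow> nat) \<Rightarrow> 'a" where
  "snake_scan y R 0 K g b = g K b"
| "snake_scan y R (Suc c) K g b =
     step_sum y (site R (Suc c) b - K) K (\<lambda>K'. snake_scan y R c K' g (put c K' b))"

text \<open>Describes what a scan of the columns up to \<open>c\<close> can make of
  \<open>b\<close>: longer rows are untouched and the others stay within column \<open>c\<close>.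
  Continuations need to be known only on such compositions.\<close>

definition agree :: "nat \<Rightarrow> (nat \<Rightarrow> nat) \<Rightarrow> (nat \<Rightarrow> nat) \<Rightarrow> bool" where
  "agree c b d \<longleftrightarrow> (\<forall>r. (c < b r \<longrightarrow> d r = b r) \<and> (b r \<le> c \<longrightarrow> d r \<le> c))"

lemma agree_site: "agree c b d \<Longrightarrow> site R (Suc c) d = site R (Suc c) b"
  unfolding agree_def site_def by (metis Suc_n_not_le_n lessI linorder_not_le)

lemma agree_Suc:
  assumes "agree c (put c J b) d" "\<And>r. r \<in> J \<Longrightarrow> b r = Suc c"
  shows "agree (Suc c) b d"
  unfolding agree_def
proof (intro allI conjI impI)
  fix r
  have d: "c < put c J b r \<Longrightarrow> d r = put c J b r" "put c J b r \<le> c \<Longrightarrow> d r \<le> c"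
    using assms(1) by (auto simp: agree_def)
  show "d r = b r" if "Suc c < b r"
    using that d(1) assms(2)[of r] by (cases "r \<in> J") (auto simp: put_def)
  show "d r \<le> Suc c" if "b r \<le> Suc c"
    using that d by (cases "put c J b r \<le> c") (auto simp: put_def split: if_splits)
qed

lemma fun_upd_eq_put: "b(m := c) = put c {m} b"
  by (auto simp: put_def)

lemma finite_site [simp]: "finite R \<Longrightarrow> finite (site R c b)"
  by (simp add: site_def)

lemma Min_site:
  assumes "finite R" "site R c b \<noteq> {}"
  shows "Min (site R c b) \<in> R" "b (Min (site R c b)) = c"
  using Min_in[OF finite_site[OF assms(1)] assms(2)] by (auto simp: site_def)

lemma strip_scan_cong:
  assumes "finite R" "\<And>d. agree c b d \<Longrightarrow> g d = g' d"
  shows "strip_scan x R c g b = strip_scan x R c g' b"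
  using assms(2)
proof (induction c arbitrary: b)
  case 0
  then show ?case by (simp add: agree_def)
next
  case (Suc c)
  have "strip_scan x R c g b = strip_scan x R c g' b"
    using Suc.prems agree_Suc[of c "{}" b] by (intro Suc.IH) (simp add: put_def)
  moreover have "strip_scan x R c g (b(Min (site R (Suc c) b) := c)) =
      strip_scan x R c g' (b(Min (site R (Suc c) b) := c))" if "site R (Suc c) b \<noteq> {}"
    using Min_site[OF assms(1) that] Suc.prems unfolding fun_upd_eq_put
    by (intro Suc.IH) (auto dest: agree_Suc)
  ultimately show ?case by simp
qed

lemma snake_scan_cong:
  assumes "\<And>r. r \<in> K \<Longrightarrow> b r = c" "\<And>K a. agree c b a \<Longrightarrow> g K a = g' K a"
  shows "snake_scan y R c K g b = snake_scan y R c K g' b"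
  using assms
proof (induction c arbitrary: b K)
  case 0
  then show ?case by (simp add: agree_def)
next
  case (Suc c)
  have "snake_scan y R c K' g (put c K' b) = snake_scan y R c K' g' (put c K' b)"
    if "K' \<in> snake_steps (site R (Suc c) b - K) K" for K'
  proof (rule Suc.IH)
    have K': "b r = Suc c" if "r \<in> K'" for r
      using that snake_stepsD[OF \<open>K' \<in> _\<close>] Suc.prems(1) by (auto simp: site_def)
    show "g L a = g' L a" if "agree c (put c K' b) a" for L a
      using that K' by (intro Suc.prems(2)) (rule agree_Suc)
  qed (simp add: put_def)
  then show ?case by (auto intro: step_sum_cong)
qed

text \<open>Rows longer than \<open>c\<close> are invisible to the remaining scan. Thus rows claimed
  by the other operation can be added to or removed from the row set as long as they are still too
  long.\<close>

lemma strip_scan_restrict: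
  assumes "finite R" "finite R'" "{r\<in>R. b r \<le> c} = {r\<in>R'. b r \<le> c}"
  shows "strip_scan x R c g b = strip_scan x R' c g b"
  using assms(3)
proof (induction c arbitrary: b)
  case (Suc c)
  have iff: "r \<in> R \<longleftrightarrow> r \<in> R'" if "b r \<le> Suc c" for r using Suc.prems that by blast
  have s: "site R (Suc c) b = site R' (Suc c) b" using iff by (auto simp: site_def)
  have "strip_scan x R c g b = strip_scan x R' c g b" using iff by (intro Suc.IH) auto
  moreover have "strip_scan x R c g (b(Min (site R (Suc c) b) := c)) = strip_scan x R' c g (b(Min (site R (Suc c) b) := c))"
    if "site R (Suc c) b \<noteq> {}"
    using iff Min_site[OF assms(1) that] by (intro Suc.IH) (auto split: if_splits)
  ultimately show ?case by (simp add: s)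
qed simp

lemma snake_scan_restrict:
  assumes "{r\<in>R. b r \<le> c} = {r\<in>R'. b r \<le> c}" "\<And>r. r \<in> K \<Longrightarrow> b r \<le> c"
  shows "snake_scan y R c K g b = snake_scan y R' c K g b"
  using assms
proof (induction c arbitrary: b K)
  case (Suc c)
  have iff: "r \<in> R \<longleftrightarrow> r \<in> R'" if "b r \<le> Suc c" for r using Suc.prems(1) that by blast
  have s: "site R (Suc c) b = site R' (Suc c) b" using iff by (auto simp: site_def)
  have "snake_scan y R c K' g (put c K' b) = snake_scan y R' c K' g (put c K' b)"
    if "K' \<in> snake_steps (site R (Suc c) b - K) K" for K'
  proof (rule Suc.IH)
    have "b r \<le> Suc c" if "r \<in> K'" for r
      using that snake_stepsD[OF \<open>K' \<in> _\<close>] Suc.prems(2) by (auto simp: site_def)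
    then show "{r \<in> R. put c K' b r \<le> c} = {r \<in> R'. put c K' b r \<le> c}"
      using iff by (auto simp: put_def split: if_splits)
  qed (simp add: put_def)
  then show ?case by (auto simp: s intro: step_sum_cong)
qed simp

lemma strip_scan_put:
  assumes "finite R" "J \<inter> R = {}"
  shows "strip_scan x R c g (put j J b) = strip_scan x R c (\<lambda>d. g (put j J d)) b"
proof (induction c arbitrary: b)
  case (Suc c)
  have s: "site R (Suc c) (put j J b) = site R (Suc c) b"
    using assms(2) by (auto simp: site_def put_def)
  have u: "(put j J b)(m := c) = put j J (b(m := c))" if "m \<in> R" for m
    using that assms(2) by (auto simp: put_def fun_eq_iff)
  show ?case
  proof (cases "site R (Suc c) b = {}")
    case True
    then show ?thesis by (simp add: s Suc)
  next
    case False
    show ?thesis unfolding strip_scan.simps s u[OF Min_site(1)[OF assms(1) False]] Suc ..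
  qed
qed simp

lemma snake_scan_put:
  assumes "J \<inter> R = {}" "J \<inter> K = {}"
  shows "snake_scan y R c K g (put j J b) = snake_scan y R c K (\<lambda>K a. g K (put j J a)) b"
  using assms(2)
proof (induction c arbitrary: b K)
  case (Suc c)
  have s: "site R (Suc c) (put j J b) = site R (Suc c) b"
    using assms(1) by (auto simp: site_def put_def)
  have "snake_scan y R c K' g (put c K' (put j J b)) = snake_scan y R c K' (\<lambda>K a. g K (put j J a)) (put c K' b)"
    if "K' \<in> snake_steps (site R (Suc c) b - K) K" for K'
  proof -
    have "J \<inter> K' = {}" using snake_stepsD[OF that] assms(1) Suc.prems by (auto simp: site_def)
    moreover from this have "put c K' (put j J b) = put j J (put c K' b)"
      by (auto simp: put_def fun_eq_iff)
    ultimately show ?thesis by (simp add: Suc.IH)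
  qed
  then show ?case by (auto simp: s intro: step_sum_cong)
qed simp

lemma strip_scan_mult: "strip_scan x R c (\<lambda>d. k * g d) b = k * strip_scan x R c g b"
  by (induction c arbitrary: b) (auto simp: algebra_simps)

lemma strip_scan_add: "strip_scan x R c (\<lambda>d. g d + h d) b = strip_scan x R c g b + strip_scan x R c h b"
  by (induction c arbitrary: b) (auto simp: algebra_simps)

lemma strip_scan_zero [simp]: "strip_scan x R c (\<lambda>d. 0) b = 0"
  by (induction c arbitrary: b) auto

lemma strip_scan_sum: "strip_scan x R c (\<lambda>d. \<Sum>j\<in>J. g j d) b = (\<Sum>j\<in>J. strip_scan x R c (g j) b)"
  by (induction J rule: infinite_finite_induct) (auto simp: strip_scan_add)

lemma strip_scan_step_sum: "strip_scan x R c (\<lambda>d. step_sum y A K (\<lambda>K'. g K' d)) b = step_sum y A K (\<lambda>K'. strip_scan x R c (g K') b)"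
  by (simp add: step_sum_def strip_scan_sum strip_scan_mult)

lemma snake_scan_mult: "snake_scan y R c K (\<lambda>K a. k * g K a) b = k * snake_scan y R c K g b"
  by (induction c arbitrary: K b) (auto simp: step_sum_mult)

lemma snake_scan_add: "snake_scan y R c K (\<lambda>K a. g K a + h K a) b = snake_scan y R c K g b + snake_scan y R c K h b"
  by (induction c arbitrary: K b) (auto simp: step_sum_add)

section \<open>The partial sums of both orders and the relations between them\<close>

locale scan =
  fixes x y :: "'a::comm_ring_1" and R :: "nat set" and i :: nat and f :: "(nat \<Rightarrow> nat) \<Rightarrow> 'a"
  assumes R: "finite R" "i \<in> R" "\<And>r. r \<in> R \<Longrightarrow> i \<le> r"
begin

text \<open>\<open>U\<close> holds rows that the strip cuts in column \<open>c + 1\<close>. The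
  snake precedes the strip and must not touch them, although \<open>b\<close> already records their
  shortened length; the strip itself may go on cutting them. The factor \<open>y\<close> for
  \<open>i \<in> K\<close> selects snakes that empty row \<open>i\<close> and shifts the exponent by
  one.\<close>

definition P :: "nat \<Rightarrow> nat set \<Rightarrow> nat set \<Rightarrow> (nat \<Rightarrow> nat) \<Rightarrow> 'a" where
  "P c K U b = snake_scan y (R - U) c K (\<lambda>K a. (if i \<in> K then y else 0) * strip_scan x R c f a) b"

text \<open>The case \<open>K = {}\<close> accounts for compositions whose row \<open>i\<close> was removed by the strip, so that
  there is no snake left to delete.\<close>

definition end_weight :: "nat set \<Rightarrow> (nat \<Rightarrow> nat) \<Rightarrow> 'a" where
  "end_weight K d = (if i \<in> K then (y - x) * f d else if K = {} \<and> d i = 0 then - (y * f d) else 0)"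

text \<open>The rows of \<open>K\<close> are cut in column \<open>c + 1\<close> by the snake, after
  the strip has passed. To the strip they are still longer, hence the row set
  \<open>R - K\<close>.\<close>

definition Q :: "nat \<Rightarrow> nat set \<Rightarrow> (nat \<Rightarrow> nat) \<Rightarrow> 'a" where
  "Q c K b = strip_scan x (R - K) c (\<lambda>d. snake_scan y R c K end_weight d) b"

text \<open>Which rows end in column \<open>c + 1\<close> after the whole snake depends only on
  \<open>K'\<close>, since the columns to the left leave longer rows alone. The choice of the strip
  in this column can therefore be made before the snake is scanned any further.\<close>

lemma P_Suc:
  assumes KU: "K \<subseteq> site R (Suc c) b" "U \<subseteq> site R (Suc c) b" "K \<inter> U = {}"
  defines "S \<equiv> site R (Suc c) b"
  shows "P (Suc c) K U b = step_sum y (S - K - U) K (\<lambda>K'. P c K' {} (put c K' b) +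
    (if S - K' = {} then 0 else x * P c K' {Min (S - K')} (put c (insert (Min (S - K')) K') b)))"
proof -
  have s: "site (R - U) (Suc c) b - K = S - K - U" by (auto simp: S_def site_def)
  have "snake_scan y (R - U) c K' (\<lambda>K a. (if i \<in> K then y else 0) * strip_scan x R (Suc c) f a) (put c K' b) =
     P c K' {} (put c K' b) +
    (if S - K' = {} then 0 else x * P c K' {Min (S - K')} (put c (insert (Min (S - K')) K') b))"
    (is "?l = _")
    if "K' \<in> snake_steps (S - K - U) K" for K'
  proof -
    have K': "K' \<subseteq> S" "K' \<inter> U = {}" using snake_stepsD[OF that] KU by (auto simp: S_def)
    have pos: "b r = Suc c" if "r \<in> S" for r using that by (simp add: S_def site_def)
    let ?b = "put c K' b"
    have S': "site R (Suc c) ?b = S - K'" by (auto simp: S_def site_def put_def)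
    have fS: "finite (S - K')" using R(1) by (simp add: S_def)
    let ?m = "Min (S - K')"
    let ?e = "\<lambda>K. if i \<in> K then y else 0"
    have "?l = snake_scan y (R - U) c K' (\<lambda>K a. ?e K * strip_scan x R c f a +
        (if S - K' = {} then 0 else x * (?e K * strip_scan x R c f (put c {?m} a)))) ?b"
    proof (rule snake_scan_cong)
      fix K a assume "agree c ?b a"
      then have e: "site R (Suc c) a = S - K'" using agree_site S' by simp
      show "?e K * strip_scan x R (Suc c) f a = ?e K * strip_scan x R c f a +
        (if S - K' = {} then 0 else x * (?e K * strip_scan x R c f (put c {?m} a)))"
        unfolding strip_scan.simps e by (simp add: fun_upd_eq_put algebra_simps)
    qed (simp add: put_def)
    also have "\<dots> = snake_scan y (R - U) c K' (\<lambda>K a. ?e K * strip_scan x R c f a) ?b +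
       (if S - K' = {} then 0 else x * snake_scan y (R - U) c K' (\<lambda>K a. ?e K * strip_scan x R c f (put c {?m} a)) ?b)"
      by (cases "S - K' = {}") (simp_all add: snake_scan_add snake_scan_mult)
    also have "snake_scan y (R - U) c K' (\<lambda>K a. ?e K * strip_scan x R c f a) ?b = P c K' {} ?b"
    proof -
      have "\<not> put c K' b r \<le> c" if "r \<in> U" for r
        using that K' KU pos by (auto simp: put_def S_def)
      then show ?thesis
        unfolding P_def by (intro snake_scan_restrict) (blast, simp add: put_def)
    qed
    also have "(if S - K' = {} then 0 else x * snake_scan y (R - U) c K' (\<lambda>K a. ?e K * strip_scan x R c f (put c {?m} a)) ?b)
      = (if S - K' = {} then 0 else x * P c K' {?m} (put c (insert ?m K') b))"
    proof (cases "S - K' = {}")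
      case False
      then have m: "?m \<in> S - K'" using Min_in[OF fS] by blast
      have "\<not> put c K' b r \<le> c" if "r \<in> insert ?m U" for r
        using that K' KU m pos by (auto simp: put_def S_def)
      then have "snake_scan y (R - U) c K' (\<lambda>K a. ?e K * strip_scan x R c f (put c {?m} a)) ?b =
         snake_scan y (R - {?m}) c K' (\<lambda>K a. ?e K * strip_scan x R c f (put c {?m} a)) ?b"
        by (intro snake_scan_restrict) (blast, simp add: put_def)
      also have "\<dots> = snake_scan y (R - {?m}) c K' (\<lambda>K a. ?e K * strip_scan x R c f a) (put c {?m} ?b)"
        using m by (subst snake_scan_put) auto
      also have "put c {?m} ?b = put c (insert ?m K') b" by (auto simp: put_def)
      finally show ?thesis by (simp add: P_def)
    qed simp
    finally show ?thesis .
  qed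
  then show ?thesis
    unfolding P_def snake_scan.simps s by (auto simp: P_def intro: step_sum_cong)
qed

lemma Q_Suc:
  assumes K: "K \<subseteq> site R (Suc c) b"
  defines "S \<equiv> site R (Suc c) b"
  shows "Q (Suc c) K b = step_sum y (S - K) K (\<lambda>K'. Q c K' (put c K' b)) +
    (if S - K = {} then 0 else
       x * step_sum y (S - K - {Min (S - K)}) K (\<lambda>K'. Q c K' (put c (insert (Min (S - K)) K') b)))"
proof -
  let ?m = "Min (S - K)"
  have pos: "b r = Suc c" if "r \<in> S" for r using that by (simp add: S_def site_def)
  have s: "site (R - K) (Suc c) b = S - K" by (auto simp: S_def site_def)
  have fS: "finite (S - K)" using R(1) by (simp add: S_def)
  have part: "strip_scan x (R - K) c (\<lambda>d. snake_scan y R (Suc c) K end_weight d) (put c J b) =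
     step_sum y (S - K - J) K (\<lambda>K'. Q c K' (put c (J \<union> K') b))" if J: "J \<subseteq> S - K" for J
  proof -
    have s': "site R (Suc c) (put c J b) = S - J"
      using J by (auto simp: S_def site_def put_def)
    have "strip_scan x (R - K) c (\<lambda>d. snake_scan y R (Suc c) K end_weight d) (put c J b) =
      strip_scan x (R - K) c (\<lambda>d. step_sum y (S - K - J) K (\<lambda>K'. snake_scan y R c K' end_weight (put c K' d))) (put c J b)"
    proof (rule strip_scan_cong)
      fix d assume "agree c (put c J b) d"
      then have "site R (Suc c) d - K = S - K - J" using agree_site s' by auto
      then show "snake_scan y R (Suc c) K end_weight d =
        step_sum y (S - K - J) K (\<lambda>K'. snake_scan y R c K' end_weight (put c K' d))"
        by simp
    qed (use R(1) in simp)
    also have "\<dots> = step_sum y (S - K - J) K (\<lambda>K'. strip_scan x (R - K) c (\<lambda>d. snake_scan y R c K' end_weight (put c K' d)) (put c J b))"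
      by (rule strip_scan_step_sum)
    also have "\<dots> = step_sum y (S - K - J) K (\<lambda>K'. Q c K' (put c (J \<union> K') b))"
    proof (rule step_sum_cong)
      fix K' assume "K' \<in> snake_steps (S - K - J) K"
      then have K': "K' \<subseteq> S" "K' \<inter> J = {}"
        using snake_stepsD[of K' "S - K - J" K] K J by (auto simp: S_def)
      have "\<not> put c J b r \<le> c" if "r \<in> K \<union> K'" for r
        using that K' K J pos by (auto simp: put_def S_def)
      then have "strip_scan x (R - K) c (\<lambda>d. snake_scan y R c K' end_weight (put c K' d)) (put c J b) =
        strip_scan x (R - K') c (\<lambda>d. snake_scan y R c K' end_weight (put c K' d)) (put c J b)"
        using R(1) by (intro strip_scan_restrict) auto
      also have "\<dots> = strip_scan x (R - K') c (\<lambda>d. snake_scan y R c K' end_weight d) (put c K' (put c J b))"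
        using R(1) by (subst strip_scan_put) auto
      also have "put c K' (put c J b) = put c (J \<union> K') b" by (auto simp: put_def)
      finally show "strip_scan x (R - K) c (\<lambda>d. snake_scan y R c K' end_weight (put c K' d)) (put c J b) =
        Q c K' (put c (J \<union> K') b)" by (simp add: Q_def)
    qed
    finally show ?thesis .
  qed
  have mv0: "put c {} b = b" by (simp add: put_def)
  have "Q (Suc c) K b = strip_scan x (R - K) c (\<lambda>d. snake_scan y R (Suc c) K end_weight d) b +
     (if S - K = {} then 0 else x * strip_scan x (R - K) c (\<lambda>d. snake_scan y R (Suc c) K end_weight d) (put c {?m} b))"
    unfolding Q_def strip_scan.simps s by (simp only: fun_upd_eq_put)
  moreover have "strip_scan x (R - K) c (\<lambda>d. snake_scan y R (Suc c) K end_weight d) b =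
     step_sum y (S - K) K (\<lambda>K'. Q c K' (put c K' b))"
    using part[of "{}"] by (simp add: mv0 del: snake_scan.simps)
  moreover have "strip_scan x (R - K) c (\<lambda>d. snake_scan y R (Suc c) K end_weight d) (put c {?m} b) =
     step_sum y (S - K - {?m}) K (\<lambda>K'. Q c K' (put c (insert ?m K') b))" if "S - K \<noteq> {}"
    using part[of "{?m}"] Min_in[OF fS that] by (simp del: snake_scan.simps)
  ultimately show ?thesis by (simp del: snake_scan.simps)
qed

text \<open>\<open>I\<close> is the set of rows cut in column \<open>c + 1\<close> by either
  operation, already shortened to \<open>c\<close> in \<open>b\<close>. The conjuncts are the
  assumptions of \<open>site_exchange\<close>, and the exchange theorems return the same conjuncts
  for \<open>c + 1\<close>; so the induction starts at column 0 and moves right, although the scans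
  move left.\<close>

definition exchanges :: "nat \<Rightarrow> nat set \<Rightarrow> (nat \<Rightarrow> nat) \<Rightarrow> bool" where
  "exchanges c I b \<longleftrightarrow>
    (I = {} \<longrightarrow> (y - x) * P c {} {} b = (y - x) * Q c {} b) \<and>
    (\<forall>m\<in>I. (\<forall>r\<in>I. m \<le> r) \<longrightarrow>
       (y - x) * P c I {} b = y * Q c I b - (if I = {m} then 0 else x * Q c (I - {m}) b)) \<and>
    (\<forall>m. I = {m} \<longrightarrow> (y - x) * P c {} {m} b = y * Q c {m} b + (y - x) * Q c {} b) \<and>
    (\<forall>m\<in>I. \<forall>w\<in>I. m < w \<longrightarrow> (\<forall>r\<in>I. r = m \<or> w \<le> r) \<longrightarrow>
       (y - x) * P c (I - {m}) {m} b = y * Q c I b + (y - x) * Q c (I - {m}) b - y * Q c (I - {w}) b) \<and>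
    (\<forall>m\<in>I. \<forall>w\<in>I. m < w \<longrightarrow> P c (I - {w}) {w} b = P c I {} b)"

text \<open>In column 0 it only matters whether \<open>i\<close> belongs to \<open>I\<close>, in
  which case it is the least element. The value \<open>- (y * f d)\<close> in
  \<open>end_weight\<close> is what the relation for \<open>I = {i}\<close> with a strip cut
  requires: \<open>y * (y - x) - (y - x) * y = 0\<close>. That same value would spoil the
  \<open>x\<close> term in the relation for \<open>P c I {} b\<close> when \<open>I = {m}\<close>,
  hence the exception there.\<close>

lemma exchanges_0:
  assumes "I \<subseteq> site R 0 b" "i \<in> I \<or> 0 < b i"
  shows "exchanges 0 I b"
proof -
  have IR: "I \<subseteq> R" using assms(1) by (auto simp: site_def)
  have I0: "b r = 0" if "r \<in> I" for r using assms(1) that by (auto simp: site_def)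
  have P: "P 0 K U b = (if i \<in> K then y * f b else 0)" for K U
    by (simp add: P_def)
  have Q: "Q 0 K b = end_weight K b" for K
    by (simp add: Q_def)
  have min: "m = i" if "i \<in> I" "m \<in> I" "\<forall>r\<in>I. m \<le> r" for m
    using that R IR by (meson antisym subsetD)
  have 1: "(y - x) * P 0 I {} b = y * Q 0 I b - (if I = {m} then 0 else x * Q 0 (I - {m}) b)"
    if "m \<in> I" "\<forall>r\<in>I. m \<le> r" for m
  proof (cases "i \<in> I")
    case True
    then have "I - {m} \<noteq> {}" if "I \<noteq> {m}" using that \<open>m \<in> I\<close> by blast
    then show ?thesis using min[OF True that] True by (auto simp: P Q end_weight_def algebra_simps)
  next
    case False
    then show ?thesis using assms(2) that by (auto simp: P Q end_weight_def)
  qed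
  have 2: "(y - x) * P 0 {} {m} b = y * Q 0 {m} b + (y - x) * Q 0 {} b" if "I = {m}" for m
    using that assms(2) I0[of m] by (auto simp: P Q end_weight_def algebra_simps)
  have 3: "(y - x) * P 0 (I - {m}) {m} b = y * Q 0 I b + (y - x) * Q 0 (I - {m}) b - y * Q 0 (I - {w}) b"
    if "m \<in> I" "w \<in> I" "m < w" "\<forall>r\<in>I. r = m \<or> w \<le> r" for m w
  proof (cases "i \<in> I")
    case True
    have "\<forall>r\<in>I. m \<le> r" using that by (auto intro: less_imp_le less_le_trans)
    then show ?thesis using min[OF True that(1)] True that by (auto simp: P Q end_weight_def algebra_simps)
  next
    case False
    then show ?thesis using assms(2) that by (auto simp: P Q end_weight_def)
  qed
  have 4: "P 0 (I - {w}) {w} b = P 0 I {} b" if "m \<in> I" "w \<in> I" "m < w" for m w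
    using that R(3)[of m] IR by (auto simp: P)
  show ?thesis
    unfolding exchanges_def using 1 2 3 4 assms(2) by (auto simp: P Q end_weight_def)
qed

lemma exchanges_Suc:
  assumes I: "I \<subseteq> site R (Suc c) b" and "0 < b i"
    and IH: "\<And>J. J \<subseteq> site R (Suc c) b \<Longrightarrow> exchanges c J (put c J b)"
  shows "exchanges (Suc c) I b"
proof -
  define S where "S = site R (Suc c) b"
  have fS: "finite S" using R by (simp add: S_def)
  define p0 where "p0 J = P c J {} (put c J b)" for J
  define q0 where "q0 J = Q c J (put c J b)" for J
  define p1 where "p1 J w = P c (J - {w}) {w} (put c J b)" for J w
  define q1 where "q1 J w = Q c (J - {w}) (put c J b)" for J w
  interpret site_exchange x y S p0 q0 p1 q1
  proof
    show "finite S" by fact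
    show "(y - x) * p0 {} = (y - x) * q0 {}"
      using IH[of "{}"] by (simp add: p0_def q0_def exchanges_def)
    show "(y - x) * p0 J = y * q0 J - (if J = {m} then 0 else x * q1 J m)"
      if "J \<subseteq> S" "m \<in> J" "\<And>r. r \<in> J \<Longrightarrow> m \<le> r" for J m
      using IH[of J] that unfolding exchanges_def p0_def q0_def q1_def S_def by blast
    show "(y - x) * p1 {m} m = y * q0 {m} + (y - x) * q1 {m} m" if "m \<in> S" for m
      using IH[of "{m}"] that by (auto simp: p1_def q0_def q1_def exchanges_def S_def)
    show "(y - x) * p1 J m = y * q0 J + (y - x) * q1 J m - y * q1 J m'"
      if "J \<subseteq> S" "m \<in> J" "m' \<in> J" "m < m'" "\<And>r. r \<in> J \<Longrightarrow> r = m \<or> m' \<le> r" for J m m'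
      using IH[of J] that unfolding exchanges_def p1_def q0_def q1_def S_def by blast
    show "p1 J w = p0 J" if "J \<subseteq> S" "m \<in> J" "w \<in> J" "m < w" for J m w
      using IH[of J] that unfolding exchanges_def p1_def p0_def S_def by blast
  qed
  have G: "G K' = P c K' {} (put c K' b) +
    (if S - K' = {} then 0 else x * P c K' {Min (S - K')} (put c (insert (Min (S - K')) K') b))" for K'
  proof (cases "S - K' = {}")
    case False
    then have "Min (S - K') \<in> S - K'" using fS by (intro Min_in) auto
    then have "insert (Min (S - K')) K' - {Min (S - K')} = K'" by auto
    then show ?thesis by (simp add: G_def p0_def p1_def)
  qed (simp add: G_def p0_def)
  have P: "P (Suc c) K U b = snake_first K U" if "K \<subseteq> S" "U \<subseteq> S" "K \<inter> U = {}" for K U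
    using P_Suc[of K c b U, folded S_def, OF that] unfolding snake_first_def G[abs_def] .
  have Q: "Q (Suc c) K b = strip_first (S - K) K" if K: "K \<subseteq> S" for K
  proof (cases "S - K = {}")
    case True
    then show ?thesis
      using Q_Suc[of K c b, folded S_def, OF K] unfolding strip_first_def unfolding q0_def[abs_def] by simp
  next
    case False
    then have m: "Min (S - K) \<in> S - K" using fS by (intro Min_in) auto
    have "step_sum y (S - K - {Min (S - K)}) K (\<lambda>J. q1 (insert (Min (S - K)) J) (Min (S - K))) =
       step_sum y (S - K - {Min (S - K)}) K (\<lambda>K'. Q c K' (put c (insert (Min (S - K)) K') b))"
    proof (rule step_sum_cong)
      fix J assume "J \<in> snake_steps (S - K - {Min (S - K)}) K"
      then have "Min (S - K) \<notin> J" using snake_stepsD m by blast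
      then show "q1 (insert (Min (S - K)) J) (Min (S - K)) = Q c J (put c (insert (Min (S - K)) J) b)"
        by (simp add: q1_def)
    qed
    then show ?thesis
      using Q_Suc[of K c b, folded S_def, OF K] False unfolding strip_first_def unfolding q0_def[abs_def] by simp
  qed
  have I': "I \<subseteq> S" using I by (simp add: S_def)
  have "(y - x) * P (Suc c) {} {} b = (y - x) * Q (Suc c) {} b"
    using exchange_empty by (simp add: P Q)
  moreover have "(y - x) * P (Suc c) I {} b =
      y * Q (Suc c) I b - (if I = {m} then 0 else x * Q (Suc c) (I - {m}) b)"
    if m: "m \<in> I" "\<forall>r\<in>I. m \<le> r" for m
  proof (cases "I = {m}")
    case True
    then show ?thesis using exchange_single[of m] I' by (simp add: P Q)
  next
    case False
    define w where "w = Min (I - {m})"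
    have f: "finite (I - {m})" "I - {m} \<noteq> {}" using False m I' fS by (auto dest: finite_subset)
    have w: "w \<in> I - {m}" "\<And>r. r \<in> I - {m} \<Longrightarrow> w \<le> r"
      using Min_in[OF f] Min_le[OF f(1)] by (auto simp: w_def)
    have "m < w" using w(1) m(2) by (auto simp: order.strict_iff_order)
    then show ?thesis
      using exchange_least[OF I' m(1), of w] w I' False by (auto simp: P Q subset_iff)
  qed
  moreover have "(y - x) * P (Suc c) {} {m} b = y * Q (Suc c) {m} b + (y - x) * Q (Suc c) {} b"
    if "I = {m}" for m
    using exchange_moved_single[of m] that I' by (simp add: P Q)
  moreover have "(y - x) * P (Suc c) (I - {m}) {m} b =
      y * Q (Suc c) I b + (y - x) * Q (Suc c) (I - {m}) b - y * Q (Suc c) (I - {w}) b"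
    if "m \<in> I" "w \<in> I" "m < w" "\<forall>r\<in>I. r = m \<or> w \<le> r" for m w
  proof -
    have "I - {m} \<subseteq> S" "I - {w} \<subseteq> S" "{m} \<subseteq> S" using I' that by auto
    then show ?thesis
      using exchange_moved_least[OF I' that(1,2,3)] that(4) I' by (simp add: P Q)
  qed
  moreover have "P (Suc c) (I - {w}) {w} b = P (Suc c) I {} b"
    if "m \<in> I" "w \<in> I" "m < w" for m w
  proof -
    have "I - {w} \<subseteq> S" "{w} \<subseteq> S" using I' that by auto
    then show ?thesis
      using exchange_other[OF I' that(1,2,3)] I' by (simp add: P)
  qed
  ultimately show ?thesis unfolding exchanges_def by blast
qed

text \<open>A row \<open>i\<close> of length 0 outside \<open>I\<close> would trigger the special
  case of \<open>end_weight\<close> in the wrong place. The disjunction is inherited, because a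
  nonempty row \<open>i\<close> reaches length 0 only by being cut in column 1.\<close>

theorem exchanges:
  assumes "I \<subseteq> site R c b" "i \<in> I \<or> 0 < b i"
  shows "exchanges c I b"
  using assms
proof (induction c arbitrary: b I)
  case 0
  then show ?case by (intro exchanges_0)
next
  case (Suc c)
  have pos: "0 < b i" using Suc.prems by (auto simp: site_def)
  show ?case
  proof (rule exchanges_Suc[OF Suc.prems(1) pos])
    fix J assume "J \<subseteq> site R (Suc c) b"
    then show "exchanges c J (put c J b)"
      using pos by (intro Suc.IH) (auto simp: site_def put_def)
  qed
qed

corollary scan_commute:
  assumes "0 < b i"
  shows "(y - x) * snake_scan y R c {} (\<lambda>K a. (if i \<in> K then y else 0) * strip_scan x R c f a) b =
    (y - x) * strip_scan x R c (\<lambda>d. snake_scan y R c {} end_weight d) b"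
  using exchanges[of "{}" c b] assms by (simp add: exchanges_def P_def Q_def)

end

section \<open>Closed forms of the two scans as sums over compositions\<close>

definition bounded_funs :: "nat set \<Rightarrow> (nat \<Rightarrow> nat) \<Rightarrow> (nat \<Rightarrow> nat) set" where
  "bounded_funs R b = {d. (\<forall>r. d r \<le> b r) \<and> (\<forall>r. r \<notin> R \<longrightarrow> d r = b r)}"

lemma finite_bounded_funs: "finite R \<Longrightarrow> finite (bounded_funs R b)"
proof (rule finite_subset)
  assume "finite R"
  then show "finite ((\<lambda>f r. if r \<in> R then f r else b r) ` (PiE R (\<lambda>r. {..b r})))"
    by (intro finite_imageI finite_PiE) auto
  show "bounded_funs R b \<subseteq> (\<lambda>f r. if r \<in> R then f r else b r) ` (PiE R (\<lambda>r. {..b r}))"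
  proof
    fix d assume "d \<in> bounded_funs R b"
    then have "d = (\<lambda>r. if r \<in> R then restrict d R r else b r)" "restrict d R \<in> PiE R (\<lambda>r. {..b r})"
      by (auto simp: bounded_funs_def)
    then show "d \<in> (\<lambda>f r. if r \<in> R then f r else b r) ` (PiE R (\<lambda>r. {..b r}))"
      by (intro image_eqI)
  qed
qed

definition strips :: "nat set \<Rightarrow> (nat \<Rightarrow> nat) \<Rightarrow> (nat \<Rightarrow> nat) set" where
  "strips R b = {d \<in> bounded_funs R b.
     \<forall>r\<in>R. \<forall>s\<in>R. r < s \<longrightarrow> d s < b s \<longrightarrow> b r \<le> d s \<or> b s < d r}"

definition strips_upto :: "nat \<Rightarrow> nat set \<Rightarrow> (nat \<Rightarrow> nat) \<Rightarrow> (nat \<Rightarrow> nat) set" where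
  "strips_upto c R b = {d \<in> strips R b. \<forall>r. c < b r \<longrightarrow> d r = b r}"

lemma finite_strips: "finite R \<Longrightarrow> finite (strips R b)"
  by (rule finite_subset[OF _ finite_bounded_funs[of R b]]) (auto simp: strips_def)

lemma finite_strips_upto: "finite R \<Longrightarrow> finite (strips_upto c R b)"
  by (rule finite_subset[OF _ finite_strips[of R b]]) (auto simp: strips_upto_def)

lemma strips_upto_Suc_empty:
  assumes "site R (Suc c) b = {}"
  shows "strips_upto (Suc c) R b = strips_upto c R b"
proof -
  have "d r = b r" if "d \<in> bounded_funs R b" "b r = Suc c" for d r
    using assms that by (auto simp: bounded_funs_def site_def)
  then show ?thesis
    by (auto simp: strips_upto_def strips_def) (metis Suc_lessI)
qed

text \<open>Only the lowest row \<open>m\<close> of length \<open>c + 1\<close> can be shortened: a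
  higher one, \<open>r\<close>, would need \<open>b m \<le> d r\<close> or \<open>b r < d m\<close>,
  and both fail because \<open>b m = b r\<close>. The two parts are separated by whether row
  \<open>m\<close> keeps its last cell; once it is lost, the conditions are those of a strip of
  \<open>b(m := c)\<close>.\<close>

lemma strips_upto_Suc:
  assumes m: "m \<in> R" "b m = Suc c" "\<And>r. r \<in> R \<Longrightarrow> b r = Suc c \<Longrightarrow> m \<le> r"
  shows "strips_upto (Suc c) R b = strips_upto c R b \<union> strips_upto c R (b(m := c))"
    and "strips_upto c R b \<inter> strips_upto c R (b(m := c)) = {}"
proof -
  show "strips_upto c R b \<inter> strips_upto c R (b(m := c)) = {}"
  proof -
    have "d m = Suc c" if "d \<in> strips_upto c R b" for d
      using that m by (auto simp: strips_upto_def)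
    moreover have "d m \<le> c" if "d \<in> strips_upto c R (b(m := c))" for d
      using that by (auto simp: strips_upto_def strips_def bounded_funs_def dest: spec[of _ m])
    ultimately show ?thesis by fastforce
  qed
  show "strips_upto (Suc c) R b = strips_upto c R b \<union> strips_upto c R (b(m := c))"
  proof (intro equalityI subsetI)
    fix d assume d: "d \<in> strips_upto (Suc c) R b"
    have le: "d r \<le> b r" and out: "r \<notin> R \<Longrightarrow> d r = b r" and far: "Suc c < b r \<Longrightarrow> d r = b r"
      and st: "\<lbrakk>r \<in> R; s \<in> R; r < s; d s < b s\<rbrakk> \<Longrightarrow> b r \<le> d s \<or> b s < d r" for r s
      using d by (auto simp: strips_upto_def strips_def bounded_funs_def)
    have mover: "r = m" if "b r = Suc c" "d r < b r" for r
    proof (rule ccontr)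
      assume "r \<noteq> m"
      have "r \<in> R" using that out by fastforce
      then have "m < r" using m(3)[of r] that \<open>r \<noteq> m\<close> by auto
      then show False using st[OF m(1) \<open>r \<in> R\<close>] that m(2) le[of m] by auto
    qed
    show "d \<in> strips_upto c R b \<union> strips_upto c R (b(m := c))"
    proof (cases "d m = b m")
      case True
      have "d r = b r" if "c < b r" for r
        using that far[of r] mover[of r] le[of r] True by (cases "b r = Suc c") force+
      then show ?thesis using d by (auto simp: strips_upto_def)
    next
      case False
      then have dm: "d m < b m" using le[of m] by simp
      let ?b = "b(m := c)"
      have "d r \<le> ?b r" for r using le[of r] dm m(2) by auto
      moreover have "d r = ?b r" if "r \<notin> R" for r using that out m(1) by auto
      moreover have "?b r \<le> d s \<or> ?b s < d r" if "r \<in> R" "s \<in> R" "r < s" "d s < ?b s" for r s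
        using st[OF that(1-3)] that(3,4) m(2) dm by (auto split: if_splits)
      moreover have "d r = ?b r" if "c < ?b r" for r
        using that far[of r] mover[of r] le[of r]
        by (cases "d r < b r"; cases "b r = Suc c") (auto split: if_splits)
      ultimately show ?thesis by (auto simp: strips_upto_def strips_def bounded_funs_def simp del: fun_upd_apply)
    qed
  next
    fix d assume "d \<in> strips_upto c R b \<union> strips_upto c R (b(m := c))"
    then show "d \<in> strips_upto (Suc c) R b"
    proof
      assume "d \<in> strips_upto c R b"
      then show ?thesis by (auto simp: strips_upto_def)
    next
      let ?b = "b(m := c)"
      assume d: "d \<in> strips_upto c R ?b"
      have le: "d r \<le> ?b r" and out: "r \<notin> R \<Longrightarrow> d r = ?b r" and far: "c < ?b r \<Longrightarrow> d r = ?b r"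
        and st: "\<lbrakk>r \<in> R; s \<in> R; r < s; d s < ?b s\<rbrakk> \<Longrightarrow> ?b r \<le> d s \<or> ?b s < d r" for r s
        using d by (auto simp: strips_upto_def strips_def bounded_funs_def simp del: fun_upd_apply)
      have dm: "d m \<le> c" using le[of m] by simp
      have "d r \<le> b r" for r using le[of r] m(2) by (auto split: if_splits)
      moreover have "d r = b r" if "r \<notin> R" for r using that out[of r] m(1) by auto
      moreover have "d r = b r" if "Suc c < b r" for r using that far[of r] m(2) by (cases "r = m") auto
      moreover have "b r \<le> d s \<or> b s < d r" if rs: "r \<in> R" "s \<in> R" "r < s" "d s < b s" for r s
      proof (cases "s = m")
        case True
        have "b r \<noteq> Suc c" using m(3)[OF rs(1)] rs(3) True by auto
        moreover have "d r = b r" if "c < b r" using far[of r] that rs(3) True by auto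
        moreover have "d m = c \<or> b r \<le> d m \<or> c < d r"
          using st[OF rs(1-3)] rs(3) True dm by auto
        ultimately show ?thesis using True m(2) dm le[of r] rs(3)
          by (cases "b r \<le> c") (auto split: if_splits)
      next
        case False
        have s: "b s \<le> c" using far[of s] False rs(4) by (cases "c < b s") auto
        show ?thesis
        proof (cases "r = m")
          case True
          then show ?thesis using st[OF rs(1-3)] rs(3,4) False s by auto
        next
          case rm: False
          then show ?thesis using st[OF rs(1-3)] rs(4) False by auto
        qed
      qed
      ultimately show ?thesis by (auto simp: strips_upto_def strips_def bounded_funs_def)
    qed
  qed
qed

lemma strip_scan_eq_sum:
  assumes "finite R"
  shows "strip_scan x R c g b = (\<Sum>d\<in>strips_upto c R b. x ^ (sum b R - sum d R) * g d)"
proof (induction c arbitrary: b)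
  case 0
  have "strips_upto 0 R b = {b}"
  proof -
    have "d = b" if "d \<in> strips_upto 0 R b" for d
      using that by (auto simp: strips_upto_def strips_def bounded_funs_def fun_eq_iff)
        (metis gr_zeroI le_zero_eq)
    moreover have "b \<in> strips_upto 0 R b" by (auto simp: strips_upto_def strips_def bounded_funs_def)
    ultimately show ?thesis by auto
  qed
  then show ?case by simp
next
  case (Suc c)
  show ?case
  proof (cases "site R (Suc c) b = {}")
    case True
    then show ?thesis by (simp add: Suc strips_upto_Suc_empty)
  next
    case False
    define m where "m = Min (site R (Suc c) b)"
    have m: "m \<in> R" "b m = Suc c" "\<And>r. r \<in> R \<Longrightarrow> b r = Suc c \<Longrightarrow> m \<le> r"
      using Min_site[OF assms False] Min_le[OF finite_site[OF assms], of _ "Suc c" b]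
      unfolding m_def by (simp_all add: site_def)
    have s: "sum b R = Suc (sum (b(m := c)) R)"
      using assms m by (simp add: sum.remove[of R m] cong: sum.cong_simp)
    have "x * (x ^ (sum (b(m := c)) R - sum d R) * g d) = x ^ (sum b R - sum d R) * g d"
      if "d \<in> strips_upto c R (b(m := c))" for d
    proof -
      have "sum d R \<le> sum (b(m := c)) R"
        using that by (intro sum_mono) (auto simp: strips_upto_def strips_def bounded_funs_def)
      then show ?thesis unfolding s by (simp add: Suc_diff_le mult_ac)
    qed
    then have "x * strip_scan x R c g (b(m := c)) =
        (\<Sum>d\<in>strips_upto c R (b(m := c)). x ^ (sum b R - sum d R) * g d)"
      unfolding Suc sum_distrib_left by (intro sum.cong) auto
    moreover have "strips_upto (Suc c) R b = strips_upto c R b \<union> strips_upto c R (b(m := c))"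
      by (rule strips_upto_Suc(1)) (use m in auto)
    moreover have "strips_upto c R b \<inter> strips_upto c R (b(m := c)) = {}"
      by (rule strips_upto_Suc(2)) (use m in auto)
    ultimately show ?thesis
      using False assms by (simp add: m_def[symmetric] Suc sum.union_disjoint finite_strips_upto)
  qed
qed

definition cols :: "(nat \<Rightarrow> nat) \<Rightarrow> (nat \<Rightarrow> nat) \<Rightarrow> nat \<Rightarrow> nat set" where
  "cols a b e = {r. a r < e \<and> e \<le> b r}"

text \<open>In column \<open>c + 1\<close> the composition \<open>b\<close> has already been
  shortened, so \<open>cols a b\<close> does not see the rows \<open>K\<close> cut there. The update
  at \<open>Suc c\<close> puts them back for the transition at \<open>e = c\<close>.\<close>

definition scans :: "nat set \<Rightarrow> nat \<Rightarrow> nat set \<Rightarrow> (nat \<Rightarrow> nat) \<Rightarrow> (nat \<Rightarrow> nat) set" where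
  "scans R c K b = {a \<in> bounded_funs R b. (\<forall>r. c < b r \<longrightarrow> a r = b r) \<and>
     (\<forall>e\<in>{1..c}. cols a b e \<in>
        snake_steps (site R e b - ((cols a b)(Suc c := K)) (Suc e)) (((cols a b)(Suc c := K)) (Suc e)))}"

lemma finite_scans: "finite R \<Longrightarrow> finite (scans R c K b)"
  by (rule finite_subset[OF _ finite_bounded_funs[of R b]]) (auto simp: scans_def)

lemma scans_step:
  assumes K: "K \<subseteq> site R (Suc c) b" and K': "K' \<in> snake_steps (site R (Suc c) b - K) K"
  shows "{a \<in> scans R (Suc c) K b. cols a b (Suc c) = K'} = scans R c K' (put c K' b)" (is "?l = ?r")
proof -
  have sub: "K' \<subseteq> R" "\<And>r. r \<in> K' \<Longrightarrow> b r = Suc c"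
    using snake_stepsD[OF K'] K by (auto simp: site_def)
  let ?b = "put c K' b"
  have cols: "cols a ?b e = cols a b e" if "e \<le> c" for a e
    using that sub by (auto simp: cols_def put_def)
  have steps: "(cols a ?b e \<in> snake_steps (site R e ?b - ((cols a ?b)(Suc c := K')) (Suc e)) (((cols a ?b)(Suc c := K')) (Suc e)))
     \<longleftrightarrow> (cols a b e \<in> snake_steps (site R e b - ((cols a b)(Suc (Suc c) := K)) (Suc e)) (((cols a b)(Suc (Suc c) := K)) (Suc e)))"
    if "cols a b (Suc c) = K'" "e \<in> {1..c}" for a e
  proof -
    have "((cols a ?b)(Suc c := K')) (Suc e) = ((cols a b)(Suc (Suc c) := K)) (Suc e)"
      using that cols[of "Suc e" a] by auto
    moreover have "site R e ?b - ((cols a ?b)(Suc c := K')) (Suc e) = site R e b - ((cols a b)(Suc (Suc c) := K)) (Suc e)"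
      using that cols[of "Suc e" a] sub by (cases "e = c") (auto simp: site_def put_def)
    ultimately show ?thesis using cols[of e a] that by simp
  qed
  show ?thesis
  proof (intro equalityI subsetI)
    fix a assume "a \<in> ?l"
    then have a: "a \<in> scans R (Suc c) K b" "cols a b (Suc c) = K'" by auto
    have le: "a r \<le> b r" and out: "r \<notin> R \<Longrightarrow> a r = b r" and far: "Suc c < b r \<Longrightarrow> a r = b r" for r
      using a(1) by (auto simp: scans_def bounded_funs_def)
    have k: "r \<in> K' \<longleftrightarrow> a r < Suc c \<and> Suc c \<le> b r" for r using a(2) by (auto simp: cols_def)
    have "a r \<le> ?b r" for r using le[of r] k[of r] by (auto simp: put_def)
    moreover have "a r = ?b r" if "r \<notin> R" for r using out[OF that] sub that by (auto simp: put_def)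
    moreover have "a r = ?b r" if "c < ?b r" for r
      using that far[of r] k[of r] le[of r] by (cases "r \<in> K'"; cases "b r = Suc c") (auto simp: put_def)
    moreover have "\<forall>e\<in>{1..c}. cols a ?b e \<in> snake_steps (site R e ?b - ((cols a ?b)(Suc c := K')) (Suc e)) (((cols a ?b)(Suc c := K')) (Suc e))"
      using steps[OF a(2)] a(1) by (auto simp: scans_def simp del: fun_upd_apply)
    ultimately show "a \<in> ?r" unfolding scans_def bounded_funs_def by blast
  next
    fix a assume a: "a \<in> ?r"
    have le: "a r \<le> ?b r" and out: "r \<notin> R \<Longrightarrow> a r = ?b r" and far: "c < ?b r \<Longrightarrow> a r = ?b r" for r
      using a by (auto simp: scans_def bounded_funs_def)
    have eq: "cols a b (Suc c) = K'"
    proof (intro equalityI subsetI)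
      fix r assume "r \<in> K'"
      then show "r \<in> cols a b (Suc c)" using le[of r] sub(2)[of r] by (auto simp: cols_def put_def)
    next
      fix r assume "r \<in> cols a b (Suc c)"
      then show "r \<in> K'" using far[of r] by (cases "r \<in> K'") (auto simp: cols_def put_def)
    qed
    have "a r \<le> b r" for r using le[of r] sub(2)[of r] by (auto simp: put_def split: if_splits)
    moreover have "a r = b r" if "r \<notin> R" for r using out[OF that] sub that by (auto simp: put_def)
    moreover have "a r = b r" if "Suc c < b r" for r
      using that far[of r] sub(2)[of r] by (cases "r \<in> K'") (auto simp: put_def)
    moreover have "cols a b e \<in> snake_steps (site R e b - ((cols a b)(Suc (Suc c) := K)) (Suc e)) (((cols a b)(Suc (Suc c) := K)) (Suc e))"
      if "e \<in> {1..Suc c}" for e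
    proof (cases "e = Suc c")
      case True
      then show ?thesis using K' eq by simp
    next
      case False
      then have "e \<in> {1..c}" using that by auto
      then show ?thesis using steps[OF eq, of e] a by (auto simp: scans_def simp del: fun_upd_apply)
    qed
    ultimately have "a \<in> scans R (Suc c) K b" unfolding scans_def bounded_funs_def by blast
    then show "a \<in> ?l" using eq by simp
  qed
qed

text \<open>A row pays its sign in the column where it ends. The rows of \<open>K\<close> have paid
  further right, so they are left out of the exponent. For \<open>c = 0\<close> nothing is scanned,
  and the last set of cut rows is \<open>K\<close> itself.\<close>

lemma snake_scan_eq_sum:
  assumes "finite R" "K \<subseteq> site R c b"
  shows "snake_scan y R c K g b = (\<Sum>a\<in>scans R c K b.
    (- 1) ^ card ({r\<in>R. a r < b r} - K) * y ^ (sum b R - sum a R) * g (if c = 0 then K else cols a b 1) a)"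
  using assms(2)
proof (induction c arbitrary: K b)
  case 0
  have "scans R 0 K b = {b}"
  proof -
    have "a = b" if "a \<in> scans R 0 K b" for a
      using that by (auto simp: scans_def bounded_funs_def fun_eq_iff) (metis gr_zeroI le_zero_eq)
    moreover have "b \<in> scans R 0 K b" by (auto simp: scans_def bounded_funs_def)
    ultimately show ?thesis by auto
  qed
  then show ?case by simp
next
  case (Suc c)
  let ?A = "site R (Suc c) b - K"
  let ?h = "\<lambda>a. (- 1) ^ card ({r\<in>R. a r < b r} - K) * y ^ (sum b R - sum a R) * g (cols a b 1) a"
  have fK: "finite K" using Suc.prems assms(1) by (auto intro: finite_subset)
  have inner: "(- 1) ^ card (K' \<inter> ?A) * y ^ card K' * snake_scan y R c K' g (put c K' b) =
     sum ?h {a \<in> scans R (Suc c) K b. cols a b (Suc c) = K'}"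
    if K': "K' \<in> snake_steps ?A K" for K'
  proof -
    have sub: "K' \<subseteq> R" "\<And>r. r \<in> K' \<Longrightarrow> b r = Suc c"
      using snake_stepsD[OF K'] Suc.prems by (auto simp: site_def)
    let ?b = "put c K' b"
    have ih: "snake_scan y R c K' g ?b = (\<Sum>a\<in>scans R c K' ?b.
       (- 1) ^ card ({r\<in>R. a r < ?b r} - K') * y ^ (sum ?b R - sum a R) * g (if c = 0 then K' else cols a ?b 1) a)"
      using sub by (intro Suc.IH) (auto simp: site_def put_def)
    show ?thesis
      unfolding ih scans_step[OF Suc.prems K'] sum_distrib_left
    proof (rule sum.cong[OF refl])
      fix a assume a: "a \<in> scans R c K' ?b"
      then have a': "cols a b (Suc c) = K'" using scans_step[OF Suc.prems K'] by blast
      have le: "a r \<le> ?b r" and far: "c < ?b r \<Longrightarrow> a r = ?b r" for r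
        using a by (auto simp: scans_def bounded_funs_def)
      have 1: "(if c = 0 then K' else cols a ?b 1) = cols a b 1"
      proof (cases "c = 0")
        case True
        then show ?thesis using a' by simp
      next
        case False
        have "1 \<le> ?b r \<longleftrightarrow> 1 \<le> b r" for r
          using False sub(2)[of r] by (cases "r \<in> K'") (auto simp: put_def)
        then show ?thesis using False by (simp add: cols_def)
      qed
      have split: "{r\<in>R. a r < b r} - K = (K' \<inter> ?A) \<union> ({r\<in>R. a r < ?b r} - K')"
      proof (intro equalityI subsetI)
        fix r assume r: "r \<in> {r\<in>R. a r < b r} - K"
        then show "r \<in> (K' \<inter> ?A) \<union> ({r\<in>R. a r < ?b r} - K')"
          using snake_stepsD[OF K'] by (cases "r \<in> K'") (auto simp: put_def)
      next
        fix r assume "r \<in> (K' \<inter> ?A) \<union> ({r\<in>R. a r < ?b r} - K')"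
        then show "r \<in> {r\<in>R. a r < b r} - K"
        proof
          assume r: "r \<in> K' \<inter> ?A"
          then have "a r < b r" using le[of r] sub(2)[of r] by (auto simp: put_def)
          then show ?thesis using r sub by auto
        next
          assume r: "r \<in> {r\<in>R. a r < ?b r} - K'"
          then have "r \<notin> K" using far[of r] Suc.prems by (auto simp: put_def site_def)
          then show ?thesis using r by (auto simp: put_def)
        qed
      qed
      have card: "card ({r\<in>R. a r < b r} - K) = card (K' \<inter> ?A) + card ({r\<in>R. a r < ?b r} - K')"
        unfolding split using assms(1) by (intro card_Un_disjoint) auto
      have "sum b R = sum b K' + sum b (R - K')"
        using sum.subset_diff[OF sub(1) assms(1), of b] by simp
      also have "sum b K' = sum ?b K' + card K'"
        using sub(2) by (simp add: put_def cong: sum.cong)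
      also have "sum b (R - K') = sum ?b (R - K')"
        by (intro sum.cong) (auto simp: put_def)
      also have "sum ?b K' + card K' + sum ?b (R - K') = sum ?b R + card K'"
        using sum.subset_diff[OF sub(1) assms(1), of ?b] by simp
      finally have "sum b R = sum ?b R + card K'" .
      moreover have "sum a R \<le> sum ?b R" using le by (intro sum_mono)
      ultimately have "sum b R - sum a R = card K' + (sum ?b R - sum a R)" by simp
      then show "(- 1) ^ card (K' \<inter> ?A) * y ^ card K' * ((- 1) ^ card ({r\<in>R. a r < ?b r} - K') *
         y ^ (sum ?b R - sum a R) * g (if c = 0 then K' else cols a ?b 1) a) = ?h a"
        unfolding 1 card by (simp add: power_add mult_ac)
    qed
  qed
  have "snake_scan y R (Suc c) K g b = (\<Sum>K'\<in>snake_steps ?A K. sum ?h {a \<in> scans R (Suc c) K b. cols a b (Suc c) = K'})"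
    unfolding snake_scan.simps step_sum_def using inner by (intro sum.cong) auto
  also have "\<dots> = sum ?h (scans R (Suc c) K b)"
  proof (rule sum.group)
    show "(\<lambda>a. cols a b (Suc c)) ` scans R (Suc c) K b \<subseteq> snake_steps ?A K"
      by (auto simp: scans_def dest!: bspec[of _ _ "Suc c"])
  qed (use assms(1) fK in \<open>auto simp: finite_scans\<close>)
  finally show ?case by simp
qed

section \<open>The operators \<open>H(x)\<close> and \<open>N(m)\<close> and their commutation
  relation\<close>

definition strip_op :: "'a::comm_ring_1 \<Rightarrow> nat set \<Rightarrow> ((nat \<Rightarrow> nat) \<Rightarrow> 'a) \<Rightarrow> (nat \<Rightarrow> nat) \<Rightarrow> 'a" where
  "strip_op x R g b = (\<Sum>d\<in>strips R b. x ^ (sum b R - sum d R) * g d)"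

definition all_scans :: "nat set \<Rightarrow> (nat \<Rightarrow> nat) \<Rightarrow> (nat \<Rightarrow> nat) set" where
  "all_scans R b = {a \<in> bounded_funs R b.
     \<forall>e\<ge>1. cols a b e \<in> snake_steps (site R e b) (cols a b (Suc e))}"

text \<open>The case distinction mirrors the tabloid condition that a snake is empty exactly when
  its row is empty. If \<open>b i\<close> is positive, \<open>a i = 0\<close> says that the snake
  contains the first cell of row \<open>i\<close>.\<close>

definition snake_cuts :: "nat set \<Rightarrow> nat \<Rightarrow> (nat \<Rightarrow> nat) \<Rightarrow> (nat \<Rightarrow> nat) set" where
  "snake_cuts R i b = (if b i = 0 then {b} else {a \<in> all_scans R b. a i = 0})"

text \<open>Subtraction is truncated: for \<open>a = b\<close> the exponent is 0, in accordance with
  height 1 of the empty snake.\<close>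

definition cut_sign :: "nat set \<Rightarrow> (nat \<Rightarrow> nat) \<Rightarrow> (nat \<Rightarrow> nat) \<Rightarrow> 'a::comm_ring_1" where
  "cut_sign R a b = (- 1) ^ (card {r\<in>R. a r < b r} - 1)"

definition snake_op :: "nat set \<Rightarrow> nat \<Rightarrow> nat \<Rightarrow> ((nat \<Rightarrow> nat) \<Rightarrow> 'a::comm_ring_1) \<Rightarrow> (nat \<Rightarrow> nat) \<Rightarrow> 'a" where
  "snake_op R i m g b = (\<Sum>a | a \<in> snake_cuts R i b \<and> sum b R = sum a R + m. cut_sign R a b * g a)"

lemma finite_all_scans: "finite R \<Longrightarrow> finite (all_scans R b)"
  by (rule finite_subset[OF _ finite_bounded_funs[of R b]]) (auto simp: all_scans_def)

lemma finite_snake_cuts: "finite R \<Longrightarrow> finite (snake_cuts R i b)"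
  by (simp add: snake_cuts_def finite_all_scans)

lemma scans_eq_all_scans:
  assumes "\<And>r. b r \<le> M"
  shows "scans R M {} b = all_scans R b"
proof -
  have top: "cols a b (Suc M) = {}" for a
    using assms by (auto simp: cols_def not_less_eq_eq[symmetric] dest: order_trans)
  have "((cols a b)(Suc M := {})) = cols a b" for a
    by (rule fun_upd_idem) (rule top)
  moreover have "site R e b - cols a b (Suc e) = site R e b" for a e
    by (auto simp: site_def cols_def)
  moreover have "cols a b e \<in> snake_steps (site R e b) (cols a b (Suc e))" if "M < e" for a e
  proof -
    have "b r < e" for r using assms[of r] that by simp
    then have "\<not> e \<le> b r" "\<not> Suc e \<le> b r" "b r \<noteq> e" for r
      by (auto simp: not_le dest: less_SucI)
    then have "cols a b e = {}" "cols a b (Suc e) = {}" "site R e b = {}"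
      by (simp_all add: cols_def site_def)
    then show ?thesis by (simp add: snake_steps_def)
  qed
  ultimately show ?thesis
    using assms by (auto simp: scans_def all_scans_def simp del: fun_upd_apply)
      (metis linorder_not_le)+
qed

lemma strips_upto_eq_strips:
  assumes "\<And>r. b r \<le> M"
  shows "strips_upto M R b = strips R b"
  using assms by (auto simp: strips_upto_def linorder_not_less[symmetric])

lemma bounded_funs_le: "d \<in> bounded_funs R b \<Longrightarrow> (\<And>r. b r \<le> M) \<Longrightarrow> d r \<le> M"
  unfolding bounded_funs_def using order_trans by blast

text \<open>Cuts propagate to the left: by connectedness, a column with cut rows forces cut rows in
  the next column to its left. A scan that cuts nothing in column 1 therefore cuts nothing.\<close>

lemma all_scans_first_empty:
  assumes a: "a \<in> all_scans R b" and "cols a b 1 = {}"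
  shows "a = b"
proof -
  have "cols a b (Suc e) = {}" for e
  proof (induction e)
    case (Suc e)
    have "cols a b (Suc e) \<in> snake_steps (site R (Suc e) b) (cols a b (Suc (Suc e)))"
      using a by (auto simp: all_scans_def)
    then show ?case using Suc by (auto simp: snake_steps_def)
  qed (use assms in simp)
  then have "\<not> a r < b r" for r
    using not_less_eq by (fastforce simp: cols_def dest: spec[of _ "a r"])
  moreover have "a r \<le> b r" for r using a by (auto simp: all_scans_def bounded_funs_def)
  ultimately show ?thesis by (auto intro!: ext order.antisym simp: not_less)
qed

lemma coeff_y_power:
  "poly.coeff ([:0, 1:] ^ s * [:k:]) m = (if s = m then k else (0::'a::comm_ring_1))"
  by (simp add: monom_altdef[symmetric])

lemma const_pCons_power: "[:k:] ^ s = [:(k::'a::comm_ring_1) ^ s:]"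
  by (induction s) auto

lemma sum_const_poly: "(\<Sum>d\<in>D. [:h d:]) = [:\<Sum>d\<in>D. h d:]"
  by (induction D rule: infinite_finite_induct) auto

lemma strip_scan_const:
  fixes x :: "'a::comm_ring_1"
  assumes "finite R" "\<And>r. b r \<le> M"
  shows "strip_scan [:x:] R M g b = (\<Sum>d\<in>strips R b. [:x ^ (sum b R - sum d R):] * g d)"
  using assms by (simp add: strip_scan_eq_sum strips_upto_eq_strips const_pCons_power)

lemma snake_op_zero:
  assumes "d i = 0"
  shows "snake_op R i k h d = (if k = 0 then h d else 0)"
proof -
  have "{a. a \<in> snake_cuts R i d \<and> sum d R = sum a R + k} = (if k = 0 then {d} else {})"
    using assms by (auto simp: snake_cuts_def)
  then show ?thesis by (simp add: snake_op_def cut_sign_def)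
qed

text \<open>With \<open>y\<close> an indeterminate, \<open>scan_commute\<close> becomes an identity
  of polynomials, and its coefficients of \<open>y ^ (m + 1)\<close> give the claim up to a common
  sign. The exponent is \<open>m + 1\<close> because \<open>P\<close> carries one factor
  \<open>y\<close> beyond the cells of the snake.\<close>

theorem snake_op_strip_op:
  fixes x :: "'a::idom"
  assumes R: "finite R" "i \<in> R" "\<And>r. r \<in> R \<Longrightarrow> i \<le> r" and M: "\<And>r. b r \<le> M"
  shows "snake_op R i m (strip_op x R g) b = strip_op x R (snake_op R i m g) b - x * strip_op x R (snake_op R i (Suc m) g) b"
proof (cases "b i = 0")
  case True
  have "d i = 0" if "d \<in> strips R b" for d
    using that True by (auto simp: strips_def bounded_funs_def dest: spec[of _ i])
  then show ?thesis
    using True by (simp add: snake_op_zero strip_op_def cong: sum.cong)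
next
  case False
  let ?y = "[:0, 1:] :: 'a poly" and ?x = "[:x:]" and ?f = "\<lambda>d. [:g d:]"
  interpret scan ?x ?y R i ?f by unfold_locales (use R in auto)
  have Mpos: "M \<noteq> 0" using False M[of i] by auto
  have strip_scan_f: "strip_scan ?x R M ?f a = [:strip_op x R g a:]" if "a \<in> all_scans R b" for a
  proof -
    have "a r \<le> M" for r
      using that M by (intro bounded_funs_le[of a R b]) (auto simp: all_scans_def)
    then show ?thesis using R(1) by (simp add: strip_scan_const sum_const_poly strip_op_def mult.commute)
  qed
  have snake_scan_sum: "snake_scan ?y R M {} G d = (\<Sum>a\<in>all_scans R d. (- 1) ^ card {r\<in>R. a r < d r} *
      ?y ^ (sum d R - sum a R) * G (cols a d 1) a)" if "\<And>r. d r \<le> M" for G d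
    using snake_scan_eq_sum[of R "{}" M d ?y G] R(1) Mpos scans_eq_all_scans[OF that] by simp
  have mem: "i \<in> cols a d 1 \<longleftrightarrow> a i = 0" if "d i \<noteq> 0" for a d :: "nat \<Rightarrow> nat"
    using that by (auto simp: cols_def)
  \<comment> \<open>The scans count every cut row in the sign, \<open>cut_sign\<close> counts one
    less; this causes the minus signs in the coefficients below.\<close>
  have sign: "(- 1) ^ card {r\<in>R. a r < d r} = - (cut_sign R a d :: 'a)" if "a i = 0" "d i \<noteq> 0" for a d
  proof -
    have "i \<in> {r\<in>R. a r < d r}" using R(2) that by simp
    then have "card {r\<in>R. a r < d r} \<noteq> 0" using R(1) by (subst card_0_eq) auto
    then obtain k where "card {r\<in>R. a r < d r} = Suc k" using not0_implies_Suc by blast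
    then show ?thesis by (simp add: cut_sign_def)
  qed
  have snake_op_sum: "snake_op R i k h d = (\<Sum>a\<in>all_scans R d. if a i = 0 \<and> sum d R - sum a R = k then cut_sign R a d * h a else 0)"
    if "d i \<noteq> 0" for k d and h :: "_ \<Rightarrow> 'a"
  proof -
    have "sum a R \<le> sum d R" if "a \<in> all_scans R d" for a
      using that by (intro sum_mono) (auto simp: all_scans_def bounded_funs_def)
    then have "{a. a \<in> snake_cuts R i d \<and> sum d R = sum a R + k} =
        {a \<in> all_scans R d. a i = 0 \<and> sum d R - sum a R = k}"
      using that by (auto simp: snake_cuts_def)
    then show ?thesis
      unfolding snake_op_def using finite_all_scans[OF R(1)] by (simp add: sum.inter_filter)
  qed
  have neg1: "(- 1 :: 'a poly) ^ k = [:(- 1) ^ k:]" for k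
    using const_pCons_power[of "- 1 :: 'a" k] by (simp add: one_pCons)
  have coeff_y: "poly.coeff ((- 1) ^ c * ?y ^ s * (?y * [:h:])) (Suc m) = (if s = m then (- 1) ^ c * h else 0)"
    for c s and h :: 'a
  proof -
    have "(- 1) ^ c * ?y ^ s * (?y * [:h:]) = ?y ^ Suc s * [:(- 1) ^ c * h:]"
      unfolding neg1 by (simp add: mult_ac)
    then show ?thesis using coeff_y_power[of "Suc s" "(- 1) ^ c * h" "Suc m"] by simp
  qed
  have coeff_c: "poly.coeff ((- 1) ^ c * ?y ^ s * [:h:]) m' = (if s = m' then (- 1) ^ c * h else 0)"
    for c s m' and h :: 'a
  proof -
    have "(- 1) ^ c * ?y ^ s * [:h:] = ?y ^ s * [:(- 1) ^ c * h:]"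
      unfolding neg1 by (simp add: mult_ac)
    then show ?thesis using coeff_y_power[of s "(- 1) ^ c * h" m'] by simp
  qed
  have lhs: "poly.coeff (snake_scan ?y R M {} (\<lambda>K a. (if i \<in> K then ?y else 0) * strip_scan ?x R M ?f a) b) (Suc m) =
    - snake_op R i m (strip_op x R g) b"
  proof -
    have "poly.coeff ((- 1) ^ card {r\<in>R. a r < b r} * ?y ^ (sum b R - sum a R) *
        ((if i \<in> cols a b 1 then ?y else 0) * strip_scan ?x R M ?f a)) (Suc m) =
      - (if a i = 0 \<and> sum b R - sum a R = m then cut_sign R a b * strip_op x R g a else 0)"
      if "a \<in> all_scans R b" for a
      unfolding strip_scan_f[OF that] mem[where d = b, OF False]
      using coeff_y[of _ _ "strip_op x R g a"] sign[of a b] False by (cases "a i = 0") auto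
    then show ?thesis
      unfolding snake_scan_sum[where d = b, OF M] snake_op_sum[where d = b, OF False] by (simp add: coeff_sum sum_negf)
  qed
  have inner: "poly.coeff (snake_scan ?y R M {} end_weight d) (Suc m) = - snake_op R i m g d + x * snake_op R i (Suc m) g d"
    if d: "d \<in> strips R b" for d
  proof -
    have dM: "d r \<le> M" for r using d M by (intro bounded_funs_le[of d R b]) (auto simp: strips_def)
    show ?thesis
    proof (cases "d i = 0")
      case True
      have fin: "finite (all_scans R d)" using R(1) by (rule finite_all_scans)
      have dd: "d \<in> all_scans R d"
        by (auto simp: all_scans_def bounded_funs_def cols_def snake_steps_def)
      \<comment> \<open>A nontrivial scan cuts some row in column 1 but not row \<open>i\<close>,
        which has length 0. So its end weight vanishes, and only the trivial scan
        \<open>a = d\<close> remains.\<close>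
      have zero: "end_weight (cols a d 1) a = 0" if "a \<in> all_scans R d" "a \<noteq> d" for a
      proof -
        have "i \<notin> cols a d 1" using True by (simp add: cols_def)
        moreover have "cols a d 1 \<noteq> {}" using all_scans_first_empty that by blast
        ultimately show ?thesis by (simp add: end_weight_def)
      qed
      have "cols d d 1 = {}" by (auto simp: cols_def)
      then have "snake_scan ?y R M {} end_weight d = - (?y * [:g d:])"
        unfolding snake_scan_sum[where d = d, OF dM] using True zero fin dd
        by (subst sum.remove[of _ d]) (auto simp: end_weight_def intro!: sum.neutral)
      then show ?thesis by (simp add: snake_op_zero True) (cases m; simp)
    next
      case False
      have "poly.coeff ((- 1) ^ card {r\<in>R. a r < d r} * ?y ^ (sum d R - sum a R) *
          end_weight (cols a d 1) a) (Suc m) =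
        - (if a i = 0 \<and> sum d R - sum a R = m then cut_sign R a d * g a else 0) +
        x * (if a i = 0 \<and> sum d R - sum a R = Suc m then cut_sign R a d * g a else 0)" for a
      proof (cases "a i = 0")
        case True
        have "end_weight (cols a d 1) a = ?y * [:g a:] - [:x * g a:]"
          using mem[where d = d and a = a, OF False] True by (simp add: end_weight_def algebra_simps)
        then show ?thesis
          using True coeff_y[of "card {r\<in>R. a r < d r}" "sum d R - sum a R" "g a"]
            coeff_c[of "card {r\<in>R. a r < d r}" "sum d R - sum a R" "x * g a" "Suc m"] sign[where a = a and d = d, OF True False]
          by (simp add: right_diff_distrib)
      next
        case a: False
        then have "end_weight (cols a d 1) a = 0"
          using mem[where d = d and a = a, OF False] by (simp add: end_weight_def)
        then show ?thesis using a by simp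
      qed
      then show ?thesis
        unfolding snake_scan_sum[where d = d, OF dM] snake_op_sum[where d = d, OF False] by (simp add: coeff_sum sum.distrib sum_distrib_left sum_negf sum_subtractf)
    qed
  qed
  \<comment> \<open>A constant polynomial differs from the indeterminate, so the spare factor in
    \<open>scan_commute\<close> can be cancelled.\<close>
  have "?y - ?x \<noteq> 0" by simp
  moreover have "0 < b i" using False by simp
  ultimately have "snake_scan ?y R M {} (\<lambda>K a. (if i \<in> K then ?y else 0) * strip_scan ?x R M ?f a) b =
     strip_scan ?x R M (\<lambda>d. snake_scan ?y R M {} end_weight d) b"
    using scan_commute[of b M] by (simp only: mult_cancel_left) simp
  then have "- snake_op R i m (strip_op x R g) b = poly.coeff (strip_scan ?x R M (\<lambda>d. snake_scan ?y R M {} end_weight d) b) (Suc m)"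
    using lhs by simp
  also have "\<dots> = (\<Sum>d\<in>strips R b. x ^ (sum b R - sum d R) * (- snake_op R i m g d + x * snake_op R i (Suc m) g d))"
    unfolding strip_scan_const[where b = b, OF R(1) M] using inner by (simp add: coeff_sum)
  also have "\<dots> = - strip_op x R (snake_op R i m g) b + x * strip_op x R (snake_op R i (Suc m) g) b"
    unfolding strip_op_def sum_distrib_left sum_negf[symmetric] sum.distrib[symmetric]
    by (intro sum.cong) (auto simp: algebra_simps)
  finally show ?thesis by (simp add: algebra_simps)
qed

section \<open>Expansion along the lowest nonempty row\<close>

definition hom :: "nat \<Rightarrow> nat \<Rightarrow> nat \<Rightarrow> int_mpoly" where
  "hom m k i = (\<Sum>js | length js = m \<and> sorted js \<and> set js \<subseteq> {k..i}. prod_list (map X js))"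

lemma finite_hom_index: "finite {js. length js = m \<and> sorted js \<and> set js \<subseteq> {k..i::nat}}"
  by (rule finite_subset[OF _ finite_lists_length_eq[of "{k..i}" m]]) auto

lemma hom_0 [simp]: "hom 0 k i = 1"
proof -
  have "{js. length js = 0 \<and> sorted js \<and> set js \<subseteq> {k..i::nat}} = {[]}" by auto
  then show ?thesis by (simp add: hom_def)
qed

lemma hom_Suc_empty: "i < k \<Longrightarrow> hom (Suc m) k i = 0"
  by (simp add: hom_def) (metis (no_types, lifting) Collect_empty_eq atLeastatMost_empty empty_subsetI
      length_0_conv nat.distinct(1) set_empty subset_empty sum.empty)

lemma hom_Suc:
  assumes "k \<le> i"
  shows "hom (Suc m) k i = X k * hom m k i + hom (Suc m) (Suc k) i"
proof -
  let ?A = "\<lambda>m k. {js. length js = m \<and> sorted js \<and> set js \<subseteq> {k..i}}"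
  have "?A (Suc m) k = (#) k ` ?A m k \<union> ?A (Suc m) (Suc k)"
  proof (intro equalityI subsetI)
    fix js assume "js \<in> ?A (Suc m) k"
    then obtain j ks where js: "js = j # ks" "length ks = m" "sorted (j # ks)" "set (j # ks) \<subseteq> {k..i}"
      by (cases js) auto
    show "js \<in> (#) k ` ?A m k \<union> ?A (Suc m) (Suc k)"
    proof (cases "j = k")
      case False
      then have "set js \<subseteq> {Suc k..i}" using js by fastforce
      then show ?thesis using js by auto
    qed (use js in auto)
  next
    fix js assume "js \<in> (#) k ` ?A m k \<union> ?A (Suc m) (Suc k)"
    then show "js \<in> ?A (Suc m) k" using assms by fastforce
  qed
  moreover have "(#) k ` ?A m k \<inter> ?A (Suc m) (Suc k) = {}" by auto
  ultimately have "hom (Suc m) k i = (\<Sum>js\<in>(#) k ` ?A m k. prod_list (map X js)) + hom (Suc m) (Suc k) i"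
    unfolding hom_def using finite_hom_index by (simp add: sum.union_disjoint)
  also have "(\<Sum>js\<in>(#) k ` ?A m k. prod_list (map X js)) = X k * hom m k i"
    unfolding hom_def by (subst sum.reindex) (auto simp: sum_distrib_left)
  finally show ?thesis .
qed

definition comps_from :: "nat \<Rightarrow> nat \<Rightarrow> (nat \<Rightarrow> nat) set" where
  "comps_from n k = {b. \<forall>r. r \<notin> {k..n} \<longrightarrow> b r = 0}"

lemma comps_from_mono: "k \<le> i \<Longrightarrow> comps_from n i \<subseteq> comps_from n k"
  by (auto simp: comps_from_def)

text \<open>Empty rows below \<open>i\<close> impose no strip condition. All letters up to
  \<open>i\<close> can thus be erased over the same row set \<open>{i..n}\<close>, whose least row
  is \<open>i\<close> as the commutation relation demands.\<close>

lemma strips_comps_eq: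
  assumes b: "b \<in> comps_from n i" and "k \<le> i"
  shows "strips {k..n} b = strips {i..n} b" "sum b {k..n} = sum b {i..n}"
proof -
  have 0: "b r = 0" if "r \<notin> {i..n}" for r using b that by (simp add: comps_from_def)
  have bf: "bounded_funs {k..n} b = bounded_funs {i..n} b"
    using 0 \<open>k \<le> i\<close> unfolding bounded_funs_def
    by (intro Collect_cong) (metis atLeastAtMost_iff le_trans le_zero_eq)
  show "strips {k..n} b = strips {i..n} b"
  proof (intro equalityI subsetI)
    fix d assume "d \<in> strips {k..n} b"
    then show "d \<in> strips {i..n} b" using \<open>k \<le> i\<close> by (auto simp: strips_def bf)
  next
    fix d assume d: "d \<in> strips {i..n} b"
    have "b r \<le> d s \<or> b s < d r" if "r \<in> {k..n}" "s \<in> {k..n}" "r < s" "d s < b s" for r s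
    proof (cases "r \<in> {i..n}")
      case True
      then have "s \<in> {i..n}" using that by auto
      then show ?thesis using d True that by (auto simp: strips_def)
    qed (use 0 in simp)
    then show "d \<in> strips {k..n} b" using d by (simp add: strips_def bf)
  qed
  show "sum b {k..n} = sum b {i..n}"
    using 0 \<open>k \<le> i\<close> by (intro sum.mono_neutral_right) auto
qed

lemma strips_comps:
  assumes "b \<in> comps_from n i" "d \<in> strips R b"
  shows "d \<in> comps_from n i"
proof -
  have "d r \<le> b r" for r using assms(2) by (auto simp: strips_def bounded_funs_def)
  then show ?thesis using assms(1) by (auto simp: comps_from_def) (metis le_zero_eq)+
qed

lemma snake_cuts_comps:
  assumes "b \<in> comps_from n i" "a \<in> snake_cuts {i..n} i b"
  shows "a \<in> comps_from n (Suc i)"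
proof -
  have "a r \<le> b r" for r using assms(2)
    by (auto simp: snake_cuts_def all_scans_def bounded_funs_def split: if_splits)
  moreover have "a i = 0" using assms(2) by (auto simp: snake_cuts_def split: if_splits)
  ultimately show ?thesis using assms(1) unfolding comps_from_def
    by (auto simp: not_le) (metis Suc_leI le_antisym le_zero_eq not_less)+
qed

text \<open>Tableaux enter the expansion only through this recursion on the smallest letter. The
  constraint \<open>d k = 0\<close> reflects that a letter above \<open>k\<close> cannot stand in
  row \<open>k\<close>.\<close>

locale key_branching =
  fixes n :: nat and g :: "nat \<Rightarrow> (nat \<Rightarrow> nat) \<Rightarrow> int_mpoly"
  assumes branching: "\<And>k b. 1 \<le> k \<Longrightarrow> k \<le> n \<Longrightarrow> b \<in> comps_from n k \<Longrightarrow>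
    g k b = (\<Sum>d | d \<in> strips {k..n} b \<and> d k = 0. X k ^ (sum b {k..n} - sum d {k..n}) * g (Suc k) d)"
begin

lemma branching_above:
  assumes "1 \<le> k" "k \<le> i" "i \<le> n" "b \<in> comps_from n i"
  shows "g k b = (\<Sum>d | d \<in> strips {i..n} b \<and> d k = 0. X k ^ (sum b {i..n} - sum d {i..n}) * g (Suc k) d)"
proof -
  have "b \<in> comps_from n k" using assms comps_from_mono by blast
  moreover have "sum d {k..n} = sum d {i..n}" if "d \<in> strips {i..n} b" for d
    using strips_comps[OF assms(4) that] assms(2) by (rule strips_comps_eq(2))
  ultimately show ?thesis
    using assms branching[of k b] strips_comps_eq[OF assms(4,2)]
    by (auto intro!: sum.cong)
qed

lemma branching_strip_op:
  assumes "1 \<le> k" "k \<le> i" "i \<le> n" "b \<in> comps_from n i" "b k = 0"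
  shows "g k b = strip_op (X k) {i..n} (g (Suc k)) b"
proof -
  have "d k = 0" if "d \<in> strips {i..n} b" for d
    using that assms(5) by (auto simp: strips_def bounded_funs_def dest: spec[of _ k])
  then have "{d. d \<in> strips {i..n} b \<and> d k = 0} = strips {i..n} b" by blast
  then show ?thesis unfolding branching_above[OF assms(1-4)] strip_op_def by simp
qed

lemma snake_op_large:
  assumes "sum b R < m"
  shows "snake_op R i m h b = 0"
  using assms by (auto simp: snake_op_def intro!: sum.neutral)

text \<open>At \<open>k = Suc i\<close> the right-hand side supplies the constraint
  \<open>d i = 0\<close> in the branching of \<open>g i\<close>; for smaller letters that constraint
  is automatic. The bound \<open>L\<close> is left free because a strip changes the number of cells
  while the range of \<open>m\<close> has to stay fixed along the induction.\<close>

theorem snake_expansion_step: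
  assumes i: "1 \<le> i" "i \<le> n" and k: "1 \<le> k" "k \<le> Suc i" and b: "b \<in> comps_from n i" "sum b {i..n} \<le> L"
  shows "(\<Sum>m\<le>L. hom m k i * snake_op {i..n} i m (g k) b) =
    (if k = Suc i \<and> b i \<noteq> 0 then 0 else g k b)"
  using k(2,1) b
proof (induction k arbitrary: b rule: inc_induct)
  case base
  have "hom m (Suc i) i = 0" if "m \<noteq> 0" for m
    using that hom_Suc_empty[of i "Suc i"] by (cases m) auto
  then have "(\<Sum>m\<le>L. hom m (Suc i) i * snake_op {i..n} i m (g (Suc i)) b) = snake_op {i..n} i 0 (g (Suc i)) b"
    by (subst sum.remove[of _ 0]) (auto intro!: sum.neutral)
  also have "\<dots> = (if b i \<noteq> 0 then 0 else g (Suc i) b)"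
  proof (cases "b i = 0")
    case True
    then show ?thesis by (simp add: snake_op_zero)
  next
    case False
    have lt: "sum a {i..n} < sum b {i..n}" if "a \<in> snake_cuts {i..n} i b" for a
    proof (rule sum_strict_mono_ex1)
      show "\<forall>r\<in>{i..n}. a r \<le> b r" "\<exists>r\<in>{i..n}. a r < b r"
        using that False i by (auto simp: snake_cuts_def all_scans_def bounded_funs_def intro!: bexI[of _ i])
    qed simp
    have e: "{a. a \<in> snake_cuts {i..n} i b \<and> sum b {i..n} = sum a {i..n} + 0} = {}"
    proof -
      have "sum b {i..n} \<noteq> sum a {i..n} + 0" if "a \<in> snake_cuts {i..n} i b" for a
        using lt[OF that] by simp
      then show ?thesis by blast
    qed
    show ?thesis using False unfolding snake_op_def e by simp
  qed
  finally show ?case by simp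
next
  case (step k)
  let ?R = "{i..n}" and ?N = "snake_op {i..n} i" and ?q = "\<lambda>d. if k = i \<and> d i \<noteq> 0 then 0 else g (Suc k) d"
  have k: "1 \<le> k" "k \<le> i" using step by auto
  have Nk: "?N m (g k) b = strip_op (X k) ?R (?N m (g (Suc k))) b - X k * strip_op (X k) ?R (?N (Suc m) (g (Suc k))) b" for m
  proof -
    \<comment> \<open>The snake has emptied row \<open>i\<close>, so even for \<open>k = i\<close>
      the branching of \<open>g k a\<close> runs over all strips.\<close>
    have "g k a = strip_op (X k) ?R (g (Suc k)) a" if "a \<in> snake_cuts ?R i b" for a
    proof -
      have a: "a \<in> comps_from n (Suc i)" using snake_cuts_comps[OF step.prems(2) that] .
      then have "a \<in> comps_from n i" "a k = 0" using k(2) comps_from_mono[of i "Suc i" n] by (auto simp: comps_from_def)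
      then show ?thesis using branching_strip_op i k by blast
    qed
    then have "?N m (g k) b = ?N m (strip_op (X k) ?R (g (Suc k))) b"
      by (auto simp: snake_op_def intro!: sum.cong)
    also have "\<dots> = strip_op (X k) ?R (?N m (g (Suc k))) b - X k * strip_op (X k) ?R (?N (Suc m) (g (Suc k))) b"
    proof (rule snake_op_strip_op)
      show "b r \<le> sum b ?R" for r
        using step.prems(2) by (cases "r \<in> ?R") (auto simp: comps_from_def intro: member_le_sum)
    qed (use i in auto)
    finally show ?thesis .
  qed
  have inner: "(\<Sum>m\<le>L. hom m k i * (?N m (g (Suc k)) d - X k * ?N (Suc m) (g (Suc k)) d)) = ?q d"
    if d: "d \<in> strips ?R b" for d
  proof -
    have dV: "d \<in> comps_from n i" using strips_comps[OF step.prems(2) d] .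
    have "sum d ?R \<le> sum b ?R" using d by (intro sum_mono) (auto simp: strips_def bounded_funs_def)
    then have dL: "sum d ?R \<le> L" using step.prems(3) by simp
    let ?F = "\<lambda>m. ?N m (g (Suc k)) d"
    \<comment> \<open>Boundary term of the summation by parts: a composition with at most
      \<open>L\<close> cells has no snake of \<open>L + 1\<close> cells.\<close>
    have z: "?F (Suc L) = 0" using dL by (intro snake_op_large) simp
    have "(\<Sum>m\<le>L. hom m k i * (?F m - X k * ?F (Suc m))) =
      (\<Sum>m\<le>L. hom m k i * ?F m) - (\<Sum>m<Suc L. X k * hom m k i * ?F (Suc m))"
      by (simp add: algebra_simps sum_subtractf lessThan_Suc_atMost)
    also have "(\<Sum>m<Suc L. X k * hom m k i * ?F (Suc m)) = (\<Sum>m<L. X k * hom m k i * ?F (Suc m))"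
      using z by simp
    also have "(\<Sum>m\<le>L. hom m k i * ?F m) = ?F 0 + (\<Sum>m<L. hom (Suc m) k i * ?F (Suc m))"
      by (simp add: sum.atMost_shift)
    also have "?F 0 + (\<Sum>m<L. hom (Suc m) k i * ?F (Suc m)) - (\<Sum>m<L. X k * hom m k i * ?F (Suc m)) =
       ?F 0 + (\<Sum>m<L. hom (Suc m) (Suc k) i * ?F (Suc m))"
      using k by (simp add: hom_Suc algebra_simps sum.distrib)
    also have "\<dots> = (\<Sum>m\<le>L. hom m (Suc k) i * ?F m)"
      by (simp add: sum.atMost_shift)
    also have "\<dots> = ?q d"
      using step.IH[of d] dV dL by simp
    finally show ?thesis .
  qed
  have "(\<Sum>m\<le>L. hom m k i * ?N m (g k) b) =
    (\<Sum>m\<le>L. \<Sum>d\<in>strips ?R b. X k ^ (sum b ?R - sum d ?R) *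
       (hom m k i * (?N m (g (Suc k)) d - X k * ?N (Suc m) (g (Suc k)) d)))"
    unfolding Nk strip_op_def sum_distrib_left sum_subtractf[symmetric]
    by (intro sum.cong refl) (simp add: algebra_simps)
  also have "\<dots> = (\<Sum>d\<in>strips ?R b. X k ^ (sum b ?R - sum d ?R) * ?q d)"
    unfolding sum.swap[of _ "strips ?R b"] sum_distrib_left[symmetric] using inner by simp
  also have "\<dots> = g k b"
  proof (cases "k = i")
    case True
    have "(\<Sum>d\<in>strips ?R b. X k ^ (sum b ?R - sum d ?R) * ?q d) =
      (\<Sum>d | d \<in> strips ?R b \<and> d i = 0. X k ^ (sum b ?R - sum d ?R) * g (Suc k) d)"
      using True finite_strips[of ?R b] by (intro sum.mono_neutral_cong_right) auto
    then show ?thesis using branching_above[OF k i(2) step.prems(2)] True by simp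
  next
    case False
    then have "b k = 0" using step.prems(2) k by (auto simp: comps_from_def)
    then show ?thesis using branching_strip_op[OF k i(2) step.prems(2)] False by (simp add: strip_op_def)
  qed
  finally show ?case using k by simp
qed

theorem snake_expansion:
  assumes "1 \<le> i" "i \<le> n" "b \<in> comps_from n i"
  shows "g 1 b = (\<Sum>a\<in>snake_cuts {i..n} i b. cut_sign {i..n} a b * complete_hom (sum b {i..n} - sum a {i..n}) i * g 1 a)"
proof -
  let ?s = "\<lambda>a. sum b {i..n} - sum a {i..n}"
  have le: "sum a {i..n} \<le> sum b {i..n}" if "a \<in> snake_cuts {i..n} i b" for a
    using that by (intro sum_mono) (auto simp: snake_cuts_def all_scans_def bounded_funs_def split: if_splits)
  have "g 1 b = (\<Sum>m\<le>sum b {i..n}. hom m 1 i * snake_op {i..n} i m (g 1) b)"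
    using snake_expansion_step[of i 1 b "sum b {i..n}"] assms by simp
  also have "\<dots> = (\<Sum>m\<le>sum b {i..n}. \<Sum>a | a \<in> snake_cuts {i..n} i b \<and> ?s a = m. cut_sign {i..n} a b * hom (?s a) 1 i * g 1 a)"
  proof (rule sum.cong[OF refl])
    fix m
    have "{a. a \<in> snake_cuts {i..n} i b \<and> sum b {i..n} = sum a {i..n} + m} = {a. a \<in> snake_cuts {i..n} i b \<and> ?s a = m}"
      using le by auto
    then show "hom m 1 i * snake_op {i..n} i m (g 1) b =
      (\<Sum>a | a \<in> snake_cuts {i..n} i b \<and> ?s a = m. cut_sign {i..n} a b * hom (?s a) 1 i * g 1 a)"
      unfolding snake_op_def sum_distrib_left by (auto intro!: sum.cong simp: mult_ac)
  qed
  also have "\<dots> = (\<Sum>a\<in>snake_cuts {i..n} i b. cut_sign {i..n} a b * hom (?s a) 1 i * g 1 a)"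
    by (rule sum.group) (auto simp: finite_snake_cuts)
  finally show ?thesis by (simp add: hom_def complete_hom_def)
qed

end

section \<open>Special snakes and tabloids\<close>

lemma mem_key_diagram: "(c, r) \<in> key_diagram n a \<longleftrightarrow> 1 \<le> c \<and> r \<in> {1..n} \<and> c \<le> a r"
  by (simp add: key_diagram_def)

lemma weak_comps_eq_comps: "weak_comps n = comps_from n 1"
  by (simp add: weak_comps_def comps_from_def)

lemma mem_key_diagram_weak:
  assumes "a \<in> weak_comps n"
  shows "(c, r) \<in> key_diagram n a \<longleftrightarrow> 1 \<le> c \<and> c \<le> a r"
  using assms by (cases "r \<in> {1..n}") (auto simp: mem_key_diagram weak_comps_def)

definition row_lengths :: "cell set \<Rightarrow> nat \<Rightarrow> nat" where
  "row_lengths S r = card {c. (c, r) \<in> S}"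

lemma row_lengths_key_diagram:
  assumes "a \<in> weak_comps n"
  shows "row_lengths (key_diagram n a) = a"
proof
  fix r
  have "{c. (c, r) \<in> key_diagram n a} = {1..a r}"
    using mem_key_diagram_weak[OF assms] by auto
  then show "row_lengths (key_diagram n a) r = a r" by (simp add: row_lengths_def)
qed

lemma key_diagram_inject:
  "a \<in> weak_comps n \<Longrightarrow> b \<in> weak_comps n \<Longrightarrow> key_diagram n a = key_diagram n b \<Longrightarrow> a = b"
  using row_lengths_key_diagram by metis

lemma key_diagram_mono: "(\<And>r. a r \<le> b r) \<Longrightarrow> key_diagram n a \<subseteq> key_diagram n b"
  by (auto simp: key_diagram_def intro: le_trans)

lemma card_key_diagram: "card (key_diagram n a) = sum a {1..n}"
proof -
  have "key_diagram n a = (\<lambda>(r, c). (c, r)) ` (SIGMA r:{1..n}. {1..a r})"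
    by (auto simp: key_diagram_def)
  moreover have "inj_on (\<lambda>(r, c). (c, r)) (SIGMA r:{1..n}. {1..a r})"
    by (auto simp: inj_on_def)
  ultimately show ?thesis by (simp add: card_image)
qed

lemma trancl_crossing:
  assumes "(x, y) \<in> E\<^sup>+" "P x" "\<not> P y"
  shows "\<exists>u v. (u, v) \<in> E \<and> P u \<and> \<not> P v"
  using assms by (induction rule: trancl_induct) blast+

lemma snake_height_pred: "snake_height S - 1 = card (snd ` S) - 1"
  by (simp add: snake_height_def)

context
  fixes n k :: nat and b :: "nat \<Rightarrow> nat"
  assumes k: "1 \<le> k" "k \<le> n" and b: "b \<in> comps_from n k"
begin

lemma comps_from_weak: "b \<in> weak_comps n"
  using b k comps_from_mono[of 1 k n] by (auto simp: weak_comps_eq_comps)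

lemma rows_outside_empty: "r \<notin> {k..n} \<Longrightarrow> b r = 0"
  using b by (simp add: comps_from_def)

lemma bounded_weak: "(\<And>r. a r \<le> b r) \<Longrightarrow> a \<in> weak_comps n"
  using comps_from_weak by (auto simp: weak_comps_def) (metis le_zero_eq)+

lemma mem_diff:
  assumes "\<And>r. a r \<le> b r"
  shows "(c, r) \<in> key_diagram n b - key_diagram n a \<longleftrightarrow> r \<in> cols a b c"
  using mem_key_diagram_weak[OF comps_from_weak] mem_key_diagram_weak[OF bounded_weak[OF assms]]
  by (auto simp: cols_def)

lemma least_row: "b k \<noteq> 0 \<Longrightarrow> (LEAST r. (1, r) \<in> key_diagram n b) = k"
  using rows_outside_empty mem_key_diagram_weak[OF comps_from_weak]
  by (intro Least_equality) (auto simp: not_less_eq_eq[symmetric] intro!: leI)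

text \<open>Every cell is joined to \<open>(1, k)\<close> by induction on its column: the
  connectedness clause of \<open>snake_steps\<close> provides an edge to the column on the left, and
  cells of one column are always connected. The snake is special because \<open>k\<close> is the
  lowest nonempty row and is emptied.\<close>

lemma special_snake_if_snake_cuts:
  assumes a: "a \<in> snake_cuts {k..n} k b"
  shows "special_snake n b (key_diagram n b - key_diagram n a) \<and>
    (key_diagram n b - key_diagram n a = {} \<longleftrightarrow> (\<forall>c. (c, k) \<notin> key_diagram n b))"
proof (cases "b k = 0")
  case True
  then have "a = b" using a by (simp add: snake_cuts_def)
  moreover have "snake n b {}"
    using comps_from_weak by (auto simp: snake_def weakly_connected_def key_le_def)
  ultimately show ?thesis
    using True mem_key_diagram_weak[OF comps_from_weak] by (auto simp: special_snake_def)
next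
  case False
  define S where "S = key_diagram n b - key_diagram n a"
  have ak: "a k = 0" and le: "a r \<le> b r"
    and step: "1 \<le> e \<Longrightarrow> cols a b e \<in> snake_steps (site {k..n} e b) (cols a b (Suc e))" for r e
    using a False by (auto simp: snake_cuts_def all_scans_def bounded_funs_def)
  have mem: "(c, r) \<in> S \<longleftrightarrow> r \<in> cols a b c" for c r
    unfolding S_def by (rule mem_diff) (rule le)
  have pos: "1 \<le> c" if "r \<in> cols a b c" for c r using that by (simp add: cols_def)
  have first: "(1, k) \<in> S" using ak False by (simp add: mem cols_def)
  have least: "s \<le> r" if "1 \<le> e" "s \<in> cols a b e" "s \<in> cols a b (Suc e)" "r \<in> cols a b (Suc e)" for e r s
    using step[OF that(1)] that unfolding snake_steps_def by blast
  let ?E = "{(u, v). u \<in> S \<and> v \<in> S \<and> cells_weakly_connected u v}"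
  have conn: "((c, r), (1, k)) \<in> ?E\<^sup>+ \<and> ((1, k), (c, r)) \<in> ?E\<^sup>+" if "(c, r) \<in> S" for c r
    using that
  proof (induction c arbitrary: r)
    case 0
    then show ?case using pos mem by fastforce
  next
    case (Suc c)
    show ?case
    proof (cases "c = 0")
      case True
      then show ?thesis using Suc.prems first by (auto intro!: r_into_trancl simp: cells_weakly_connected_def)
    next
      case False
      have "cols a b (Suc c) \<noteq> {}" using Suc.prems mem by blast
      moreover have "1 \<le> c" using False by simp
      ultimately obtain u v where uv: "u \<in> cols a b c" "v \<in> cols a b (Suc c)" "v \<le> u"
        using step unfolding snake_steps_def by blast
      have 1: "((Suc c, r), (Suc c, v)) \<in> ?E" "((Suc c, v), (Suc c, r)) \<in> ?E"
        using Suc.prems uv mem by (auto simp: cells_weakly_connected_def)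
      have 2: "((Suc c, v), (c, u)) \<in> ?E" "((c, u), (Suc c, v)) \<in> ?E"
        using uv mem by (auto simp: cells_weakly_connected_def)
      have "(c, u) \<in> S" using uv mem by blast
      from Suc.IH[OF this] show ?thesis
        using 1 2 by (meson trancl_into_trancl trancl_into_trancl2)
    qed
  qed
  have "weakly_connected S"
    unfolding weakly_connected_def
  proof (intro ballI)
    fix x y assume "x \<in> S" "y \<in> S"
    then have "(x, (1, k)) \<in> ?E\<^sup>+" "((1, k), y) \<in> ?E\<^sup>+"
      using conn[of "fst x" "snd x"] conn[of "fst y" "snd y"] by simp_all
    then show "(x, y) \<in> ?E\<^sup>+" by (rule trancl_trans)
  qed
  moreover have "key_le n a b"
    unfolding key_le_def
  proof (intro conjI ballI impI)
    fix i j assume ij: "i \<in> {1..n}" "j \<in> {1..n}" "i < j \<and> a j < a i"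
    show "b j < b i"
    proof (rule ccontr)
      assume "\<not> b j < b i"
      \<comment> \<open>Row \<open>i\<close> ends in column \<open>b i\<close>, where the higher row
        \<open>j\<close> is cut, so row \<open>i\<close> is cut there as well. Then row
        \<open>j\<close> is cut in columns \<open>a i\<close> and \<open>a i + 1\<close> and row
        \<open>i\<close> in the latter, which are three cells forbidden by condition (3).\<close>
      then have bij: "b i \<le> b j" by simp
      have ai: "1 \<le> a i" "1 \<le> b i" using ij le[of i] by auto
      have "i \<in> {k..n}" using rows_outside_empty[of i] ai by auto
      then have "i \<in> site {k..n} (b i) b" by (simp add: site_def)
      moreover have "j \<in> cols a b (b i)" using ij bij le[of i] by (auto simp: cols_def)
      ultimately have "i \<in> cols a b (b i)"
        using step[OF ai(2)] ij(3) unfolding snake_steps_def by blast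
      then have i: "i \<in> cols a b (Suc (a i))" by (auto simp: cols_def)
      have j: "j \<in> cols a b (a i)" "j \<in> cols a b (Suc (a i))"
        using ij bij i le[of i] by (auto simp: cols_def)
      show False using least[OF ai(1) j i] ij(3) by simp
    qed
  qed (rule le)
  moreover have "key_diagram n b - S = key_diagram n a"
    using key_diagram_mono[of a b, OF le] by (auto simp: S_def)
  moreover have "\<not> (\<exists>c r s. r < s \<and> {(c, s), (c + 1, s), (c + 1, r)} \<subseteq> S)"
    using least pos by (fastforce simp: mem)
  moreover have "a \<in> weak_comps n" using le by (rule bounded_weak)
  ultimately have "snake n b S"
    unfolding snake_def S_def by blast
  then have "special_snake n b S"
    using first least_row[OF False] by (simp add: special_snake_def)
  moreover have "S \<noteq> {}" "(1, k) \<in> key_diagram n b" using first by (auto simp: S_def)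
  ultimately show ?thesis unfolding S_def[symmetric] by blast
qed

text \<open>Connectedness is a global condition, whereas \<open>snake_steps\<close> asks for an edge
  between every two adjacent columns. A path from \<open>(1, k)\<close> to column
  \<open>e + 1\<close> must leave the columns up to \<open>e\<close> somewhere, and since each edge
  changes the column by at most one, that crossing edge is the required one.\<close>

lemma snake_cuts_if_special_snake:
  assumes S: "special_snake n b S" "S = {} \<longleftrightarrow> (\<forall>c. (c, k) \<notin> key_diagram n b)"
  shows "\<exists>a\<in>snake_cuts {k..n} k b. S = key_diagram n b - key_diagram n a"
proof (cases "b k = 0")
  case True
  then have "S = {}" using S(2) mem_key_diagram_weak[OF comps_from_weak] by auto
  then show ?thesis using True by (auto simp: snake_cuts_def)
next
  case False
  then have "(1, k) \<in> key_diagram n b" using mem_key_diagram_weak[OF comps_from_weak] by simp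
  then have first: "(1, k) \<in> S"
    using S least_row[OF False] by (auto simp: special_snake_def)
  obtain a where sub: "S \<subseteq> key_diagram n b" and conn: "weakly_connected S"
    and a: "a \<in> weak_comps n" "key_le n a b" "key_diagram n b - S = key_diagram n a"
    and three: "\<not> (\<exists>c r s. r < s \<and> {(c, s), (c + 1, s), (c + 1, r)} \<subseteq> S)"
    using S(1) unfolding special_snake_def snake_def by blast
  have le: "a r \<le> b r" for r
    using a(1,2) by (cases "r \<in> {1..n}") (auto simp: weak_comps_def key_le_def)
  have Seq: "S = key_diagram n b - key_diagram n a" using a(3) sub by blast
  have mem: "(c, r) \<in> S \<longleftrightarrow> r \<in> cols a b c" for c r
    unfolding Seq by (rule mem_diff) (rule le)
  have row: "r \<in> {k..n}" if "r \<in> cols a b c" for c r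
    using that rows_outside_empty[of r] by (cases "r \<in> {k..n}") (auto simp: cols_def)
  have "cols a b e \<in> snake_steps (site {k..n} e b) (cols a b (Suc e))" if e: "1 \<le> e" for e
  proof -
    have 1: "cols a b e \<subseteq> site {k..n} e b \<union> cols a b (Suc e)"
    proof
      fix r assume r: "r \<in> cols a b e"
      then show "r \<in> site {k..n} e b \<union> cols a b (Suc e)"
        using row[OF r] by (auto simp: cols_def site_def)
    qed
    \<comment> \<open>If row \<open>r\<close> kept its last cell in column \<open>e\<close>, then
      \<open>a s < a r\<close>, and the key order would make row \<open>r\<close> of
      \<open>b\<close> longer than row \<open>s\<close>, although row \<open>s\<close> reaches
      column \<open>e\<close>.\<close>
    have 2: "r \<in> cols a b e" if "s \<in> cols a b e" "r \<in> site {k..n} e b" "r < s" for r s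
    proof (rule ccontr)
      assume "r \<notin> cols a b e"
      then have "a s < a r" "b r \<le> b s" using that by (auto simp: cols_def site_def)
      moreover have "r \<in> {1..n}" "s \<in> {1..n}" using that row k by (auto simp: site_def)
      ultimately show False using a(2) that(3) unfolding key_le_def by (metis linorder_not_le)
    qed
    have 3: "s \<le> r" if "s \<in> cols a b e" "s \<in> cols a b (Suc e)" "r \<in> cols a b (Suc e)" for r s
    proof (rule ccontr)
      assume "\<not> s \<le> r"
      then have "r < s \<and> {(e, s), (e + 1, s), (e + 1, r)} \<subseteq> S" using that by (simp add: mem)
      then show False using three by blast
    qed
    have 4: "\<exists>u\<in>cols a b e. \<exists>v\<in>cols a b (Suc e). v \<le> u" if ne: "cols a b (Suc e) \<noteq> {}"
    proof -
      obtain v0 where "v0 \<in> cols a b (Suc e)" using ne by blast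
      then have v0: "(Suc e, v0) \<in> S" by (simp add: mem)
      let ?E = "{(u, v). u \<in> S \<and> v \<in> S \<and> cells_weakly_connected u v}"
      have "((1, k), (Suc e, v0)) \<in> ?E\<^sup>+"
        using bspec[OF bspec[OF conn[unfolded weakly_connected_def] first] v0] .
      then have "\<exists>u v. (u, v) \<in> ?E \<and> fst u \<le> e \<and> \<not> fst v \<le> e"
        by (rule trancl_crossing) (use e in auto)
      then obtain x y where xy: "(x, y) \<in> ?E" "fst x \<le> e" "\<not> fst y \<le> e"
        by blast
      obtain c u c' v where "x = (c, u)" "y = (c', v)" by (metis surj_pair)
      with xy have "c = e" "c' = Suc e" "v \<le> u" "(c, u) \<in> S" "(c', v) \<in> S"
        by (auto simp: cells_weakly_connected_def)
      then have "u \<in> cols a b e" "v \<in> cols a b (Suc e)" "v \<le> u" by (simp_all add: mem)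
      then show ?thesis by blast
    qed
    show ?thesis unfolding snake_steps_def using 1 2 3 4 by blast
  qed
  moreover have "a \<in> bounded_funs {k..n} b"
  proof -
    have "a r = b r" if "r \<notin> {k..n}" for r using le[of r] rows_outside_empty[OF that] by simp
    then show ?thesis using le by (simp add: bounded_funs_def)
  qed
  moreover have "a k = 0"
  proof -
    have "k \<in> cols a b 1" using first by (simp only: mem)
    then show ?thesis by (simp add: cols_def)
  qed
  ultimately have "a \<in> snake_cuts {k..n} k b" using False by (simp add: snake_cuts_def all_scans_def)
  then show ?thesis using Seq by blast
qed

lemma snake_cuts_le: "a \<in> snake_cuts {k..n} k b \<Longrightarrow> a r \<le> b r"
  by (auto simp: snake_cuts_def all_scans_def bounded_funs_def split: if_splits)

lemma snake_cuts_weak: "a \<in> snake_cuts {k..n} k b \<Longrightarrow> a \<in> weak_comps n"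
  using snake_cuts_le bounded_weak by blast

lemma snake_cuts_diagram: "a \<in> snake_cuts {k..n} k b \<Longrightarrow> key_diagram n b - (key_diagram n b - key_diagram n a) = key_diagram n a"
  using key_diagram_mono[of a b] snake_cuts_le by blast

lemma card_snake_cuts:
  assumes a: "a \<in> snake_cuts {k..n} k b"
  shows "card (key_diagram n b - key_diagram n a) = sum b {k..n} - sum a {k..n}"
proof -
  have "card (key_diagram n b - key_diagram n a) = sum b {1..n} - sum a {1..n}"
    using key_diagram_mono[of a b] snake_cuts_le[OF a]
    by (simp add: card_Diff_subset finite_key_diagram card_key_diagram)
  moreover have "a \<in> comps_from n k" using snake_cuts_comps[OF b a] comps_from_mono[of k "Suc k" n] by auto
  ultimately show ?thesis using strips_comps_eq(2)[OF _ k(1)] b by simp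
qed

lemma sign_snake_cuts:
  assumes a: "a \<in> snake_cuts {k..n} k b"
  shows "of_int (snake_sign (key_diagram n b - key_diagram n a)) = (cut_sign {k..n} a b :: int_mpoly)"
proof -
  let ?S = "key_diagram n b - key_diagram n a"
  have "snd ` ?S = {r \<in> {k..n}. a r < b r}"
  proof (intro equalityI subsetI)
    fix r assume "r \<in> snd ` ?S"
    then obtain c where "r \<in> cols a b c" using mem_diff[of a, OF snake_cuts_le[OF a]] by fastforce
    then show "r \<in> {r \<in> {k..n}. a r < b r}" using rows_outside_empty[of r] by (cases "r \<in> {k..n}") (auto simp: cols_def)
  next
    fix r assume "r \<in> {r \<in> {k..n}. a r < b r}"
    then have "(b r, r) \<in> ?S" using mem_diff[of a, OF snake_cuts_le[OF a]] by (simp add: cols_def)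
    then show "r \<in> snd ` ?S" by force
  qed
  then have "snake_height ?S - 1 = card {r \<in> {k..n}. a r < b r} - 1"
    unfolding snake_height_pred by (simp only:)
  then show ?thesis by (simp add: snake_sign_def cut_sign_def)
qed

end

section \<open>Splitting off the first snake of a tabloid\<close>

definition tabloids_from :: "nat \<Rightarrow> nat \<Rightarrow> (nat \<Rightarrow> nat) \<Rightarrow> (nat \<Rightarrow> cell set) set" where
  "tabloids_from n k b = {U \<in> {k..n} \<rightarrow>\<^sub>E Pow (key_diagram n b).
     disjoint_family_on U {k..n} \<and> (\<Union>i\<in>{k..n}. U i) = key_diagram n b \<and>
     (\<forall>i\<in>{k..n}. \<exists>d\<in>weak_comps n.
        key_diagram n d = key_diagram n b - (\<Union>j\<in>{k..<i}. U j) \<and>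
        special_snake n d (U i) \<and>
        (U i = {} \<longleftrightarrow> (\<forall>c. (c, i) \<notin> key_diagram n d)))}"

lemma tabloids_fromE:
  assumes "U \<in> tabloids_from n k b" "i \<in> {k..n}"
  obtains d where "d \<in> weak_comps n" "key_diagram n d = key_diagram n b - (\<Union>j\<in>{k..<i}. U j)"
    "special_snake n d (U i)" "U i = {} \<longleftrightarrow> (\<forall>c. (c, i) \<notin> key_diagram n d)"
proof -
  have "\<forall>i\<in>{k..n}. \<exists>d\<in>weak_comps n. key_diagram n d = key_diagram n b - (\<Union>j\<in>{k..<i}. U j) \<and>
      special_snake n d (U i) \<and> (U i = {} \<longleftrightarrow> (\<forall>c. (c, i) \<notin> key_diagram n d))"
    using assms(1) unfolding tabloids_from_def mem_Collect_eq by (elim conjE)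
  then show ?thesis using assms(2) that by meson
qed

lemma finite_tabs: "finite (tabloids_from n k b)"
  by (rule finite_subset[of _ "{k..n} \<rightarrow>\<^sub>E Pow (key_diagram n b)"])
    (auto simp: tabloids_from_def intro!: finite_PiE finite_key_diagram)

lemma tabloids_from_insert:
  assumes k: "1 \<le> k" "k \<le> n" and b: "b \<in> comps_from n k" and a: "a \<in> snake_cuts {k..n} k b"
    and U: "U \<in> tabloids_from n (Suc k) a"
  shows "U(k := key_diagram n b - key_diagram n a) \<in> tabloids_from n k b"
proof -
  let ?S = "key_diagram n b - key_diagram n a" and ?D = "key_diagram n"
  let ?U = "U(k := ?S)"
  have sub: "?D a \<subseteq> ?D b" using key_diagram_mono snake_cuts_le[OF k b a] by blast
  have ivl: "{k..n} = insert k {Suc k..n}" using k by auto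
  have U1: "U i \<subseteq> ?D a" if "i \<in> {Suc k..n}" for i using U that by (auto simp: tabloids_from_def)
  have U2: "disjoint_family_on U {Suc k..n}" "(\<Union>i\<in>{Suc k..n}. U i) = ?D a" using U by (auto simp: tabloids_from_def)
  have "?U \<in> {k..n} \<rightarrow>\<^sub>E Pow (?D b)"
    using U U1 sub k by (auto simp: tabloids_from_def PiE_iff extensional_def ivl)
  moreover have "disjoint_family_on ?U {k..n}"
    unfolding disjoint_family_on_def
  proof (intro ballI impI)
    fix i j assume ij: "i \<in> {k..n}" "j \<in> {k..n}" "i \<noteq> j"
    consider "i = k" "j \<in> {Suc k..n}" | "j = k" "i \<in> {Suc k..n}" | "i \<in> {Suc k..n}" "j \<in> {Suc k..n}"
      using ij by fastforce
    then show "?U i \<inter> ?U j = {}"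
    proof cases
      case 3
      then show ?thesis using ij U2(1) by (auto simp: disjoint_family_on_def)
    qed (use U1 ij in auto)
  qed
  moreover have "(\<Union>i\<in>{k..n}. ?U i) = ?D b"
  proof -
    have "(\<Union>i\<in>{k..n}. ?U i) = ?S \<union> (\<Union>i\<in>{Suc k..n}. U i)" unfolding ivl by auto
    then show ?thesis using U2 sub by auto
  qed
  moreover have "\<exists>d\<in>weak_comps n. ?D d = ?D b - (\<Union>j\<in>{k..<i}. ?U j) \<and>
        special_snake n d (?U i) \<and> (?U i = {} \<longleftrightarrow> (\<forall>c. (c, i) \<notin> ?D d))" if i: "i \<in> {k..n}" for i
  proof (cases "i = k")
    case True
    then show ?thesis
      using special_snake_if_snake_cuts[OF k b a] comps_from_weak[OF k b] by (intro bexI[of _ b]) auto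
  next
    case False
    then have i': "i \<in> {Suc k..n}" using i by auto
    obtain d where d: "d \<in> weak_comps n" "?D d = ?D a - (\<Union>j\<in>{Suc k..<i}. U j)"
      "special_snake n d (U i)" "U i = {} \<longleftrightarrow> (\<forall>c. (c, i) \<notin> ?D d)"
      by (rule tabloids_fromE[OF U i'])
    have "{k..<i} = insert k {Suc k..<i}" using i' by auto
    then have "?D b - (\<Union>j\<in>{k..<i}. ?U j) = ?D d" using d(2) sub by auto
    then show ?thesis using d False by (intro bexI[of _ d]) auto
  qed
  ultimately show ?thesis by (simp add: tabloids_from_def)
qed

text \<open>The composition left by the first snake is recovered from the remaining diagram through
  \<open>row_lengths\<close>, the inverse of \<open>key_diagram\<close>. This explicit inverse is
  what the bijection behind \<open>sum_tabloids_from_Suc\<close> uses.\<close>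

lemma tabloids_from_remove:
  assumes k: "1 \<le> k" "k \<le> n" and b: "b \<in> comps_from n k" and U: "U \<in> tabloids_from n k b"
  defines "a \<equiv> row_lengths (key_diagram n b - U k)"
  shows "a \<in> snake_cuts {k..n} k b" "U k = key_diagram n b - key_diagram n a"
    "restrict U {Suc k..n} \<in> tabloids_from n (Suc k) a"
proof -
  let ?D = "key_diagram n"
  have kk: "k \<in> {k..n}" using k by simp
  have ivl: "{k..n} = insert k {Suc k..n}" using k by auto
  obtain d where d: "d \<in> weak_comps n" "?D d = ?D b" "special_snake n d (U k)"
    "U k = {} \<longleftrightarrow> (\<forall>c. (c, k) \<notin> ?D d)"
    by (rule tabloids_fromE[OF U kk]) simp
  have "d = b" using d(1,2) comps_from_weak[OF k b] key_diagram_inject by blast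
  then obtain a' where a': "a' \<in> snake_cuts {k..n} k b" "U k = ?D b - ?D a'"
    using snake_cuts_if_special_snake[OF k b d(3,4)[unfolded \<open>d = b\<close>]] by (elim bexE)
  have e: "?D b - U k = ?D a'" using snake_cuts_diagram[OF k b a'(1)] a'(2) by simp
  have aa: "a = a'"
    unfolding a_def e using snake_cuts_weak[OF k b a'(1)] by (rule row_lengths_key_diagram)
  show a: "a \<in> snake_cuts {k..n} k b" "U k = ?D b - ?D a" using a' aa by auto
  have eq: "?D a = ?D b - U k" using e aa by simp
  have disj: "U i \<inter> U j = {}" if "i \<in> {k..n}" "j \<in> {k..n}" "i \<noteq> j" for i j
    using U that by (auto simp: tabloids_from_def disjoint_family_on_def)
  have sub: "U i \<subseteq> ?D b" if "i \<in> {k..n}" for i using U that by (auto simp: tabloids_from_def)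
  have sub': "U i \<subseteq> ?D a" if "i \<in> {Suc k..n}" for i
    using that disj[of i k] sub[of i] kk unfolding eq by force
  have un: "(\<Union>i\<in>{k..n}. U i) = ?D b" using U by (simp add: tabloids_from_def)
  let ?U = "restrict U {Suc k..n}"
  have "?U \<in> {Suc k..n} \<rightarrow>\<^sub>E Pow (?D a)" using sub' by auto
  moreover have "disjoint_family_on ?U {Suc k..n}"
    using disj by (auto simp: disjoint_family_on_def)
  moreover have "(\<Union>i\<in>{Suc k..n}. ?U i) = ?D a"
  proof -
    have "U k \<union> (\<Union>i\<in>{Suc k..n}. U i) = ?D b" using un unfolding ivl by simp
    moreover have "(\<Union>i\<in>{Suc k..n}. U i) \<subseteq> ?D a" using sub' by blast
    ultimately show ?thesis unfolding eq by auto
  qed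
  moreover have "\<exists>d\<in>weak_comps n. ?D d = ?D a - (\<Union>j\<in>{Suc k..<i}. ?U j) \<and>
        special_snake n d (?U i) \<and> (?U i = {} \<longleftrightarrow> (\<forall>c. (c, i) \<notin> ?D d))" if i: "i \<in> {Suc k..n}" for i
  proof -
    have "i \<in> {k..n}" using i by auto
    then obtain d where d: "d \<in> weak_comps n" "?D d = ?D b - (\<Union>j\<in>{k..<i}. U j)"
      "special_snake n d (U i)" "U i = {} \<longleftrightarrow> (\<forall>c. (c, i) \<notin> ?D d)"
      by (rule tabloids_fromE[OF U])
    have "{k..<i} = insert k {Suc k..<i}" using i by auto
    then have "?D d = ?D a - (\<Union>j\<in>{Suc k..<i}. U j)" unfolding d(2) eq by auto
    moreover have "(\<Union>j\<in>{Suc k..<i}. ?U j) = (\<Union>j\<in>{Suc k..<i}. U j)" using i by auto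
    ultimately show ?thesis using d i by (intro bexI[of _ d]) auto
  qed
  ultimately show "?U \<in> tabloids_from n (Suc k) a" by (simp add: tabloids_from_def)
qed

lemma sum_tabloids_from_Suc:
  fixes w :: "nat \<Rightarrow> cell set \<Rightarrow> 'a::comm_ring_1"
  assumes k: "1 \<le> k" "k \<le> n" and b: "b \<in> comps_from n k"
  shows "(\<Sum>U\<in>tabloids_from n k b. \<Prod>i\<in>{k..n}. w i (U i)) =
    (\<Sum>a\<in>snake_cuts {k..n} k b. w k (key_diagram n b - key_diagram n a) *
       (\<Sum>U\<in>tabloids_from n (Suc k) a. \<Prod>i\<in>{Suc k..n}. w i (U i)))"
proof -
  let ?D = "key_diagram n"
  have ivl: "{k..n} = insert k {Suc k..n}" using k by auto
  have "(\<Sum>U\<in>tabloids_from n k b. \<Prod>i\<in>{k..n}. w i (U i)) =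
    (\<Sum>(a, U)\<in>(SIGMA a:snake_cuts {k..n} k b. tabloids_from n (Suc k) a). w k (?D b - ?D a) * (\<Prod>i\<in>{Suc k..n}. w i (U i)))"
  proof (rule sum.reindex_bij_witness[where
      i = "\<lambda>(a, U). U(k := ?D b - ?D a)" and
      j = "\<lambda>U. (row_lengths (?D b - U k), restrict U {Suc k..n})"])
    fix U assume U: "U \<in> tabloids_from n k b"
    note r = tabloids_from_remove[OF k b U]
    have ext: "U i = undefined" if "i \<notin> {k..n}" for i
      using U that by (auto simp: tabloids_from_def PiE_iff extensional_def)
    show "(case (row_lengths (?D b - U k), restrict U {Suc k..n}) of (a, U) \<Rightarrow> U(k := ?D b - ?D a)) = U"
      using r(2) ext ivl by (auto simp: fun_eq_iff restrict_def)
    show "(row_lengths (?D b - U k), restrict U {Suc k..n}) \<in> (SIGMA a:snake_cuts {k..n} k b. tabloids_from n (Suc k) a)"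
      using r by simp
    show "(case (row_lengths (?D b - U k), restrict U {Suc k..n}) of (a, U) \<Rightarrow>
         w k (?D b - ?D a) * (\<Prod>i\<in>{Suc k..n}. w i (U i))) = (\<Prod>i\<in>{k..n}. w i (U i))"
      using r(2)[symmetric] unfolding ivl by simp
  next
    fix aU assume "aU \<in> (SIGMA a:snake_cuts {k..n} k b. tabloids_from n (Suc k) a)"
    then obtain a U where aU: "aU = (a, U)" "a \<in> snake_cuts {k..n} k b" "U \<in> tabloids_from n (Suc k) a" by auto
    show "(case aU of (a, U) \<Rightarrow> U(k := ?D b - ?D a)) \<in> tabloids_from n k b"
      using tabloids_from_insert[OF k b aU(2,3)] aU(1) by simp
    have "restrict (U(k := ?D b - ?D a)) {Suc k..n} = U"
      using aU(3) by (auto simp: tabloids_from_def PiE_iff extensional_def fun_eq_iff)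
    moreover have "row_lengths (?D b - (?D b - ?D a)) = a"
      unfolding snake_cuts_diagram[OF k b aU(2)] using snake_cuts_weak[OF k b aU(2)] by (rule row_lengths_key_diagram)
    ultimately show "(row_lengths (?D b - (case aU of (a, U) \<Rightarrow> U(k := ?D b - ?D a)) k),
        restrict (case aU of (a, U) \<Rightarrow> U(k := ?D b - ?D a)) {Suc k..n}) = aU"
      using aU(1) by simp
  qed
  then show ?thesis
    by (simp add: sum.Sigma[symmetric] finite_snake_cuts finite_tabs sum_distrib_left)
qed

theorem (in key_branching) tabloid_expansion:
  assumes "1 \<le> k" "k \<le> Suc n" "b \<in> comps_from n k" and one: "g 1 (\<lambda>r. 0) = 1"
  shows "g 1 b = (\<Sum>U\<in>tabloids_from n k b. \<Prod>i\<in>{k..n}. of_int (snake_sign (U i)) * complete_hom (card (U i)) i)"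
  using assms(2,1,3)
proof (induction k arbitrary: b rule: inc_induct)
  case base
  have b: "b = (\<lambda>r. 0)" using base(2) by (auto simp: comps_from_def)
  have "tabloids_from n (Suc n) b = {\<lambda>_. undefined}"
    by (auto simp: tabloids_from_def b key_diagram_def disjoint_family_on_def)
  then show ?case using one b by simp
next
  case (step k)
  have k: "1 \<le> k" "k \<le> n" using step by auto
  have "g 1 b = (\<Sum>a\<in>snake_cuts {k..n} k b. cut_sign {k..n} a b * complete_hom (sum b {k..n} - sum a {k..n}) k * g 1 a)"
    using k step.prems by (intro snake_expansion)
  also have "\<dots> = (\<Sum>a\<in>snake_cuts {k..n} k b.
      (of_int (snake_sign (key_diagram n b - key_diagram n a)) * complete_hom (card (key_diagram n b - key_diagram n a)) k) *
      (\<Sum>U\<in>tabloids_from n (Suc k) a. \<Prod>i\<in>{Suc k..n}. of_int (snake_sign (U i)) * complete_hom (card (U i)) i))"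
  proof (rule sum.cong[OF refl])
    fix a assume a: "a \<in> snake_cuts {k..n} k b"
    have "g 1 a = (\<Sum>U\<in>tabloids_from n (Suc k) a. \<Prod>i\<in>{Suc k..n}. of_int (snake_sign (U i)) * complete_hom (card (U i)) i)"
      using snake_cuts_comps[OF step.prems(2) a] by (intro step.IH) auto
    then show "cut_sign {k..n} a b * complete_hom (sum b {k..n} - sum a {k..n}) k * g 1 a =
      (of_int (snake_sign (key_diagram n b - key_diagram n a)) * complete_hom (card (key_diagram n b - key_diagram n a)) k) *
      (\<Sum>U\<in>tabloids_from n (Suc k) a. \<Prod>i\<in>{Suc k..n}. of_int (snake_sign (U i)) * complete_hom (card (U i)) i)"
      by (simp only: sign_snake_cuts[OF k step.prems(2) a] card_snake_cuts[OF k step.prems(2) a])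
  qed
  also have "\<dots> = (\<Sum>U\<in>tabloids_from n k b. \<Prod>i\<in>{k..n}. of_int (snake_sign (U i)) * complete_hom (card (U i)) i)"
    by (rule sum_tabloids_from_Suc[OF k step.prems(2), symmetric])
  finally show ?case .
qed

text \<open>Tabloids are grouped by weight; a weight whose signed count cancels contributes zero and
  falls outside the support.\<close>

lemma sum_inv_kostka:
  "(\<Sum>a | a \<in> weak_comps n \<and> inv_kostka n a b \<noteq> 0. of_int (inv_kostka n a b) * flag_hom n a) =
   (\<Sum>U\<in>tabloids_from n 1 b. \<Prod>i\<in>{1..n}. of_int (snake_sign (U i)) * complete_hom (card (U i)) i)"
proof -
  let ?T = "special_snake_tabloids n b" and ?w = "tabloid_weight n"
  have T: "tabloids_from n 1 b = ?T" by (simp add: tabloids_from_def special_snake_tabloids_def)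
  have weak: "?w U \<in> weak_comps n" for U by (simp add: tabloid_weight_def weak_comps_def)
  have "(\<Sum>U\<in>?T. \<Prod>i\<in>{1..n}. of_int (snake_sign (U i)) * complete_hom (card (U i)) i) =
    (\<Sum>U\<in>?T. of_int (tabloid_sign n U) * flag_hom n (?w U))"
    by (intro sum.cong refl) (simp add: tabloid_sign_def flag_hom_def tabloid_weight_def prod.distrib)
  also have "\<dots> = (\<Sum>a\<in>?w ` ?T. \<Sum>U | U \<in> ?T \<and> ?w U = a. of_int (tabloid_sign n U) * flag_hom n (?w U))"
    by (rule sum.group[symmetric]) (auto simp: finite_special_snake_tabloids)
  also have "\<dots> = (\<Sum>a\<in>?w ` ?T. of_int (inv_kostka n a b) * flag_hom n a)"
    by (intro sum.cong refl) (simp add: inv_kostka_def sum_distrib_right)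
  also have "\<dots> = (\<Sum>a | a \<in> weak_comps n \<and> inv_kostka n a b \<noteq> 0. of_int (inv_kostka n a b) * flag_hom n a)"
  proof (rule sum.mono_neutral_cong_right)
    show "{a \<in> weak_comps n. inv_kostka n a b \<noteq> 0} \<subseteq> ?w ` ?T"
    proof
      fix a assume "a \<in> {a \<in> weak_comps n. inv_kostka n a b \<noteq> 0}"
      then obtain U where "U \<in> ?T" "?w U = a"
        unfolding inv_kostka_def by (auto elim: sum.not_neutral_contains_not_neutral)
      then show "a \<in> ?w ` ?T" by auto
    qed
    show "\<forall>a\<in>?w ` ?T - {a \<in> weak_comps n. inv_kostka n a b \<noteq> 0}. of_int (inv_kostka n a b) * flag_hom n a = 0"
      using weak by auto
  qed (auto simp: finite_special_snake_tabloids)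
  finally show ?thesis unfolding T by (rule sym)
qed

section \<open>Erasing the smallest letter of a key tableau\<close>

text \<open>As rows decrease weakly, the entries of a co-inversion triple satisfy \<open>i < j < k\<close>.\<close>

definition sskt :: "nat \<Rightarrow> (nat \<Rightarrow> nat) \<Rightarrow> (cell \<Rightarrow> nat) \<Rightarrow> bool" where
  "sskt n b t \<longleftrightarrow>
    (\<forall>r\<in>{1..n}. \<forall>s\<in>{1..n}. \<forall>c. r < s \<longrightarrow> c \<le> b r \<longrightarrow> c \<le> b s \<longrightarrow> t (c, r) \<noteq> t (c, s)) \<and>
    (\<forall>r\<in>{1..n}. \<forall>s\<in>{1..n}. \<forall>c. r < s \<longrightarrow> Suc c \<le> b r \<longrightarrow> c \<le> b s \<longrightarrow> t (c, s) \<noteq> t (Suc c, r)) \<and>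
    (\<forall>r\<in>{1..n}. \<forall>c d. c \<le> d \<longrightarrow> d \<le> b r \<longrightarrow> t (d, r) \<le> t (c, r)) \<and>
    (\<forall>r\<in>{1..n}. \<forall>s\<in>{1..n}. \<forall>c. r < s \<longrightarrow> b s < b r \<longrightarrow> Suc c \<le> b r \<longrightarrow> c \<le> b s \<longrightarrow>
       \<not> (t (Suc c, r) < t (c, s) \<and> t (c, s) < t (c, r))) \<and>
    (\<forall>r\<in>{1..n}. \<forall>s\<in>{1..n}. \<forall>c. r < s \<longrightarrow> b r \<le> b s \<longrightarrow> Suc c \<le> b r \<longrightarrow>
       \<not> (t (Suc c, s) < t (Suc c, r) \<and> t (Suc c, r) < t (c, s)))"

lemma ssktD:
  assumes "sskt n b t"
  shows sskt_column: "\<And>r s c. r \<in> {1..n} \<Longrightarrow> s \<in> {1..n} \<Longrightarrow> r < s \<Longrightarrow> c \<le> b r \<Longrightarrow> c \<le> b s \<Longrightarrow> t (c, r) \<noteq> t (c, s)"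
    and sskt_attack: "\<And>r s c. r \<in> {1..n} \<Longrightarrow> s \<in> {1..n} \<Longrightarrow> r < s \<Longrightarrow> Suc c \<le> b r \<Longrightarrow> c \<le> b s \<Longrightarrow>
       t (c, s) \<noteq> t (Suc c, r)"
    and sskt_row: "\<And>r c d. r \<in> {1..n} \<Longrightarrow> c \<le> d \<Longrightarrow> d \<le> b r \<Longrightarrow> t (d, r) \<le> t (c, r)"
    and sskt_I: "\<And>r s c. r \<in> {1..n} \<Longrightarrow> s \<in> {1..n} \<Longrightarrow> r < s \<Longrightarrow> b s < b r \<Longrightarrow> Suc c \<le> b r \<Longrightarrow> c \<le> b s \<Longrightarrow>
       t (Suc c, r) < t (c, s) \<Longrightarrow> t (c, r) \<le> t (c, s)"
    and sskt_II: "\<And>r s c. r \<in> {1..n} \<Longrightarrow> s \<in> {1..n} \<Longrightarrow> r < s \<Longrightarrow> b r \<le> b s \<Longrightarrow> Suc c \<le> b r \<Longrightarrow>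
       t (Suc c, s) < t (Suc c, r) \<Longrightarrow> t (c, s) \<le> t (Suc c, r)"
proof -
  note conj = assms[unfolded sskt_def]
  note col = conj[THEN conjunct1, rule_format]
    and att = conj[THEN conjunct2, THEN conjunct1, rule_format]
    and row = conj[THEN conjunct2, THEN conjunct2, THEN conjunct1, rule_format]
    and I = conj[THEN conjunct2, THEN conjunct2, THEN conjunct2, THEN conjunct1, rule_format]
    and II = conj[THEN conjunct2, THEN conjunct2, THEN conjunct2, THEN conjunct2, rule_format]
  show "t (c, r) \<noteq> t (c, s)" if "r \<in> {1..n}" "s \<in> {1..n}" "r < s" "c \<le> b r" "c \<le> b s" for r s c
    using col that by simp
  show "t (c, s) \<noteq> t (Suc c, r)" if "r \<in> {1..n}" "s \<in> {1..n}" "r < s" "Suc c \<le> b r" "c \<le> b s" for r s c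
    using att that by simp
  show "t (d, r) \<le> t (c, r)" if "r \<in> {1..n}" "c \<le> d" "d \<le> b r" for r c d
    using row that by simp
  show "t (c, r) \<le> t (c, s)" if "r \<in> {1..n}" "s \<in> {1..n}" "r < s" "b s < b r" "Suc c \<le> b r" "c \<le> b s"
    "t (Suc c, r) < t (c, s)" for r s c
    using I[OF that(1-6)] that(7) by simp
  show "t (c, s) \<le> t (Suc c, r)" if "r \<in> {1..n}" "s \<in> {1..n}" "r < s" "b r \<le> b s" "Suc c \<le> b r"
    "t (Suc c, s) < t (Suc c, r)" for r s c
    using II[OF that(1-5)] that(6) by simp
qed

lemma sskt_cong:
  assumes "\<And>c r. r \<in> {1..n} \<Longrightarrow> c \<le> b r \<Longrightarrow> t (c, r) = t' (c, r)"
  shows "sskt n b t \<longleftrightarrow> sskt n b t'"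
proof -
  have "sskt n b t'" if "sskt n b t" "\<And>c r. r \<in> {1..n} \<Longrightarrow> c \<le> b r \<Longrightarrow> t (c, r) = t' (c, r)" for t t'
    unfolding sskt_def
  proof (intro conjI ballI allI impI)
    fix r s c assume "r \<in> {1..n}" "s \<in> {1..n}" "r < s" "c \<le> b r" "c \<le> b s"
    then show "t' (c, r) \<noteq> t' (c, s)" using sskt_column[OF that(1), of r s c] that(2)[of r c] that(2)[of s c] by simp
  next
    fix r s c assume "r \<in> {1..n}" "s \<in> {1..n}" "r < s" "Suc c \<le> b r" "c \<le> b s"
    then show "t' (c, s) \<noteq> t' (Suc c, r)" using sskt_attack[OF that(1), of r s c] that(2)[of r "Suc c"] that(2)[of s c] by simp
  next
    fix r c d assume "r \<in> {1..n}" "c \<le> d" "d \<le> b r"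
    then show "t' (d, r) \<le> t' (c, r)" using sskt_row[OF that(1), of r c d] that(2)[of r c] that(2)[of r d] by simp
  next
    fix r s c assume *: "r \<in> {1..n}" "s \<in> {1..n}" "r < s" "b s < b r" "Suc c \<le> b r" "c \<le> b s"
    then show "\<not> (t' (Suc c, r) < t' (c, s) \<and> t' (c, s) < t' (c, r))"
      using sskt_I[OF that(1) *] that(2)[of r c] that(2)[of r "Suc c"] that(2)[of s c] by auto
  next
    fix r s c assume *: "r \<in> {1..n}" "s \<in> {1..n}" "r < s" "b r \<le> b s" "Suc c \<le> b r"
    then have "Suc c \<le> b s" "c \<le> b s" by auto
    then show "\<not> (t' (Suc c, s) < t' (Suc c, r) \<and> t' (Suc c, r) < t' (c, s))"
      using sskt_II[OF that(1) *] that(2)[of s c] that(2)[of s "Suc c"] that(2)[of r "Suc c"] * by auto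
  qed
  from this[of t t'] this[of t' t] show ?thesis using assms by (auto simp: atLeastAtMost_iff)
qed

lemma ext_diagram_iff: "(c, r) \<in> ext_diagram n b \<longleftrightarrow> r \<in> {1..n} \<and> c \<le> b r"
  by (cases "c = 0") (auto simp: ext_diagram_def key_diagram_def)

lemma SSKT_iff: "T \<in> SSKT n b \<longleftrightarrow> T \<in> fillings n b \<and> sskt n b (ext_filling T)"
proof -
  let ?t = "ext_filling T"
  have 1: "(\<forall>x\<in>ext_diagram n b. \<forall>y\<in>ext_diagram n b. attacks x y \<longrightarrow> ?t x \<noteq> ?t y) \<longleftrightarrow>
    (\<forall>r\<in>{1..n}. \<forall>s\<in>{1..n}. \<forall>c. r < s \<longrightarrow> c \<le> b r \<longrightarrow> c \<le> b s \<longrightarrow> ?t (c, r) \<noteq> ?t (c, s)) \<and>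
    (\<forall>r\<in>{1..n}. \<forall>s\<in>{1..n}. \<forall>c. r < s \<longrightarrow> Suc c \<le> b r \<longrightarrow> c \<le> b s \<longrightarrow> ?t (c, s) \<noteq> ?t (Suc c, r))"
    (is "?l \<longleftrightarrow> ?r1 \<and> ?r2")
  proof
    assume l: ?l
    have "?t (c, r) \<noteq> ?t (c, s)" if "r \<in> {1..n}" "s \<in> {1..n}" "r < s" "c \<le> b r" "c \<le> b s" for r s c
      using l[rule_format, of "(c, r)" "(c, s)"] that by (simp add: ext_diagram_iff attacks_def)
    moreover have "?t (c, s) \<noteq> ?t (Suc c, r)" if "r \<in> {1..n}" "s \<in> {1..n}" "r < s" "Suc c \<le> b r" "c \<le> b s" for r s c
      using l[rule_format, of "(c, s)" "(Suc c, r)"] that by (simp add: ext_diagram_iff attacks_def)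
    ultimately show "?r1 \<and> ?r2" by blast
  next
    assume r: "?r1 \<and> ?r2"
    note r1 = r[THEN conjunct1, rule_format] and r2 = r[THEN conjunct2, rule_format]
    show ?l
    proof (intro ballI impI)
      fix x y assume x: "x \<in> ext_diagram n b" and y: "y \<in> ext_diagram n b" and xy: "attacks x y"
      obtain c r where x': "x = (c, r)" by (cases x)
      obtain c' s where y': "y = (c', s)" by (cases y)
      have m: "r \<in> {1..n}" "c \<le> b r" "s \<in> {1..n}" "c' \<le> b s"
        using x y by (auto simp: x' y' ext_diagram_iff)
      consider "c = c'" "r < s" | "c = c'" "s < r" | "c' = Suc c" "s < r" | "c = Suc c'" "r < s"
        using xy by (auto simp: x' y' attacks_def elim: linorder_neqE_nat)
      then show "?t x \<noteq> ?t y"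
      proof cases
        case 1
        then show ?thesis using r1[of r s c] m by (simp add: x' y')
      next
        case 2
        then show ?thesis using r1[of s r c] m by (simp add: x' y')
      next
        case 3
        then show ?thesis using r2[of s r c] m by (simp add: x' y')
      next
        case 4
        then show ?thesis using r2[of r s c'] m by (simp add: x' y')
      qed
    qed
  qed
  have 2: "(\<forall>c d r. c \<le> d \<and> (c, r) \<in> ext_diagram n b \<and> (d, r) \<in> ext_diagram n b \<longrightarrow> ?t (d, r) \<le> ?t (c, r))
    \<longleftrightarrow> (\<forall>r\<in>{1..n}. \<forall>c d. c \<le> d \<longrightarrow> d \<le> b r \<longrightarrow> ?t (d, r) \<le> ?t (c, r))" (is "_ \<longleftrightarrow> ?row")
    by (auto simp: ext_diagram_iff)
  have 3: "\<not> has_coinversion_triple n b T \<longleftrightarrow>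
    (\<forall>r\<in>{1..n}. \<forall>s\<in>{1..n}. \<forall>c. r < s \<longrightarrow> b s < b r \<longrightarrow> Suc c \<le> b r \<longrightarrow> c \<le> b s \<longrightarrow>
       \<not> (?t (Suc c, r) < ?t (c, s) \<and> ?t (c, s) < ?t (c, r))) \<and>
    (\<forall>r\<in>{1..n}. \<forall>s\<in>{1..n}. \<forall>c. r < s \<longrightarrow> b r \<le> b s \<longrightarrow> Suc c \<le> b r \<longrightarrow>
       \<not> (?t (Suc c, s) < ?t (Suc c, r) \<and> ?t (Suc c, r) < ?t (c, s)))"
    (is "_ \<longleftrightarrow> ?I \<and> ?II") if row: ?row
  proof -
    have co: "coinv_order (?t (Suc c, r)) j (?t (c, r)) \<longleftrightarrow> ?t (Suc c, r) < j \<and> j < ?t (c, r)"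
      if "r \<in> {1..n}" "Suc c \<le> b r" for c r j
      using row[rule_format, of r c "Suc c"] that by (auto simp: coinv_order_def)
    show ?thesis
    proof (intro iffI conjI)
      assume no: "\<not> has_coinversion_triple n b T"
      show ?I
      proof (intro ballI allI impI)
        fix r s c assume *: "r \<in> {1..n}" "s \<in> {1..n}" "r < s" "b s < b r" "Suc c \<le> b r" "c \<le> b s"
        then have "\<not> coinv_order (?t (c + 1, r)) (?t (c, s)) (?t (c, r))"
          using no unfolding has_coinversion_triple_def by (auto simp: ext_diagram_iff)
        then show "\<not> (?t (Suc c, r) < ?t (c, s) \<and> ?t (c, s) < ?t (c, r))"
          using co[OF *(1,5)] by simp
      qed
      show ?II
      proof (intro ballI allI impI)
        fix r s c assume *: "r \<in> {1..n}" "s \<in> {1..n}" "r < s" "b r \<le> b s" "Suc c \<le> b r"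
        then have s: "Suc c \<le> b s" by simp
        then have "\<not> coinv_order (?t (c + 1, s)) (?t (c + 1, r)) (?t (c, s))"
          using no * unfolding has_coinversion_triple_def by (auto simp: ext_diagram_iff)
        then show "\<not> (?t (Suc c, s) < ?t (Suc c, r) \<and> ?t (Suc c, r) < ?t (c, s))"
          using co[OF *(2) s] by simp
      qed
    next
      assume both: "?I \<and> ?II"
      show "\<not> has_coinversion_triple n b T"
      proof
        assume "has_coinversion_triple n b T"
        then obtain c r s where rs: "r < s" and
          "b r > b s \<and> {(c, r), (c + 1, r), (c, s)} \<subseteq> ext_diagram n b \<and>
            coinv_order (?t (c + 1, r)) (?t (c, s)) (?t (c, r)) \<or>
           b r \<le> b s \<and> {(c + 1, r), (c, s), (c + 1, s)} \<subseteq> ext_diagram n b \<and>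
            coinv_order (?t (c + 1, s)) (?t (c + 1, r)) (?t (c, s))"
          unfolding has_coinversion_triple_def by blast
        then show False
        proof (elim disjE conjE)
          assume *: "b s < b r" "{(c, r), (c + 1, r), (c, s)} \<subseteq> ext_diagram n b"
            "coinv_order (?t (c + 1, r)) (?t (c, s)) (?t (c, r))"
          then have m: "r \<in> {1..n}" "s \<in> {1..n}" "Suc c \<le> b r" "c \<le> b s" by (auto simp: ext_diagram_iff)
          then have "?t (Suc c, r) < ?t (c, s) \<and> ?t (c, s) < ?t (c, r)" using co[OF m(1,3)] *(3) by simp
          then show False using both m rs *(1) by blast
        next
          assume *: "b r \<le> b s" "{(c + 1, r), (c, s), (c + 1, s)} \<subseteq> ext_diagram n b"
            "coinv_order (?t (c + 1, s)) (?t (c + 1, r)) (?t (c, s))"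
          then have m: "r \<in> {1..n}" "s \<in> {1..n}" "Suc c \<le> b r" "Suc c \<le> b s" by (auto simp: ext_diagram_iff)
          then have "?t (Suc c, s) < ?t (Suc c, r) \<and> ?t (Suc c, r) < ?t (c, s)" using co[OF m(2,4)] *(3) by simp
          then show False using both m rs *(1) by blast
        qed
      qed
    qed
  qed
  show ?thesis
  proof (cases ?row)
    case True
    show ?thesis
      unfolding SSKT_def sskt_def mem_Collect_eq 1 2 3[OF True]
      by (rule iffI; elim conjE; intro conjI; assumption)
  next
    case False
    then show ?thesis
      unfolding SSKT_def sskt_def mem_Collect_eq 1 2
      by (intro iffI; elim conjE; simp only:)
  qed
qed

text \<open>A reversed pair in column \<open>c + 1\<close> would, by the second triple condition,
  push \<open>t (c, s)\<close> down to at most \<open>t (Suc c, r)\<close>, which is at most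
  \<open>t (c, r)\<close>, against the induction hypothesis. The start is column 0, where entries
  are row numbers.\<close>

lemma sskt_rows_increase:
  assumes t: "sskt n b t" and zero: "\<And>r. t (0, r) = r"
    and rs: "r \<in> {1..n}" "s \<in> {1..n}" "r < s" "b r \<le> b s" and "c \<le> b r"
  shows "t (c, r) < t (c, s)"
  using \<open>c \<le> b r\<close>
proof (induction c)
  case 0
  then show ?case using zero rs by simp
next
  case (Suc c)
  have "t (c, r) < t (c, s)" using Suc by simp
  moreover have "t (Suc c, r) \<le> t (c, r)" using Suc.prems by (intro sskt_row[OF t rs(1)]) auto
  ultimately have "\<not> t (c, s) \<le> t (Suc c, r)" by simp
  then have "\<not> t (Suc c, s) < t (Suc c, r)" using sskt_II[OF t rs Suc.prems] by blast
  moreover have "t (Suc c, r) \<noteq> t (Suc c, s)"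
    using sskt_column[OF t rs(1-3)] Suc.prems rs(4) by simp
  ultimately show ?case by simp
qed

section \<open>Erasing and appending the smallest letter\<close>

context
  fixes n k :: nat and b d :: "nat \<Rightarrow> nat" and t :: "cell \<Rightarrow> nat"
  assumes k: "1 \<le> k" "k \<le> n" and b: "b \<in> comps_from n k" and zero: "\<And>r. t (0, r) = r"
    and le: "\<And>r. d r \<le> b r"
    and large: "\<And>c r. 1 \<le> c \<Longrightarrow> c \<le> d r \<Longrightarrow> k < t (c, r)"
    and small: "\<And>c r. d r < c \<Longrightarrow> c \<le> b r \<Longrightarrow> t (c, r) = k"
begin

lemma rows_below_empty: "r < k \<Longrightarrow> b r = 0"
  using b by (simp add: comps_from_def)

lemma entries_ge: "1 \<le> c \<Longrightarrow> c \<le> b r \<Longrightarrow> k \<le> t (c, r)"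
  using large[of c r] small[of r c] by (cases "c \<le> d r") auto

text \<open>There are two ways to violate the strip condition. If \<open>b r \<le> b s\<close>,
  entries increase from row \<open>r\<close> to row \<open>s\<close>, so below the \<open>k\<close>
  in \<open>(Suc (d s), s)\<close> there would be an entry less than \<open>k\<close>. Otherwise the
  cells \<open>(b s, s)\<close> and \<open>(Suc (b s), r)\<close> attack each other and both contain
  \<open>k\<close>.\<close>

lemma erase_strip:
  assumes t: "sskt n b t"
  shows "d \<in> strips {k..n} b"
proof -
  have out: "d r = b r" if "r \<notin> {k..n}" for r
    using that le[of r] b by (auto simp: comps_from_def)
  have "b r \<le> d s \<or> b s < d r" if rs: "r \<in> {k..n}" "s \<in> {k..n}" "r < s" "d s < b s" for r s
  proof (rule ccontr)
    assume "\<not> (b r \<le> d s \<or> b s < d r)"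
    then have *: "d s < b r" "d r \<le> b s" by auto
    have rs': "r \<in> {1..n}" "s \<in> {1..n}" using rs k by auto
    show False
    proof (cases "b r \<le> b s")
      case True
      have "t (Suc (d s), r) < t (Suc (d s), s)"
        using * by (intro sskt_rows_increase[OF t zero rs' rs(3) True]) simp
      moreover have "t (Suc (d s), s) = k" using rs(4) by (intro small) auto
      moreover have "k \<le> t (Suc (d s), r)" using * by (intro entries_ge) auto
      ultimately show False by simp
    next
      case False
      have "t (b s, s) = k" using rs(4) by (intro small) auto
      moreover have "t (Suc (b s), r) = k" using * False by (intro small) auto
      ultimately show False
        using sskt_attack[OF t rs' rs(3), of "b s"] False by simp
    qed
  qed
  then show ?thesis using le out by (simp add: strips_def bounded_funs_def)
qed

lemma erase_first_row:
  assumes t: "sskt n b t"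
  shows "d k = 0"
proof (rule ccontr)
  assume "d k \<noteq> 0"
  then have "1 \<le> d k" "1 \<le> b k" using le[of k] by auto
  then have "k < t (1, k)" "t (1, k) \<le> t (0, k)"
    using large[of 1 k] sskt_row[OF t, of k 0 1] k by auto
  then show False using zero by simp
qed

text \<open>The erasure turns \<open>b s < b r\<close> into \<open>d r \<le> d s\<close>, so
  \<open>sskt_rows_increase\<close> is of no help. The induction descends from column
  \<open>d r\<close>: the \<open>k\<close> just behind the surviving part of row \<open>r\<close>
  starts the comparison, and the first triple condition carries it to the left.\<close>

lemma upper_row_larger:
  assumes t: "sskt n b t" and rs: "r \<in> {1..n}" "s \<in> {1..n}" "r < s" "b s < b r" "d r \<le> d s"
  shows "c \<le> d r \<Longrightarrow> t (c, r) < t (c, s)"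
proof (induction rule: inc_induct)
  have bs: "d r \<le> b s" using rs(5) le[of s] by simp
  have rk: "k \<le> r" using rs(4) rows_below_empty[of r] by (cases "r < k") auto
  have attack: "t (c, s) \<noteq> t (Suc c, r)" if "c \<le> d r" for c
    using that bs rs(4) by (intro sskt_attack[OF t rs(1-3)]) auto
  have triple: "t (c, r) \<le> t (c, s)" if "c \<le> d r" "t (Suc c, r) < t (c, s)" for c
    using that bs rs(4) by (intro sskt_I[OF t rs(1-4)]) auto
  have column: "t (c, r) \<noteq> t (c, s)" if "c \<le> d r" for c
    using that bs rs(4) by (intro sskt_column[OF t rs(1-3)]) auto
  {
    case base
    have "t (Suc (d r), r) = k" using bs rs(4) by (intro small) auto
    moreover have "k \<le> t (d r, s)"
    proof (cases "d r = 0")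
      case True
      then show ?thesis using zero rk rs(3) by simp
    next
      case False
      then show ?thesis using bs by (intro entries_ge) auto
    qed
    ultimately have "t (Suc (d r), r) < t (d r, s)" using attack[of "d r"] by simp
    then show ?case using triple[of "d r"] column[of "d r"] by simp
  next
    case (step c)
    have "t (Suc c, s) \<le> t (c, s)" using step.hyps bs by (intro sskt_row[OF t rs(2)]) auto
    then have "t (Suc c, r) < t (c, s)" using step.IH by simp
    then show ?case using triple[of c] column[of c] step.hyps by simp
  }
qed

text \<open>The kind of a triple depends on which row is longer, and this can change. The strip
  condition makes \<open>d s < d r\<close> imply \<open>b s < b r\<close>, so the first kind is
  inherited. A pair with \<open>d r \<le> d s\<close> may come from either kind, but in both cases
  its entries increase from row \<open>r\<close> to row \<open>s\<close>, which excludes a triple of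
  the second kind.\<close>

lemma erase_sskt:
  assumes t: "sskt n b t"
  shows "sskt n d t"
  unfolding sskt_def
proof (intro conjI ballI allI impI)
  fix r s c assume "r \<in> {1..n}" "s \<in> {1..n}" "r < s" "c \<le> d r" "c \<le> d s"
  then show "t (c, r) \<noteq> t (c, s)" using le le_trans sskt_column[OF t] by meson
next
  fix r s c assume "r \<in> {1..n}" "s \<in> {1..n}" "r < s" "Suc c \<le> d r" "c \<le> d s"
  then show "t (c, s) \<noteq> t (Suc c, r)" using le le_trans sskt_attack[OF t] by meson
next
  fix r c e assume "r \<in> {1..n}" "c \<le> e" "e \<le> d r"
  then show "t (e, r) \<le> t (c, r)" using le le_trans sskt_row[OF t] by meson
next
  fix r s c assume rs: "r \<in> {1..n}" "s \<in> {1..n}" "r < s" "d s < d r" "Suc c \<le> d r" "c \<le> d s"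
  have c: "Suc c \<le> b r" "c \<le> b s" using rs le[of r] le[of s] by auto
  have "b s < b r"
  proof (rule ccontr)
    assume "\<not> b s < b r"
    then have "d s < b s" using rs(4) le[of r] by simp
    moreover have "r \<in> {k..n}" "s \<in> {k..n}"
      using rs rows_below_empty[of r] c by (cases "r < k", auto)+
    ultimately have "b r \<le> d s \<or> b s < d r"
      using erase_strip[OF t] rs(3) by (simp add: strips_def)
    then show False using rs(4) le[of r] \<open>\<not> b s < b r\<close> by auto
  qed
  then show "\<not> (t (Suc c, r) < t (c, s) \<and> t (c, s) < t (c, r))"
    using sskt_I[OF t rs(1-3) _ c] by auto
next
  fix r s c assume rs: "r \<in> {1..n}" "s \<in> {1..n}" "r < s" "d r \<le> d s" "Suc c \<le> d r"
  have "t (Suc c, r) < t (Suc c, s)"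
  proof (cases "b r \<le> b s")
    case True
    then show ?thesis using rs le[of r] by (intro sskt_rows_increase[OF t zero rs(1-3) True]) auto
  next
    case False
    then show ?thesis using upper_row_larger[OF t rs(1-3) _ rs(4,5)] by simp
  qed
  then show "\<not> (t (Suc c, s) < t (Suc c, r) \<and> t (Suc c, r) < t (c, s))" by simp
qed

text \<open>Two copies of \<open>k\<close> in attacking position would contradict the strip
  condition. In a triple the two larger entries exceed \<open>k\<close> and hence lie in
  \<open>d\<close>. If \<open>b r \<le> b s\<close>, the strip condition gives
  \<open>d r \<le> d s\<close>, so the kind is preserved; if the kind changes from the first to the
  second, the rows increase in \<open>d\<close> and no triple arises.\<close>

lemma append_sskt:
  assumes t: "sskt n d t" and strip: "d \<in> strips {k..n} b" and dk: "d k = 0"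
  shows "sskt n b t"
proof -
  have st: "b r \<le> d s \<or> b s < d r" if "r < s" "d s < b s" for r s
  proof (cases "r \<in> {k..n}")
    case True
    have "s \<in> {k..n}" using that strip by (auto simp: strips_def bounded_funs_def)
    then show ?thesis using that strip True by (simp add: strips_def)
  next
    case False
    then show ?thesis using b by (simp add: comps_from_def)
  qed
  \<comment> \<open>Apart from the appended cells, only the cell \<open>(0, k)\<close> of the
    extended diagram holds \<open>k\<close>.\<close>
  have at_k: "d r < c \<or> c = 0 \<and> r = k" if "t (c, r) = k" "c \<le> b r" for c r
    using that large[of c r] zero[of r] by (cases "c = 0"; cases "c \<le> d r") auto
  have row_ge: "k \<le> t (c, r)" if "c \<le> b r" "0 < b r" for c r
  proof (cases "c = 0")
    case True
    then show ?thesis using rows_below_empty[of r] that(2) by (cases "r < k") (auto simp: zero)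
  next
    case False
    then show ?thesis using that by (intro entries_ge) auto
  qed
  have gt: "c \<le> d r" if "k < t (c, r)" "c \<le> b r" for c r
    using that small[of r c] by (cases "c \<le> d r") auto
  have row: "t (e, r) \<le> t (c, r)" if r: "r \<in> {1..n}" "c \<le> e" "e \<le> b r" for r c e
  proof (cases "e \<le> d r")
    case True
    then show ?thesis using sskt_row[OF t] r by blast
  next
    case False
    then have "t (e, r) = k" using r(3) by (intro small) auto
    then show ?thesis using row_ge[of c r] False r by (cases "b r = 0") auto
  qed
  show ?thesis
    unfolding sskt_def
  proof (intro conjI ballI allI impI)
    fix r s c assume rs: "r \<in> {1..n}" "s \<in> {1..n}" "r < s" "c \<le> b r" "c \<le> b s"
    show "t (c, r) \<noteq> t (c, s)"
    proof (cases "c \<le> d r \<and> c \<le> d s")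
      case True
      then show ?thesis using sskt_column[OF t] rs by blast
    next
      case False
      show ?thesis
      proof
        assume eq: "t (c, r) = t (c, s)"
        then have "t (c, r) = k" "t (c, s) = k" using False small[of r c] small[of s c] rs by auto
        then have "d r < c" "d s < c" using at_k[of c r] at_k[of c s] rs(3-5) False by auto
        then show False using st[OF rs(3)] rs by auto
      qed
    qed
  next
    fix r s c assume rs: "r \<in> {1..n}" "s \<in> {1..n}" "r < s" "Suc c \<le> b r" "c \<le> b s"
    have rk: "k \<le> r" using rs(4) rows_below_empty[of r] by (cases "r < k") auto
    show "t (c, s) \<noteq> t (Suc c, r)"
    proof (cases "Suc c \<le> d r \<and> c \<le> d s")
      case True
      then show ?thesis using sskt_attack[OF t] rs by blast
    next
      case False
      show ?thesis
      proof
        assume eq: "t (c, s) = t (Suc c, r)"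
        then have "t (Suc c, r) = k" "t (c, s) = k" using False small[of r "Suc c"] small[of s c] rs by auto
        then have "d r < Suc c" "d s < c" using at_k[of "Suc c" r] at_k[of c s] rs(3-5) rk by auto
        then show False using st[OF rs(3)] rs by auto
      qed
    qed
  next
    fix r c e assume "r \<in> {1..n}" "c \<le> e" "e \<le> b r"
    then show "t (e, r) \<le> t (c, r)" by (rule row)
  next
    fix r s c assume rs: "r \<in> {1..n}" "s \<in> {1..n}" "r < s" "b s < b r" "Suc c \<le> b r" "c \<le> b s"
    show "\<not> (t (Suc c, r) < t (c, s) \<and> t (c, s) < t (c, r))"
    proof
      assume *: "t (Suc c, r) < t (c, s) \<and> t (c, s) < t (c, r)"
      have "k \<le> t (Suc c, r)" using rs by (intro row_ge) auto
      then have c: "c \<le> d s" "c \<le> d r" using * rs by (auto intro!: gt)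
      show False
      proof (cases "d r \<le> d s")
        case True
        then show False using sskt_rows_increase[OF t zero rs(1-3) True c(2)] * by simp
      next
        case False
        then have "Suc c \<le> d r" using c by simp
        then show False using sskt_I[OF t rs(1-3) _ _ c(1)] False * by auto
      qed
    qed
  next
    fix r s c assume rs: "r \<in> {1..n}" "s \<in> {1..n}" "r < s" "b r \<le> b s" "Suc c \<le> b r"
    show "\<not> (t (Suc c, s) < t (Suc c, r) \<and> t (Suc c, r) < t (c, s))"
    proof
      assume *: "t (Suc c, s) < t (Suc c, r) \<and> t (Suc c, r) < t (c, s)"
      have "k \<le> t (Suc c, s)" using rs by (intro row_ge) auto
      then have c: "Suc c \<le> d r" using * rs by (auto intro!: gt)
      have "d r \<le> d s"
      proof (rule ccontr)
        assume "\<not> d r \<le> d s"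
        then show False using st[OF rs(3)] rs(4) le[of r] by auto
      qed
      then show False using sskt_II[OF t rs(1-3) _ c] * by auto
    qed
  qed
qed

end

lemma down_closed_eq_atMost:
  assumes "finite A" "\<And>c. c \<in> A \<Longrightarrow> 1 \<le> c" "\<And>c c'. c \<in> A \<Longrightarrow> 1 \<le> c' \<Longrightarrow> c' \<le> c \<Longrightarrow> c' \<in> A"
  shows "A = {1..card A}"
proof (cases "A = {}")
  case False
  then have "Max A \<in> A" using assms(1) by simp
  have eq: "A = {1..Max A}"
  proof (intro equalityI subsetI)
    fix c assume "c \<in> A"
    then show "c \<in> {1..Max A}" using assms(2) Max_ge[OF assms(1)] by simp
  next
    fix c assume "c \<in> {1..Max A}"
    then show "c \<in> A" using assms(3)[OF \<open>Max A \<in> A\<close>] by simp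
  qed
  have "card A = Max A" using arg_cong[OF eq, of card] by (simp only: card_atLeastAtMost)
  with eq show ?thesis by (simp only:)
qed simp

section \<open>The branching rule for key polynomials\<close>

definition key_tableaux_above :: "nat \<Rightarrow> nat \<Rightarrow> (nat \<Rightarrow> nat) \<Rightarrow> (cell \<Rightarrow> nat) set" where
  "key_tableaux_above n k b = {T \<in> SSKT n b. \<forall>x\<in>key_diagram n b. k \<le> T x}"

definition key_above :: "nat \<Rightarrow> nat \<Rightarrow> (nat \<Rightarrow> nat) \<Rightarrow> int_mpoly" where
  "key_above n k b = (\<Sum>T\<in>key_tableaux_above n k b. x_pow n (filling_weight n b T))"

text \<open>Rows decrease weakly, so the letters above \<open>k\<close> occupy the left end of each
  row and their number is the length that survives.\<close>

definition erase_letter :: "nat \<Rightarrow> nat \<Rightarrow> (nat \<Rightarrow> nat) \<Rightarrow> (cell \<Rightarrow> nat) \<Rightarrow> nat \<Rightarrow> nat" where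
  "erase_letter n k b T r = card {c. (c, r) \<in> key_diagram n b \<and> k < T (c, r)}"

text \<open>The value \<open>undefined\<close> off the larger diagram keeps the result extensional,
  as \<open>fillings\<close> requires.\<close>

definition append_letter :: "nat \<Rightarrow> nat \<Rightarrow> (nat \<Rightarrow> nat) \<Rightarrow> (nat \<Rightarrow> nat) \<Rightarrow> (cell \<Rightarrow> nat) \<Rightarrow> cell \<Rightarrow> nat" where
  "append_letter n k b d T = (\<lambda>x. if x \<in> key_diagram n d then T x else if x \<in> key_diagram n b then k else undefined)"

lemma finite_key_tableaux_above: "finite (key_tableaux_above n k b)"
  by (rule finite_subset[OF _ finite_SSKT[of n b]]) (auto simp: key_tableaux_above_def)

lemma ext_filling_simps: "ext_filling T (0, r) = r" "1 \<le> c \<Longrightarrow> ext_filling T (c, r) = T (c, r)"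
  by (simp_all add: ext_filling_def)

context
  fixes n k :: nat and b :: "nat \<Rightarrow> nat"
  assumes k: "1 \<le> k" "k \<le> n" and b: "b \<in> comps_from n k"
begin

lemma erase_properties:
  assumes T: "T \<in> key_tableaux_above n k b"
  defines "d \<equiv> erase_letter n k b T"
  shows "d \<in> strips {k..n} b" "d k = 0" "restrict T (key_diagram n d) \<in> key_tableaux_above n (Suc k) d"
    "append_letter n k b d (restrict T (key_diagram n d)) = T"
proof -
  let ?t = "ext_filling T" and ?D = "key_diagram n"
  note bw = comps_from_weak[OF k b]
  have S: "sskt n b ?t" and fill: "T \<in> ?D b \<rightarrow>\<^sub>E {1..n}" and ge: "\<And>x. x \<in> ?D b \<Longrightarrow> k \<le> T x"
    using T by (auto simp: key_tableaux_above_def SSKT_iff fillings_def)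
  have mem: "(c, r) \<in> ?D b \<longleftrightarrow> 1 \<le> c \<and> c \<le> b r" for c r
    using bw by (rule mem_key_diagram_weak)
  have rn: "r \<in> {1..n}" if "(c, r) \<in> ?D b" for c r using that by (simp add: key_diagram_def)
  have d: "{c. (c, r) \<in> ?D b \<and> k < T (c, r)} = {1..d r}" for r
    unfolding d_def erase_letter_def
  proof (rule down_closed_eq_atMost)
    show "finite {c. (c, r) \<in> ?D b \<and> k < T (c, r)}"
      by (rule finite_subset[of _ "{..b r}"]) (auto simp: mem)
    fix c c' assume c: "c \<in> {c. (c, r) \<in> ?D b \<and> k < T (c, r)}" "1 \<le> c'" "c' \<le> c"
    then have "T (c, r) \<le> T (c', r)"
      using sskt_row[OF S rn, of c r c' c] by (auto simp: mem ext_filling_simps)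
    then show "c' \<in> {c. (c, r) \<in> ?D b \<and> k < T (c, r)}" using c by (auto simp: mem)
  qed (auto simp: mem)
  have d': "(c, r) \<in> ?D b \<and> k < T (c, r) \<longleftrightarrow> 1 \<le> c \<and> c \<le> d r" for c r
    using d[of r] by (auto simp: set_eq_iff)
  have le: "d r \<le> b r" for r
    using d'[of "d r" r] by (cases "d r = 0") (auto simp: mem)
  have large: "k < ?t (c, r)" if "1 \<le> c" "c \<le> d r" for c r
    using d'[of c r] that by (auto simp: ext_filling_simps)
  have small: "?t (c, r) = k" if "d r < c" "c \<le> b r" for c r
    using d'[of c r] ge[of "(c, r)"] that by (auto simp: ext_filling_simps mem)
  note props = k b ext_filling_simps(1) le large small
  show "d \<in> strips {k..n} b" by (rule erase_strip[OF props S])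
  show "d k = 0" by (rule erase_first_row[OF props S])
  have dw: "d \<in> weak_comps n" using le bounded_weak[OF k b] by blast
  have memd: "(c, r) \<in> ?D d \<longleftrightarrow> 1 \<le> c \<and> c \<le> d r" for c r
    using dw by (rule mem_key_diagram_weak)
  have sub: "?D d \<subseteq> ?D b" using le by (rule key_diagram_mono)
  have "sskt n d (ext_filling (restrict T (?D d)))"
  proof -
    have "sskt n d ?t" by (rule erase_sskt[OF props S])
    moreover have "?t (c, r) = ext_filling (restrict T (?D d)) (c, r)" if "c \<le> d r" for c r
      using that by (cases "c = 0") (auto simp: ext_filling_def memd)
    ultimately show ?thesis using sskt_cong[of n d ?t "ext_filling (restrict T (?D d))"] by blast
  qed
  moreover have "restrict T (?D d) \<in> fillings n d"
    using fill sub by (auto simp: fillings_def PiE_iff)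
  moreover have "Suc k \<le> restrict T (?D d) x" if "x \<in> ?D d" for x
    using that d'[of "fst x" "snd x"] memd[of "fst x" "snd x"] by simp
  ultimately show "restrict T (?D d) \<in> key_tableaux_above n (Suc k) d"
    by (simp add: key_tableaux_above_def SSKT_iff)
  show "append_letter n k b d (restrict T (?D d)) = T"
  proof
    fix x :: cell
    obtain c r where x: "x = (c, r)" by (cases x)
    show "append_letter n k b d (restrict T (?D d)) x = T x"
    proof (cases "x \<in> ?D b")
      case True
      then show ?thesis
        using small[of r c] by (cases "x \<in> ?D d") (auto simp: append_letter_def x mem memd ext_filling_simps)
    next
      case False
      then show ?thesis using PiE_arb[OF fill False] sub by (auto simp: append_letter_def)
    qed
  qed
qed

lemma append_properties:
  assumes d: "d \<in> strips {k..n} b" "d k = 0" and T: "T \<in> key_tableaux_above n (Suc k) d"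
  shows "append_letter n k b d T \<in> key_tableaux_above n k b" "erase_letter n k b (append_letter n k b d T) = d"
    "restrict (append_letter n k b d T) (key_diagram n d) = T"
    "x_pow n (filling_weight n b (append_letter n k b d T)) =
       X k ^ (sum b {k..n} - sum d {k..n}) * x_pow n (filling_weight n d T)"
proof -
  let ?A = "append_letter n k b d T" and ?D = "key_diagram n"
  note bw = comps_from_weak[OF k b]
  have S: "sskt n d (ext_filling T)" and fill: "T \<in> ?D d \<rightarrow>\<^sub>E {1..n}" and ge: "\<And>x. x \<in> ?D d \<Longrightarrow> Suc k \<le> T x"
    using T by (auto simp: key_tableaux_above_def SSKT_iff fillings_def)
  have le: "d r \<le> b r" for r using d(1) by (simp add: strips_def bounded_funs_def)
  have dw: "d \<in> weak_comps n" using le bounded_weak[OF k b] by blast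
  have mem: "(c, r) \<in> ?D b \<longleftrightarrow> 1 \<le> c \<and> c \<le> b r" for c r
    using bw by (rule mem_key_diagram_weak)
  have memd: "(c, r) \<in> ?D d \<longleftrightarrow> 1 \<le> c \<and> c \<le> d r" for c r
    using dw by (rule mem_key_diagram_weak)
  have sub: "?D d \<subseteq> ?D b" using le by (rule key_diagram_mono)
  have large: "k < ext_filling ?A (c, r)" if "1 \<le> c" "c \<le> d r" for c r
    using that ge[of "(c, r)"] by (auto simp: ext_filling_simps append_letter_def memd)
  have small: "ext_filling ?A (c, r) = k" if "d r < c" "c \<le> b r" for c r
    using that by (auto simp: ext_filling_simps append_letter_def memd mem)
  have "ext_filling T (c, r) = ext_filling ?A (c, r)" if "c \<le> d r" for c r
    using that by (cases "c = 0") (auto simp: ext_filling_def append_letter_def memd)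
  then have "sskt n d (ext_filling ?A)"
    using S sskt_cong[of n d "ext_filling T" "ext_filling ?A"] by blast
  then have "sskt n b (ext_filling ?A)"
    using d by (rule append_sskt[OF k b, where d = d and t = "ext_filling ?A", rotated -3])
      (use le large small in \<open>simp_all only: ext_filling_simps(1)\<close>)
  moreover have "?A \<in> fillings n b"
    using fill sub k by (auto simp: fillings_def PiE_iff extensional_def append_letter_def)
  moreover have "k \<le> ?A x" if "x \<in> ?D b" for x
    using that ge[of x] by (auto simp: append_letter_def)
  ultimately show "?A \<in> key_tableaux_above n k b"
    by (simp add: key_tableaux_above_def SSKT_iff)
  show "erase_letter n k b ?A = d"
  proof
    fix r
    have "{c. (c, r) \<in> ?D b \<and> k < ?A (c, r)} = {1..d r}"
      using ge le[of r] by (auto simp: append_letter_def mem memd Suc_le_eq split: if_splits)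
    then show "erase_letter n k b ?A r = d r" by (simp add: erase_letter_def)
  qed
  show "restrict ?A (?D d) = T"
  proof
    fix x
    show "restrict ?A (?D d) x = T x"
      using PiE_arb[OF fill, of x] by (simp add: append_letter_def)
  qed
  have wk: "filling_weight n d T k = 0"
  proof -
    have "{x \<in> ?D d. T x = k} = {}" using ge by fastforce
    then show ?thesis by (simp only: filling_weight_def card.empty)
  qed
  have "{x \<in> ?D b. ?A x = k} = ?D b - ?D d"
    using ge sub by (auto simp: append_letter_def Suc_le_eq split: if_splits)
  then have wk': "filling_weight n b ?A k = sum b {k..n} - sum d {k..n}"
  proof -
    have "filling_weight n b ?A k = sum b {1..n} - sum d {1..n}"
      using sub \<open>{x \<in> ?D b. ?A x = k} = ?D b - ?D d\<close>
      by (simp add: filling_weight_def card_Diff_subset finite_key_diagram card_key_diagram)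
    then show ?thesis
      using strips_comps_eq(2)[OF b k(1)] strips_comps_eq(2)[OF strips_comps[OF b d(1)] k(1)] by simp
  qed
  have wj: "filling_weight n b ?A j = filling_weight n d T j" if "j \<noteq> k" for j
  proof -
    have "{x \<in> ?D b. ?A x = j} = {x \<in> ?D d. T x = j}"
      using that sub by (auto simp: append_letter_def split: if_splits)
    then show ?thesis by (simp add: filling_weight_def)
  qed
  have kk: "k \<in> {1..n}" using k by simp
  show "x_pow n (filling_weight n b ?A) = X k ^ (sum b {k..n} - sum d {k..n}) * x_pow n (filling_weight n d T)"
    unfolding x_pow_def prod.remove[OF finite_atLeastAtMost kk] wk wk' using wj by simp
qed

theorem key_above_branching:
  "key_above n k b = (\<Sum>d | d \<in> strips {k..n} b \<and> d k = 0.
     X k ^ (sum b {k..n} - sum d {k..n}) * key_above n (Suc k) d)"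
proof -
  let ?I = "{d. d \<in> strips {k..n} b \<and> d k = 0}"
  have fin: "finite ?I" by (rule finite_subset[OF _ finite_strips[of "{k..n}" b]]) auto
  have "key_above n k b = (\<Sum>(d, T)\<in>(SIGMA d:?I. key_tableaux_above n (Suc k) d).
      X k ^ (sum b {k..n} - sum d {k..n}) * x_pow n (filling_weight n d T))"
    unfolding key_above_def
  proof (rule sum.reindex_bij_witness[where
      i = "\<lambda>(d, T). append_letter n k b d T" and
      j = "\<lambda>T. (erase_letter n k b T, restrict T (key_diagram n (erase_letter n k b T)))"])
    fix T assume T: "T \<in> key_tableaux_above n k b"
    note e = erase_properties[OF T]
    show "(case (erase_letter n k b T, restrict T (key_diagram n (erase_letter n k b T))) of (d, T) \<Rightarrow> append_letter n k b d T) = T"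
      using e(4) by simp
    show "(erase_letter n k b T, restrict T (key_diagram n (erase_letter n k b T))) \<in>
        (SIGMA d:?I. key_tableaux_above n (Suc k) d)"
      using e(1-3) by simp
    show "(case (erase_letter n k b T, restrict T (key_diagram n (erase_letter n k b T))) of (d, T) \<Rightarrow>
        X k ^ (sum b {k..n} - sum d {k..n}) * x_pow n (filling_weight n d T)) = x_pow n (filling_weight n b T)"
      using append_properties(4)[OF e(1-3)] e(4) by simp
  next
    fix dT assume "dT \<in> (SIGMA d:?I. key_tableaux_above n (Suc k) d)"
    then obtain d T where dT: "dT = (d, T)" "d \<in> strips {k..n} b" "d k = 0" "T \<in> key_tableaux_above n (Suc k) d"
      by auto
    note a = append_properties[OF dT(2-4)]
    show "(case dT of (d, T) \<Rightarrow> append_letter n k b d T) \<in> key_tableaux_above n k b"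
      using a(1) dT(1) by simp
    show "(erase_letter n k b (case dT of (d, T) \<Rightarrow> append_letter n k b d T),
        restrict (case dT of (d, T) \<Rightarrow> append_letter n k b d T)
          (key_diagram n (erase_letter n k b (case dT of (d, T) \<Rightarrow> append_letter n k b d T)))) = dT"
      using a(2,3) dT(1) by simp
  qed
  then show ?thesis
    using fin by (simp add: sum.Sigma[symmetric] finite_key_tableaux_above key_above_def sum_distrib_left)
qed

end

lemma key_above_one: "key_above n 1 b = key_polynomial n b"
proof -
  have "key_tableaux_above n 1 b = SSKT n b"
    by (auto simp: key_tableaux_above_def SSKT_def fillings_def PiE_iff Pi_iff)
  then show ?thesis by (simp add: key_above_def key_polynomial_def)
qed

lemma key_polynomial_zero: "key_polynomial n (\<lambda>r. 0) = 1"
proof -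
  have D: "key_diagram n (\<lambda>r. 0) = {}" by (auto simp: key_diagram_def)
  have "sskt n (\<lambda>r. 0) (ext_filling (\<lambda>x. undefined))"
    by (auto simp: sskt_def ext_filling_def)
  then have "SSKT n (\<lambda>r. 0) = {\<lambda>x. undefined}"
    by (auto simp: SSKT_iff fillings_def D)
  then show ?thesis by (simp add: key_polynomial_def x_pow_def filling_weight_def D)
qed

theorem theorem7p6:
  fixes n :: nat and b :: "nat \<Rightarrow> nat"
  assumes "n \<ge> 1" and "b \<in> weak_comps n"
  shows "key_polynomial n b =
    (\<Sum>a | a \<in> weak_comps n \<and> inv_kostka n a b \<noteq> 0. of_int (inv_kostka n a b) * flag_hom n a)"
proof -
  interpret key_branching n "key_above n"
    by unfold_locales (rule key_above_branching)
  have "key_above n 1 b = (\<Sum>U\<in>tabloids_from n 1 b. \<Prod>i\<in>{1..n}. of_int (snake_sign (U i)) * complete_hom (card (U i)) i)"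
  proof (rule tabloid_expansion)
    show "key_above n 1 (\<lambda>r. 0) = 1"
      by (simp only: key_above_one key_polynomial_zero)
  qed (use assms in \<open>simp_all add: weak_comps_eq_comps\<close>)
  then show ?thesis by (simp only: key_above_one sum_inv_kostka)
qed

end
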